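(* Let $F$ and $G$ be $\varphi$-functions, and $0<p<\infty$. (i) If the lower Boyd index satisfies $p(L_{F,G})>p$, and if $G\succ H^{-1}\circ T^p$ for some $N$-function $H$ satisfying condition $(J)$, then $L_{F,G}$ is $p$-convex. (ii) If $L_{F,G}$ is $p$-convex, then $p(L_{F,G})\ge p$, and $G\succ H^{-1}\circ T^p$ for some $N$-function $H$ satisfying condition $(J)$.
   Context: A $\varphi$-function is a continuous, strictly increasing function $F:[0,\infty)\to[0,\infty)$ with $F(0)=0$ and $\lim_{t\to\infty}F(t)=\infty$. $T^p$ denotes $t\mapsto t^p$. Two $\varphi$-functions $F,G$ are equivalent if for some $c<\infty$, $F(t/c)\le G(t)\le F(ct)$ for all $t\ge0$. For $\varphi$-functions $F,G$, write $G\succ F$ (and $F\prec G$) if $G\circ F^{-1}$ is equivalent to a convex function. An $N$-function is a $\varphi$-function equivalent to a $\varphi$-function $F_0$ such that $F_0(t)/t$ is strictly increasing, $F_0(t)/t\to\infty$ as $t\to\infty$, and $F_0(t)/t\to0$ as $t\to0$. A $\varphi$-function $H^*$ is complementary to $H$ if for some $c<\infty$, $t/c\le H^{-1}(t)\,(H^* )^{-1}(t)\le ct$ for all $t\ge0$. For a $\varphi$-function $F$ put $\tilde F(t)=1/F(1/t)$ for $t>0$, $\tilde F(0)=0$. Functions live on $[0,\infty)$ with Lebesgue measure $\lambda$; $f^*(x)=\sup\{t:\lambda(|f|\ge t)\ge x\}$. Luxemburg functional: $\|f\|_G=\inf\{c>0:\int_0^\infty G(|f(x)|/c)\,dx\le1\}$.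 An $N$-function $H$ satisfies condition $(J)$ if, for a function $H^*$ complementary to $H$, the function $x\mapsto 1/(\widetilde{H^*})^{-1}(x)$ has finite Luxemburg functional $\|\cdot\|_{H^*}$. Orlicz--Lorentz functional: $\|f\|_{F,G}=\|f^*\circ\tilde F\circ\tilde G^{-1}\|_G$, space $L_{F,G}=\{f:\|f\|_{F,G}<\infty\}$. Dilation operators $d_af(x)=f(ax)$, $\|d_a\|_{X\to X}=\sup\{\|d_af\|_X/\|f\|_X:0<\|f\|_X<\infty\}$; lower Boyd index $p(X)=\sup\{p:\exists c<\infty,\ \|d_a\|_{X\to X}\le c\,a^{-1/p}\ \forall a<1\}$. $X$ is $p$-convex if there is $C<\infty$ with $\|(\sum_{i=1}^n|f_i|^p)^{1/p}\|_X\le C(\sum_{i=1}^n\|f_i\|_X^p)^{1/p}$ for all $n$ and $f_1,\dots,f_n\in X$. *)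

theory Defs
  imports "HOL-Analysis.Analysis"
begin

text \<open>All functions live on [0,\<infinity>); values at negative arguments are irrelevant.\<close>

definition phi_function :: "(real \<Rightarrow> real) \<Rightarrow> bool" where
  "phi_function F \<longleftrightarrow> continuous_on {0..} F \<and> strict_mono_on {0..} F \<and> F 0 = 0
     \<and> (\<forall>t\<ge>0. F t \<ge> 0) \<and> filterlim F at_top at_top"

definition phi_inv :: "(real \<Rightarrow> real) \<Rightarrow> real \<Rightarrow> real" where
  "phi_inv F y = (THE x. 0 \<le> x \<and> F x = y)"

definition phi_equiv :: "(real \<Rightarrow> real) \<Rightarrow> (real \<Rightarrow> real) \<Rightarrow> bool" where
  "phi_equiv F G \<longleftrightarrow> (\<exists>c>0. \<forall>t\<ge>0. F (t / c) \<le> G t \<and> G t \<le> F (c * t))"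

definition phi_succ :: "(real \<Rightarrow> real) \<Rightarrow> (real \<Rightarrow> real) \<Rightarrow> bool" where
  "phi_succ G F \<longleftrightarrow> (\<exists>K. convex_on {0..} K \<and> phi_equiv (\<lambda>t. G (phi_inv F t)) K)"

definition N_function :: "(real \<Rightarrow> real) \<Rightarrow> bool" where
  "N_function H \<longleftrightarrow> phi_function H \<and>
     (\<exists>F0. phi_function F0 \<and> strict_mono_on {0<..} (\<lambda>t. F0 t / t)
        \<and> filterlim (\<lambda>t. F0 t / t) at_top at_top
        \<and> ((\<lambda>t. F0 t / t) \<longlongrightarrow> 0) (at_right 0)
        \<and> phi_equiv H F0)"

definition complementary :: "(real \<Rightarrow> real) \<Rightarrow> (real \<Rightarrow> real) \<Rightarrow> bool" where
  "complementary H Hs \<longleftrightarrow> phi_function Hs \<and>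
     (\<exists>c>0. \<forall>t\<ge>0. t / c \<le> phi_inv H t * phi_inv Hs t \<and> phi_inv H t * phi_inv Hs t \<le> c * t)"

definition tilde :: "(real \<Rightarrow> real) \<Rightarrow> real \<Rightarrow> real" where
  "tilde F t = (if t > 0 then 1 / F (1 / t) else 0)"

text \<open>Luxemburg functional on [0,\<infinity>) with Lebesgue measure (value \<infinity> if no c works).\<close>
definition lux :: "(real \<Rightarrow> real) \<Rightarrow> (real \<Rightarrow> real) \<Rightarrow> ennreal" where
  "lux G f = Inf {ennreal c | c. c > 0 \<and>
      (\<integral>\<^sup>+ x. indicator {0..} x * ennreal (G (\<bar>f x\<bar> / c)) \<partial>lborel) \<le> 1}"

definition condJ :: "(real \<Rightarrow> real) \<Rightarrow> bool" where
  "condJ H \<longleftrightarrow> (\<exists>Hs. complementary H Hs \<and> lux Hs (\<lambda>x. 1 / phi_inv (tilde Hs) x) < \<infinity>)"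

definition level_set :: "(real \<Rightarrow> real) \<Rightarrow> real \<Rightarrow> real set" where
  "level_set f x = {t. ennreal x \<le> emeasure lborel {y \<in> {0..}. t \<le> \<bar>f y\<bar>}}"

definition rearr :: "(real \<Rightarrow> real) \<Rightarrow> real \<Rightarrow> real" where
  "rearr f x = Sup (level_set f x)"

text \<open>Orlicz-Lorentz functional; it is \<infinity> when f^* takes the value \<infinity> at some x > 0.\<close>
definition lorentz :: "(real \<Rightarrow> real) \<Rightarrow> (real \<Rightarrow> real) \<Rightarrow> (real \<Rightarrow> real) \<Rightarrow> ennreal" where
  "lorentz F G f = (if \<forall>x>0. bdd_above (level_set f x)
      then lux G (\<lambda>x. rearr f (tilde F (phi_inv (tilde G) x))) else \<infinity>)"

definition LFG :: "(real \<Rightarrow> real) \<Rightarrow> (real \<Rightarrow> real) \<Rightarrow> (real \<Rightarrow> real) set" where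
  "LFG F G = {f. f \<in> borel_measurable lborel \<and> lorentz F G f < \<infinity>}"

definition dil :: "real \<Rightarrow> (real \<Rightarrow> real) \<Rightarrow> real \<Rightarrow> real" where
  "dil a f x = f (a * x)"

definition dil_norm :: "(real \<Rightarrow> real) \<Rightarrow> (real \<Rightarrow> real) \<Rightarrow> real \<Rightarrow> ennreal" where
  "dil_norm F G a = (SUP f \<in> {f \<in> LFG F G. 0 < lorentz F G f}.
       lorentz F G (dil a f) / lorentz F G f)"

definition lower_boyd :: "(real \<Rightarrow> real) \<Rightarrow> (real \<Rightarrow> real) \<Rightarrow> ereal" where
  "lower_boyd F G = Sup {ereal q | q. q > 0 \<and>
      (\<exists>c. \<forall>a. 0 < a \<and> a < 1 \<longrightarrow> dil_norm F G a \<le> ennreal (c * a powr (-1 / q)))}"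

definition p_convex :: "(real \<Rightarrow> real) \<Rightarrow> (real \<Rightarrow> real) \<Rightarrow> real \<Rightarrow> bool" where
  "p_convex F G p \<longleftrightarrow> (\<exists>C. \<forall>n (fs :: nat \<Rightarrow> real \<Rightarrow> real). (\<forall>i<n. fs i \<in> LFG F G) \<longrightarrow>
      lorentz F G (\<lambda>x. (\<Sum>i<n. \<bar>fs i x\<bar> powr p) powr (1 / p))
        \<le> ennreal (C * (\<Sum>i<n. enn2real (lorentz F G (fs i)) powr p) powr (1 / p)))"

end

theory Submission
  imports Defs
begin

text \<open>
  Passing from \<open>f\<close> to \<open>|f| powr p\<close> replaces \<open>F\<close> and \<open>G\<close> by \<open>F(t powr (1/p))\<close> and \<open>G(t powr (1/p))\<close> and
  reduces the theorem to \<open>p = 1\<close>. The functional of \<open>f\<close> is then the \<open>G\<close>-Luxemburg functional of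
  \<open>f\<^sup>* \<circ> \<theta>\<close>, where \<open>\<theta> = F~ \<circ> G~\<^sup>-\<^sup>1\<close>, and up to the averaging
  \<open>f \<mapsto> f\<^sup>*\<^sup>*\<close> the question is whether this functional is subadditive up to a constant on
  decreasing functions.

  If \<open>G \<circ> H\<close> is equivalent to a convex \<open>K\<close>, put \<open>\<rho> = (H\<^sup>*)\<^sup>-\<^sup>1\<close> and \<open>\<tau>(x) = G\<^sup>-\<^sup>1(1/x)\<close>. For
  decreasing \<open>f\<close> the \<open>G\<close>-functional is equivalent to the \<open>K\<close>-Luxemburg norm of the
  \<^emph>\<open>linear\<close> image \<open>f / (\<rho> \<circ> \<tau>)\<close>: a modular bound gives \<open>f \<le> \<tau>\<close>, hence one inequality, and the
  other fails only where \<open>f\<close> is below \<open>H\<^sup>*(\<rho>(\<tau>)/\<delta>)\<close>, whose modular is finite by (J). The Boyd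
  index hypothesis makes the dyadic decomposition of \<open>f\<^sup>*\<^sup>*\<close> summable.

  Conversely, subadditivity up to a constant applied to indicator functions of intervals gives, for
  \<open>T\<^sub>k = G\<^sup>-\<^sup>1(2 powr k)\<close>, that smallness of \<open>\<Sum> T (j k) / T k\<close> forces \<open>\<Sum> 2 powr (j k - k) \<le> 2\<close>.
  So \<open>T\<^sub>k / 2 powr k\<close> can rise by a fixed factor only over blocks of indices whose end points have
  summable ratios, and a function \<open>\<rho>\<close> growing by a fixed factor on every block yields \<open>H\<close>. The lower
  bound for the Boyd index comes from disjoint equimeasurable copies.
\<close>

section \<open>Phi-functions\<close>

lemma phi_less_iff:
  assumes "phi_function F" "0 \<le> x" "0 \<le> y"
  shows "F x < F y \<longleftrightarrow> x < y"
  using assms strict_mono_on_less[of "{0..}" F x y] by (auto simp: phi_function_def)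

lemma phi_le_iff:
  assumes "phi_function F" "0 \<le> x" "0 \<le> y"
  shows "F x \<le> F y \<longleftrightarrow> x \<le> y"
  using phi_less_iff[OF assms(1,3,2)] by (simp add: linorder_not_less[symmetric])

lemma phi_eq_iff:
  assumes "phi_function F" "0 \<le> x" "0 \<le> y"
  shows "F x = F y \<longleftrightarrow> x = y"
  using phi_le_iff[OF assms] phi_le_iff[OF assms(1,3,2)] by (auto simp: order_eq_iff)

lemma phi_nonneg: "phi_function F \<Longrightarrow> 0 \<le> x \<Longrightarrow> 0 \<le> F x"
  by (simp add: phi_function_def)

lemma phi_zero: "phi_function F \<Longrightarrow> F 0 = 0"
  by (simp add: phi_function_def)

lemma phi_pos: "phi_function F \<Longrightarrow> 0 < x \<Longrightarrow> 0 < F x"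
  using phi_less_iff[of F 0 x] by (simp add: phi_zero)

lemma phi_continuous_on: "phi_function F \<Longrightarrow> continuous_on {0..} F"
  by (simp add: phi_function_def)

lemma phi_surj:
  assumes "phi_function F" "0 \<le> y"
  obtains x where "0 \<le> x" "F x = y"
proof -
  have "eventually (\<lambda>x. y \<le> F x \<and> 0 \<le> x) at_top"
    using assms(1)
    by (intro eventually_conj eventually_ge_at_top) (simp add: phi_function_def filterlim_at_top)
  then obtain b where "y \<le> F b" "0 \<le> b" unfolding eventually_at_top_linorder by auto
  moreover have "continuous_on {0..b} F"
    using phi_continuous_on[OF assms(1)] by (rule continuous_on_subset) auto
  ultimately show thesis
    using IVT'[of F 0 y b] assms phi_zero[of F] that by auto
qed

lemma phi_functionI_surj:
  assumes zero: "F 0 = 0" and less: "\<And>s t. 0 \<le> s \<Longrightarrow> s < t \<Longrightarrow> F s < F t"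
    and surj: "\<And>y. 0 \<le> y \<Longrightarrow> \<exists>x\<ge>0. F x = y"
  shows "phi_function F"
proof -
  have F_mono: "F s \<le> F t" if "0 \<le> s" "s \<le> t" for s t
    using less[of s t] that by (cases "s = t") auto
  have nonneg: "0 \<le> F t" if "0 \<le> t" for t using F_mono[of 0 t] that zero by simp
  define extension where "extension t = (if t < 0 then t else F t)" for t :: real
  have "\<exists>x. extension x = y" for y
    using surj[of y] by (cases "y < 0") (auto simp: extension_def not_less)
  then have "range extension = UNIV" by (metis surj_def)
  then have "continuous_on UNIV extension"
    using F_mono nonneg by (intro continuous_onI_mono) (auto simp: extension_def intro: order_trans[OF less_imp_le])
  then have "continuous_on {0..} extension" by (rule continuous_on_subset) auto
  then have "continuous_on {0..} F"
    by (rule continuous_on_cong[THEN iffD1, rotated 2]) (auto simp: extension_def)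
  moreover have "filterlim F at_top at_top"
    unfolding filterlim_at_top eventually_at_top_linorder
  proof
    fix Z :: real
    obtain x where "0 \<le> x" "F x = max Z 0" using surj[of "max Z 0"] by auto
    then show "\<exists>N. \<forall>n\<ge>N. Z \<le> F n" using F_mono[of x] by (intro exI[of _ x]) force
  qed
  ultimately show ?thesis
    using zero less nonneg by (auto simp: phi_function_def strict_mono_on_def)
qed

lemma
  assumes "phi_function F" "0 \<le> y"
  shows phi_inv_nonneg: "0 \<le> phi_inv F y" and phi_phi_inv: "F (phi_inv F y) = y"
proof -
  have "\<exists>!x. 0 \<le> x \<and> F x = y"
    by (rule phi_surj[OF assms]) (auto simp: phi_eq_iff[OF assms(1)])
  from theI'[OF this] show "0 \<le> phi_inv F y" "F (phi_inv F y) = y"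
    by (auto simp: phi_inv_def)
qed

lemma phi_inv_eqI:
  assumes "phi_function F" "0 \<le> x" "F x = y"
  shows "phi_inv F y = x"
  using phi_eq_iff[OF assms(1)] phi_inv_nonneg phi_phi_inv phi_nonneg assms by metis

lemma phi_inv_phi: "phi_function F \<Longrightarrow> 0 \<le> x \<Longrightarrow> phi_inv F (F x) = x"
  by (rule phi_inv_eqI) auto

lemma phi_inv_less_iff:
  assumes "phi_function F" "0 \<le> x" "0 \<le> y"
  shows "phi_inv F x < phi_inv F y \<longleftrightarrow> x < y"
  using phi_less_iff[OF assms(1) phi_inv_nonneg[OF assms(1,2)] phi_inv_nonneg[OF assms(1,3)]]
    by (simp add: phi_phi_inv assms)

lemma phi_inv_le_iff:
  assumes "phi_function F" "0 \<le> x" "0 \<le> y"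
  shows "phi_inv F x \<le> phi_inv F y \<longleftrightarrow> x \<le> y"
  using phi_inv_less_iff[OF assms(1,3,2)] by (simp add: linorder_not_less[symmetric])

lemma le_phi_inv_iff:
  assumes "phi_function F" "0 \<le> x" "0 \<le> y"
  shows "x \<le> phi_inv F y \<longleftrightarrow> F x \<le> y"
  using phi_le_iff[OF assms(1,2) phi_inv_nonneg[OF assms(1,3)]] by (simp add: phi_phi_inv assms)

lemma phi_inv_le_iff_le_phi:
  assumes "phi_function F" "0 \<le> x" "0 \<le> y"
  shows "phi_inv F y \<le> x \<longleftrightarrow> y \<le> F x"
  using phi_le_iff[OF assms(1) phi_inv_nonneg[OF assms(1,3)] assms(2)] by (simp add: phi_phi_inv assms)

lemma phi_inv_zero: "phi_function F \<Longrightarrow> phi_inv F 0 = 0"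
  by (rule phi_inv_eqI) (auto simp: phi_zero)

lemma phi_inv_pos: "phi_function F \<Longrightarrow> 0 < y \<Longrightarrow> 0 < phi_inv F y"
  using phi_inv_less_iff[of F 0 y] by (simp add: phi_inv_zero)

lemma phi_function_phi_inv:
  assumes "phi_function F"
  shows "phi_function (phi_inv F)"
proof (rule phi_functionI_surj)
  fix y :: real assume "0 \<le> y"
  then show "\<exists>x\<ge>0. phi_inv F x = y"
    using assms by (intro exI[of _ "F y"]) (simp add: phi_nonneg phi_inv_phi)
qed (use assms in \<open>simp_all add: phi_inv_zero phi_inv_less_iff\<close>)

lemma phi_inv_phi_inv:
  assumes "phi_function F" "0 \<le> x"
  shows "phi_inv (phi_inv F) x = F x"
  using assms by (intro phi_inv_eqI) (auto simp: phi_function_phi_inv phi_nonneg phi_inv_phi)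

lemma phi_function_compose:
  assumes "phi_function F" "phi_function G"
  shows "phi_function (\<lambda>t. F (G t))"
proof (rule phi_functionI_surj)
  fix y :: real assume "0 \<le> y"
  then show "\<exists>x\<ge>0. F (G x) = y"
    using assms by (intro exI[of _ "phi_inv G (phi_inv F y)"]) (simp add: phi_inv_nonneg phi_phi_inv)
qed (use assms in \<open>simp_all add: phi_zero phi_less_iff phi_nonneg\<close>)

lemma phi_function_powr:
  assumes "0 < a"
  shows "phi_function (\<lambda>t. t powr a)"
proof (rule phi_functionI_surj)
  fix y :: real assume "0 \<le> y"
  then show "\<exists>x\<ge>0. x powr a = y"
    using assms by (intro exI[of _ "y powr (1 / a)"]) (simp add: powr_powr)
qed (use assms in \<open>simp_all add: powr_less_mono2\<close>)

lemma isCont_quasi_concave: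
  fixes g :: "real \<Rightarrow> real"
  assumes g_mono: "\<And>s t. 0 < s \<Longrightarrow> s \<le> t \<Longrightarrow> g s \<le> g t"
    and ratio: "\<And>s t. 0 < s \<Longrightarrow> s \<le> t \<Longrightarrow> g t / t \<le> g s / s" and s_pos: "0 < s"
  shows "isCont g s"
proof -
  have "min 1 (t / s) * g s \<le> g t \<and> g t \<le> max 1 (t / s) * g s" if t_pos: "0 < t" for t
  proof (cases "s \<le> t")
    case True
    then show ?thesis
      using g_mono[of s t] ratio[of s t] s_pos t_pos by (auto simp: min_def max_def field_simps)
  next
    case False
    then show ?thesis
      using g_mono[of t s] ratio[of t s] s_pos t_pos by (auto simp: min_def max_def field_simps)
  qed
  moreover have "eventually (\<lambda>t. 0 < t) (at s)"
    by (rule order_tendstoD(1)[OF tendsto_ident_at s_pos])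
  ultimately have bounds: "eventually (\<lambda>t. min 1 (t / s) * g s \<le> g t) (at s)"
    "eventually (\<lambda>t. g t \<le> max 1 (t / s) * g s) (at s)"
    by (auto elim: eventually_mono)
  have "((\<lambda>t. min 1 (t / s) * g s) \<longlongrightarrow> min 1 (s / s) * g s) (at s)"
    "((\<lambda>t. max 1 (t / s) * g s) \<longlongrightarrow> max 1 (s / s) * g s) (at s)"
    by (intro tendsto_intros; use s_pos in simp)+
  then show "isCont g s"
    using tendsto_sandwich[OF bounds, of "g s"] s_pos by (simp add: isCont_def)
qed

lemma phi_function_of_quasi_concave:
  fixes g :: "real \<Rightarrow> real"
  assumes zero: "g 0 = 0" and less: "\<And>s t. 0 \<le> s \<Longrightarrow> s < t \<Longrightarrow> g s < g t"
    and ratio: "\<And>s t. 0 < s \<Longrightarrow> s \<le> t \<Longrightarrow> g t / t \<le> g s / s"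
    and small: "\<And>e. 0 < e \<Longrightarrow> \<exists>t>0. g t \<le> e" and large: "\<And>y. \<exists>t>0. y \<le> g t"
  shows "phi_function g"
proof (rule phi_functionI_surj)
  have g_mono: "g s \<le> g t" if "0 < s" "s \<le> t" for s t
    using less[of s t] that by (cases "s = t") auto
  fix y :: real assume y_nonneg: "0 \<le> y"
  show "\<exists>x\<ge>0. g x = y"
  proof (cases "y = 0")
    case False
    obtain a b where ab: "0 < a" "g a \<le> y" "0 < b" "y \<le> g b"
      using small[of y] large[of y] y_nonneg False by auto
    show ?thesis
    proof (cases "a \<le> b")
      case True
      have "continuous_on {a..b} g"
        using ab(1) g_mono ratio
        by (intro continuous_at_imp_continuous_on) (auto intro!: isCont_quasi_concave)
      then obtain x where "a \<le> x" "g x = y" using IVT'[of g a y b] ab True by auto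
      then show ?thesis using ab(1) by (intro exI[of _ x]) simp
    next
      case False
      then have "g a = y" using g_mono[of b a] ab by simp
      then show ?thesis using ab(1) by (intro exI[of _ a]) simp
    qed
  qed (use zero in auto)
qed (use zero less in auto)

definition root_scale :: "real \<Rightarrow> (real \<Rightarrow> real) \<Rightarrow> real \<Rightarrow> real" where
  "root_scale p G t = G (t powr (1 / p))"

lemma phi_function_root_scale:
  "phi_function G \<Longrightarrow> 0 < p \<Longrightarrow> phi_function (root_scale p G)"
  using phi_function_compose[of G "\<lambda>t. t powr (1 / p)"] phi_function_powr[of "1 / p"]
  by (simp add: root_scale_def[abs_def])

lemma phi_inv_root_scale:
  assumes "phi_function G" "0 < p" "0 \<le> y"
  shows "phi_inv (root_scale p G) y = phi_inv G y powr p"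
  using assms phi_inv_nonneg[OF assms(1,3)]
  by (intro phi_inv_eqI) (auto simp: phi_function_root_scale root_scale_def powr_powr phi_phi_inv)

lemma phi_inv_inv_powr:
  assumes "phi_function H" "0 < p" "0 \<le> u"
  shows "phi_inv (\<lambda>t. phi_inv H (t powr p)) u = H u powr (1 / p)"
proof (rule phi_inv_eqI)
  show "phi_function (\<lambda>t. phi_inv H (t powr p))"
    using assms by (intro phi_function_compose[OF phi_function_phi_inv phi_function_powr])
qed (use assms in \<open>simp_all add: powr_powr phi_nonneg phi_inv_phi\<close>)

lemma phi_equiv_cong:
  assumes "\<And>t. 0 \<le> t \<Longrightarrow> F t = F' t"
  shows "phi_equiv F K \<longleftrightarrow> phi_equiv F' K"
  unfolding phi_equiv_def using assms by (intro ex_cong1 conj_cong refl) auto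

lemma phi_succ_phi_inv_powr_iff:
  assumes "phi_function H" "0 < p"
  shows "phi_succ G (\<lambda>t. phi_inv H (t powr p))
    \<longleftrightarrow> (\<exists>K. convex_on {0..} K \<and> phi_equiv (\<lambda>u. root_scale p G (H u)) K)"
proof -
  have "phi_equiv (\<lambda>u. G (phi_inv (\<lambda>t. phi_inv H (t powr p)) u)) K
      \<longleftrightarrow> phi_equiv (\<lambda>u. root_scale p G (H u)) K" for K
    by (rule phi_equiv_cong) (simp add: phi_inv_inv_powr[OF assms] root_scale_def)
  then show ?thesis by (simp add: phi_succ_def)
qed

section \<open>The Luxemburg functional\<close>

abbreviation half_line :: "real measure" where
  "half_line \<equiv> restrict_space lborel {0<..}"

definition modular :: "(real \<Rightarrow> real) \<Rightarrow> (real \<Rightarrow> real) \<Rightarrow> ennreal" where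
  "modular G f = (\<integral>\<^sup>+ x. ennreal (G (f x)) \<partial>half_line)"

lemma modular_mono:
  assumes "phi_function G" "\<And>x. 0 < x \<Longrightarrow> 0 \<le> f x" "\<And>x. 0 < x \<Longrightarrow> f x \<le> g x"
  shows "modular G f \<le> modular G g"
  unfolding modular_def
proof (rule nn_integral_mono)
  fix x :: real assume "x \<in> space half_line"
  then have "0 \<le> f x" "f x \<le> g x" using assms by (auto simp: space_restrict_space)
  then show "ennreal (G (f x)) \<le> ennreal (G (g x))"
    using phi_le_iff[OF assms(1), of "f x" "g x"] by (simp add: ennreal_leI)
qed

lemma modular_cong:
  "(\<And>x. 0 < x \<Longrightarrow> G (f x) = G' (g x)) \<Longrightarrow> modular G f = modular G' g"
  unfolding modular_def by (rule nn_integral_cong) (simp add: space_restrict_space)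

lemma
  assumes "0 \<le> u" "u \<le> v"
  shows sets_half_line_Ioc: "{u<..v} \<in> sets half_line"
    and emeasure_half_line_Ioc: "emeasure half_line {u<..v} = ennreal (v - u)"
proof -
  show "{u<..v} \<in> sets half_line"
    using assms by (subst sets_restrict_space_iff) auto
  show "emeasure half_line {u<..v} = ennreal (v - u)"
    using assms by (subst emeasure_restrict_space) auto
qed

lemma nn_integral_half_line_Ioc:
  assumes "0 \<le> u" "u \<le> v" "0 \<le> c"
  shows "(\<integral>\<^sup>+ x. ennreal c * indicator {u<..v} x \<partial>half_line) = ennreal (c * (v - u))"
  using assms by (simp add: nn_integral_cmult_indicator sets_half_line_Ioc emeasure_half_line_Ioc ennreal_mult)

lemma lux_eq_Inf_modular:
  "lux G f = Inf {ennreal c | c. 0 < c \<and> modular G (\<lambda>x. \<bar>f x\<bar> / c) \<le> 1}"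
proof -
  have "(\<integral>\<^sup>+ x. indicator {0..} x * ennreal (G (\<bar>f x\<bar> / c)) \<partial>lborel) = modular G (\<lambda>x. \<bar>f x\<bar> / c)" for c
  proof -
    have "AE x in lborel. x \<noteq> (0::real)" by (rule AE_lborel_singleton)
    then have "AE x in lborel. indicator {0..} x * ennreal (G (\<bar>f x\<bar> / c)) =
        ennreal (G (\<bar>f x\<bar> / c)) * indicator {0<..} x"
      by eventually_elim (auto simp: indicator_def)
    then show ?thesis
      unfolding modular_def by (simp add: nn_integral_restrict_space nn_integral_cong_AE)
  qed
  then show ?thesis by (simp add: lux_def)
qed

lemma modular_le_1_of_lux_less:
  assumes "phi_function G" "lux G f < ennreal c"
  shows "modular G (\<lambda>x. \<bar>f x\<bar> / c) \<le> 1"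
proof -
  obtain d where d: "0 < d" "modular G (\<lambda>x. \<bar>f x\<bar> / d) \<le> 1" "ennreal d < ennreal c"
    using assms(2) unfolding lux_eq_Inf_modular Inf_less_iff by auto
  then have "d \<le> c" using ennreal_less_iff by force
  then have "modular G (\<lambda>x. \<bar>f x\<bar> / c) \<le> modular G (\<lambda>x. \<bar>f x\<bar> / d)"
    using d by (intro modular_mono assms) (auto intro!: divide_left_mono)
  with d show ?thesis by auto
qed

lemma lux_le_of_modular_le_1: "0 < c \<Longrightarrow> modular G (\<lambda>x. \<bar>f x\<bar> / c) \<le> 1 \<Longrightarrow> lux G f \<le> ennreal c"
  unfolding lux_eq_Inf_modular by (rule Inf_lower) auto

lemma lux_le_iff:
  assumes "phi_function G" "0 \<le> c"
  shows "lux G f \<le> ennreal c \<longleftrightarrow> (\<forall>d>c. modular G (\<lambda>x. \<bar>f x\<bar> / d) \<le> 1)"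
proof (intro iffI allI impI)
  fix d assume "lux G f \<le> ennreal c" "c < d"
  then have "lux G f < ennreal d" using assms(2) by (auto intro: le_less_trans ennreal_lessI)
  then show "modular G (\<lambda>x. \<bar>f x\<bar> / d) \<le> 1" by (rule modular_le_1_of_lux_less[OF assms(1)])
next
  assume modular_le: "\<forall>d>c. modular G (\<lambda>x. \<bar>f x\<bar> / d) \<le> 1"
  have "lux G f \<le> ennreal c + ennreal e" if "0 < e" for e
    using lux_le_of_modular_le_1[of "c + e" G f] modular_le that assms(2) by simp
  then show "lux G f \<le> ennreal c" by (rule ennreal_le_epsilon)
qed

lemma lux_cong: "(\<And>x. 0 < x \<Longrightarrow> \<bar>f x\<bar> = \<bar>g x\<bar>) \<Longrightarrow> lux G f = lux G g"
  unfolding lux_eq_Inf_modular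
  by (intro arg_cong[where f = Inf] Collect_cong ex_cong1 conj_cong refl arg_cong2[where f = "(\<le>)"] modular_cong)
     simp

lemma lux_mono:
  assumes "phi_function G" "\<And>x. 0 < x \<Longrightarrow> \<bar>f x\<bar> \<le> \<bar>g x\<bar>"
  shows "lux G f \<le> lux G g"
proof (cases "lux G g")
  case (real c)
  have "modular G (\<lambda>x. \<bar>f x\<bar> / d) \<le> 1" if "c < d" for d
  proof -
    have "modular G (\<lambda>x. \<bar>f x\<bar> / d) \<le> modular G (\<lambda>x. \<bar>g x\<bar> / d)"
      using assms real that by (intro modular_mono) (auto intro: divide_right_mono)
    also have "\<dots> \<le> 1" using lux_le_iff[OF assms(1), of c g] real that by simp
    finally show ?thesis .
  qed
  then show ?thesis using lux_le_iff[OF assms(1), of c f] real by simp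
qed simp

lemma lux_zero: "phi_function G \<Longrightarrow> lux G (\<lambda>x. 0) = 0"
  using lux_le_iff[of G 0 "\<lambda>x. 0"] by (simp add: modular_def phi_zero)

lemma lux_scale_le:
  assumes "phi_function G" "0 < a"
  shows "lux G (\<lambda>x. a * f x) \<le> ennreal a * lux G f"
proof (cases "lux G f")
  case (real c)
  have "modular G (\<lambda>x. \<bar>a * f x\<bar> / d) \<le> 1" if "a * c < d" for d
  proof -
    have "c < d / a" using that assms(2) by (simp add: pos_less_divide_eq mult.commute)
    moreover have "\<forall>d>c. modular G (\<lambda>x. \<bar>f x\<bar> / d) \<le> 1"
      using lux_le_iff[OF assms(1), of c f] real by simp
    ultimately have "modular G (\<lambda>x. \<bar>f x\<bar> / (d / a)) \<le> 1" by blast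
    then show ?thesis using assms(2) by (simp add: abs_mult mult.commute)
  qed
  then have "lux G (\<lambda>x. a * f x) \<le> ennreal (a * c)"
    using lux_le_iff[OF assms(1), of "a * c"] real assms(2) by simp
  then show ?thesis using real assms(2) by (simp add: ennreal_mult)
qed (use assms in \<open>simp add: ennreal_mult_top\<close>)

lemma lux_root_scale_powr_le_iff:
  assumes G: "phi_function G" and p_pos: "0 < p" and c_nonneg: "0 \<le> c" and f: "\<And>x. 0 < x \<Longrightarrow> 0 \<le> f x"
  shows "lux (root_scale p G) (\<lambda>x. f x powr p) \<le> ennreal (c powr p) \<longleftrightarrow> lux G f \<le> ennreal c"
proof -
  have modular_eq: "modular (root_scale p G) (\<lambda>x. \<bar>f x powr p\<bar> / d powr p) = modular G (\<lambda>x. \<bar>f x\<bar> / d)"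
    if "0 < d" for d
    using that p_pos f by (intro modular_cong) (simp add: root_scale_def powr_divide[symmetric] powr_powr)
  have "lux (root_scale p G) (\<lambda>x. f x powr p) \<le> ennreal (c powr p)
      \<longleftrightarrow> (\<forall>e>c powr p. modular (root_scale p G) (\<lambda>x. \<bar>f x powr p\<bar> / e) \<le> 1)"
    using c_nonneg by (intro lux_le_iff phi_function_root_scale G p_pos) simp
  also have "\<dots> \<longleftrightarrow> (\<forall>d>c. modular (root_scale p G) (\<lambda>x. \<bar>f x powr p\<bar> / d powr p) \<le> 1)"
  proof (intro iffI allI impI)
    fix e assume modular_le: "\<forall>d>c. modular (root_scale p G) (\<lambda>x. \<bar>f x powr p\<bar> / d powr p) \<le> 1"
      and e: "c powr p < e"
    have e_pos: "0 < e" using e powr_ge_zero[of c p] by linarith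
    have "c < e powr (1 / p)"
      using powr_less_mono2[of "1 / p" "c powr p" e] e p_pos c_nonneg by (simp add: powr_powr)
    then show "modular (root_scale p G) (\<lambda>x. \<bar>f x powr p\<bar> / e) \<le> 1"
      using modular_le[rule_format, of "e powr (1 / p)"] p_pos e_pos by (simp add: powr_powr)
  qed (use c_nonneg p_pos in \<open>simp add: powr_less_mono2\<close>)
  also have "\<dots> \<longleftrightarrow> lux G f \<le> ennreal c"
    using modular_eq c_nonneg by (simp add: lux_le_iff[OF G c_nonneg])
  finally show ?thesis .
qed

lemma phi_measurable_compose:
  assumes "phi_function G" "f \<in> borel_measurable half_line" "\<And>x. 0 < x \<Longrightarrow> 0 \<le> f x"
  shows "(\<lambda>x. G (f x)) \<in> borel_measurable half_line"
proof (rule measurable_compose[of f half_line "restrict_space borel {0..}" G])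
  show "f \<in> half_line \<rightarrow>\<^sub>M restrict_space borel {0..}"
    using assms by (intro measurable_restrict_space2) (auto simp: space_restrict_space)
  show "G \<in> borel_measurable (restrict_space borel {0..})"
    using phi_continuous_on[OF assms(1)] by (rule borel_measurable_continuous_on_restrict)
qed

lemma lux_le_of_tendsto:
  fixes f :: "nat \<Rightarrow> real \<Rightarrow> real"
  assumes G: "phi_function G" and c_nonneg: "0 \<le> c"
    and f_measurable: "\<And>n. f n \<in> borel_measurable half_line" and f_nonneg: "\<And>n x. 0 < x \<Longrightarrow> 0 \<le> f n x"
    and lim: "\<And>x. 0 < x \<Longrightarrow> (\<lambda>n. f n x) \<longlonglongrightarrow> g x"
    and lux_le: "\<And>n. lux G (f n) \<le> ennreal c"
  shows "lux G g \<le> ennreal c"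
proof -
  have "modular G (\<lambda>x. \<bar>g x\<bar> / d) \<le> 1" if d: "c < d" for d
  proof -
    have "modular G (\<lambda>x. \<bar>g x\<bar> / d) = (\<integral>\<^sup>+ x. liminf (\<lambda>n. ennreal (G (\<bar>f n x\<bar> / d))) \<partial>half_line)"
      unfolding modular_def
    proof (rule nn_integral_cong)
      fix x assume "x \<in> space half_line"
      then have "(\<lambda>n. \<bar>f n x\<bar> / d) \<longlonglongrightarrow> \<bar>g x\<bar> / d"
        using lim[of x] c_nonneg d by (intro tendsto_intros) (auto simp: space_restrict_space)
      then have "(\<lambda>n. G (\<bar>f n x\<bar> / d)) \<longlonglongrightarrow> G (\<bar>g x\<bar> / d)"
        by (rule continuous_on_tendsto_compose[OF phi_continuous_on[OF G]]) (use c_nonneg d in auto)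
      then show "ennreal (G (\<bar>g x\<bar> / d)) = liminf (\<lambda>n. ennreal (G (\<bar>f n x\<bar> / d)))"
        by (intro lim_imp_Liminf[symmetric] tendsto_ennrealI) auto
    qed
    also have "\<dots> \<le> liminf (\<lambda>n. \<integral>\<^sup>+ x. ennreal (G (\<bar>f n x\<bar> / d)) \<partial>half_line)"
      using phi_measurable_compose[OF G, of "\<lambda>x. \<bar>f _ x\<bar> / d"] f_measurable c_nonneg d
      by (intro nn_integral_liminf) simp
    also have "\<dots> \<le> liminf (\<lambda>n. 1)"
      using lux_le_iff[OF G c_nonneg] lux_le d by (intro Liminf_mono) (simp add: modular_def)
    finally show ?thesis by (simp add: Liminf_const)
  qed
  then show ?thesis using lux_le_iff[OF G c_nonneg] by simp
qed

lemma modular_add_le: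
  assumes G: "phi_function G" and conv: "convex_on {0..} G" and ab: "0 < a" "0 < b"
    and f[measurable]: "f \<in> borel_measurable half_line" and f_nonneg: "\<And>x. 0 < x \<Longrightarrow> 0 \<le> f x"
    and g[measurable]: "g \<in> borel_measurable half_line" and g_nonneg: "\<And>x. 0 < x \<Longrightarrow> 0 \<le> g x"
  shows "modular G (\<lambda>x. (f x + g x) / (a + b))
    \<le> ennreal (a / (a + b)) * modular G (\<lambda>x. f x / a) + ennreal (b / (a + b)) * modular G (\<lambda>x. g x / b)"
proof -
  define t where "t = b / (a + b)"
  have t: "0 \<le> t" "t \<le> 1" "1 - t = a / (a + b)" using ab by (simp_all add: t_def field_simps)
  have [measurable]: "(\<lambda>x. G (f x / a)) \<in> borel_measurable half_line"
    "(\<lambda>x. G (g x / b)) \<in> borel_measurable half_line"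
    using ab f_nonneg g_nonneg by (auto intro!: phi_measurable_compose[OF G])
  have "modular G (\<lambda>x. (f x + g x) / (a + b))
      \<le> (\<integral>\<^sup>+ x. ennreal (1 - t) * ennreal (G (f x / a)) + ennreal t * ennreal (G (g x / b)) \<partial>half_line)"
    unfolding modular_def
  proof (rule nn_integral_mono)
    fix x assume "x \<in> space half_line"
    then have x: "0 \<le> f x" "0 \<le> g x" using f_nonneg g_nonneg by (auto simp: space_restrict_space)
    have "(f x + g x) / (a + b) = (1 - t) *\<^sub>R (f x / a) + t *\<^sub>R (g x / b)"
      unfolding t(3) using ab by (simp add: t_def add_divide_distrib)
    moreover have "G ((1 - t) *\<^sub>R (f x / a) + t *\<^sub>R (g x / b)) \<le> (1 - t) * G (f x / a) + t * G (g x / b)"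
      using x ab t by (intro convex_onD[OF conv]) auto
    ultimately show "ennreal (G ((f x + g x) / (a + b)))
        \<le> ennreal (1 - t) * ennreal (G (f x / a)) + ennreal t * ennreal (G (g x / b))"
      using x ab t phi_nonneg[OF G]
      by (simp add: ennreal_mult[symmetric] ennreal_plus[symmetric] ennreal_leI del: ennreal_plus)
  qed
  also have "\<dots> = ennreal (1 - t) * modular G (\<lambda>x. f x / a) + ennreal t * modular G (\<lambda>x. g x / b)"
    by (simp add: modular_def nn_integral_add nn_integral_cmult)
  finally show ?thesis by (simp add: t(3)) (simp add: t_def)
qed

lemma lux_add_le:
  assumes G: "phi_function G" and conv: "convex_on {0..} G"
    and f: "f \<in> borel_measurable half_line" "\<And>x. 0 < x \<Longrightarrow> 0 \<le> f x"
    and g: "g \<in> borel_measurable half_line" "\<And>x. 0 < x \<Longrightarrow> 0 \<le> g x"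
  shows "lux G (\<lambda>x. f x + g x) \<le> lux G f + lux G g"
proof (cases "lux G f"; cases "lux G g")
  fix a b assume lux: "lux G f = ennreal a" "lux G g = ennreal b" and ab: "0 \<le> a" "0 \<le> b"
  have "modular G (\<lambda>x. \<bar>f x + g x\<bar> / d) \<le> 1" if "a + b < d" for d
  proof -
    define a' b' where "a' = a + (d - a - b) / 2" and "b' = b + (d - a - b) / 2"
    have less: "a < a'" "b < b'" and d: "d = a' + b'"
      using that by (auto simp: a'_def b'_def field_simps)
    have bounds_pos: "0 < a'" "0 < b'" using less ab by auto
    have "modular G (\<lambda>x. \<bar>f x + g x\<bar> / d) = modular G (\<lambda>x. (f x + g x) / (a' + b'))"
      by (rule modular_cong) (simp add: f(2) g(2) d)
    also have "\<dots> \<le> ennreal (a' / (a' + b')) * modular G (\<lambda>x. f x / a')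
        + ennreal (b' / (a' + b')) * modular G (\<lambda>x. g x / b')"
      by (rule modular_add_le[OF G conv bounds_pos f g])
    also have "modular G (\<lambda>x. f x / a') = modular G (\<lambda>x. \<bar>f x\<bar> / a')"
      by (rule modular_cong) (simp add: f(2))
    also have "modular G (\<lambda>x. g x / b') = modular G (\<lambda>x. \<bar>g x\<bar> / b')"
      by (rule modular_cong) (simp add: g(2))
    also have "ennreal (a' / (a' + b')) * modular G (\<lambda>x. \<bar>f x\<bar> / a')
        + ennreal (b' / (a' + b')) * modular G (\<lambda>x. \<bar>g x\<bar> / b')
        \<le> ennreal (a' / (a' + b')) * 1 + ennreal (b' / (a' + b')) * 1"
      using lux_le_iff[OF G, of a f] lux_le_iff[OF G, of b g] lux ab less
      by (intro add_mono mult_left_mono) auto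
    also have "\<dots> = 1"
      using bounds_pos by (simp add: ennreal_plus[symmetric] add_divide_distrib[symmetric] del: ennreal_plus)
    finally show ?thesis .
  qed
  then have "lux G (\<lambda>x. f x + g x) \<le> ennreal (a + b)" using lux_le_iff[OF G, of "a + b"] ab by simp
  then show ?thesis using lux ab by simp
qed auto

lemma lux_sum_le:
  assumes G: "phi_function G" "convex_on {0..} G"
    and f: "\<And>i. i \<in> I \<Longrightarrow> f i \<in> borel_measurable half_line" "\<And>i x. i \<in> I \<Longrightarrow> 0 < x \<Longrightarrow> 0 \<le> f i x"
  shows "lux G (\<lambda>x. \<Sum>i\<in>I. f i x) \<le> (\<Sum>i\<in>I. lux G (f i))"
  using f
proof (induction I rule: infinite_finite_induct)
  case (insert i I)
  have "lux G (\<lambda>x. f i x + (\<Sum>j\<in>I. f j x)) \<le> lux G (f i) + lux G (\<lambda>x. \<Sum>j\<in>I. f j x)"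
    using insert.prems by (intro lux_add_le G) (auto intro: sum_nonneg)
  also have "\<dots> \<le> lux G (f i) + (\<Sum>j\<in>I. lux G (f j))"
    using insert by (intro add_left_mono) auto
  finally show ?case using insert by simp
qed (simp_all add: lux_zero G)

section \<open>Decreasing functions\<close>

definition decreasing_fun :: "(real \<Rightarrow> real) \<Rightarrow> bool" where
  "decreasing_fun f \<longleftrightarrow> (\<forall>x>0. 0 \<le> f x) \<and> (\<forall>x y. 0 < x \<longrightarrow> x \<le> y \<longrightarrow> f y \<le> f x)"

lemma decreasing_funI:
  "(\<And>x. 0 < x \<Longrightarrow> 0 \<le> f x) \<Longrightarrow> (\<And>x y. 0 < x \<Longrightarrow> x \<le> y \<Longrightarrow> f y \<le> f x) \<Longrightarrow> decreasing_fun f"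
  by (simp add: decreasing_fun_def)

lemma decreasing_fun_nonneg: "decreasing_fun f \<Longrightarrow> 0 < x \<Longrightarrow> 0 \<le> f x"
  by (simp add: decreasing_fun_def)

lemma decreasing_funD: "decreasing_fun f \<Longrightarrow> 0 < x \<Longrightarrow> x \<le> y \<Longrightarrow> f y \<le> f x"
  by (simp add: decreasing_fun_def)

lemma decreasing_fun_mult: "decreasing_fun f \<Longrightarrow> 0 \<le> a \<Longrightarrow> decreasing_fun (\<lambda>x. a * f x)"
  by (simp add: decreasing_fun_def mult_left_mono)

lemma decreasing_fun_sum: "(\<And>i. i \<in> I \<Longrightarrow> decreasing_fun (f i)) \<Longrightarrow> decreasing_fun (\<lambda>x. \<Sum>i\<in>I. f i x)"
  by (auto simp: decreasing_fun_def intro: sum_mono sum_nonneg)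

lemma decreasing_fun_phi: "phi_function G \<Longrightarrow> decreasing_fun f \<Longrightarrow> decreasing_fun (\<lambda>x. G (f x))"
  by (simp add: decreasing_fun_def phi_nonneg phi_le_iff)

lemma decreasing_fun_measurable:
  assumes "decreasing_fun f"
  shows "f \<in> borel_measurable half_line"
proof -
  have "mono_on {0<..} (\<lambda>x. - f x)"
    using decreasing_funD[OF assms] by (auto simp: mono_on_def)
  then have "(\<lambda>x. - f x) \<in> borel_measurable (restrict_space borel {0<..})"
    by (rule borel_measurable_mono_on_fnc)
  then have "f \<in> borel_measurable (restrict_space borel {0<..})" by simp
  also have "\<dots> = borel_measurable half_line"
    by (intro measurable_cong_sets sets_restrict_space_cong) auto
  finally show ?thesis .
qed

definition envelope :: "(real \<Rightarrow> real) \<Rightarrow> real \<Rightarrow> real" where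
  "envelope G x = phi_inv G (1 / x)"

lemma envelope_pos: "phi_function G \<Longrightarrow> 0 < x \<Longrightarrow> 0 < envelope G x"
  by (simp add: envelope_def phi_inv_pos)

lemma phi_envelope: "phi_function G \<Longrightarrow> 0 < x \<Longrightarrow> G (envelope G x) = 1 / x"
  by (simp add: envelope_def phi_phi_inv)

lemma envelope_le_iff:
  "phi_function G \<Longrightarrow> 0 < x \<Longrightarrow> 0 < y \<Longrightarrow> envelope G x \<le> envelope G y \<longleftrightarrow> y \<le> x"
  by (simp add: envelope_def phi_inv_le_iff field_simps)

lemma decreasing_fun_envelope: "phi_function G \<Longrightarrow> decreasing_fun (envelope G)"
  by (intro decreasing_funI) (auto simp: envelope_le_iff envelope_pos less_imp_le)

lemma decreasing_le_envelope_of_modular: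
  assumes G: "phi_function G" and f: "decreasing_fun f" and "modular G f \<le> 1" and x_pos: "0 < x"
  shows "f x \<le> envelope G x"
proof -
  have fx_nonneg: "0 \<le> f x" using f x_pos by (rule decreasing_fun_nonneg)
  have "ennreal (G (f x) * (x - 0)) = (\<integral>\<^sup>+ y. ennreal (G (f x)) * indicator {0<..x} y \<partial>half_line)"
    using x_pos phi_nonneg[OF G fx_nonneg] by (intro nn_integral_half_line_Ioc[symmetric]) auto
  also have "\<dots> \<le> modular G f"
    unfolding modular_def using fx_nonneg decreasing_funD[OF f] decreasing_fun_nonneg[OF f] G x_pos
    by (intro nn_integral_mono)
      (auto simp: indicator_def space_restrict_space phi_le_iff intro!: ennreal_leI)
  also note \<open>modular G f \<le> 1\<close>
  finally have "G (f x) \<le> 1 / x" using x_pos by (simp add: ennreal_le_1 field_simps)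
  then show ?thesis using le_phi_inv_iff[OF G fx_nonneg, of "1 / x"] x_pos by (simp add: envelope_def)
qed

lemma decreasing_le_envelope:
  assumes G: "phi_function G" and f: "decreasing_fun f" and c: "0 \<le> c" "lux G f \<le> ennreal c" and x_pos: "0 < x"
  shows "f x \<le> c * envelope G x"
proof -
  have env_pos: "0 < envelope G x" using G x_pos by (rule envelope_pos)
  have "f x / envelope G x \<le> c"
  proof (rule dense_ge)
    fix d assume d: "c < d"
    have "modular G (\<lambda>y. 1 / d * f y) = modular G (\<lambda>y. \<bar>f y\<bar> / d)"
      by (rule modular_cong) (simp add: decreasing_fun_nonneg[OF f])
    also have "\<dots> \<le> 1" using lux_le_iff[OF G c(1)] c(2) d by simp
    finally have "1 / d * f x \<le> envelope G x"
      using c d x_pos by (intro decreasing_le_envelope_of_modular[OF G decreasing_fun_mult[OF f]]) auto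
    then show "f x / envelope G x \<le> d" using c d env_pos by (simp add: field_simps)
  qed
  then show ?thesis using env_pos by (simp add: field_simps)
qed

section \<open>Decreasing rearrangements\<close>

definition superlevel :: "(real \<Rightarrow> real) \<Rightarrow> real \<Rightarrow> real set" where
  "superlevel f t = {y \<in> {0..}. t \<le> \<bar>f y\<bar>}"

lemma superlevel_sets: "f \<in> borel_measurable borel \<Longrightarrow> superlevel f t \<in> sets borel"
  unfolding superlevel_def by measurable

lemma mem_level_set_iff: "t \<in> level_set f x \<longleftrightarrow> ennreal x \<le> emeasure lborel (superlevel f t)"
  by (simp add: level_set_def superlevel_def)

lemma level_set_cong:
  assumes "\<And>y. 0 \<le> y \<Longrightarrow> \<bar>f y\<bar> = \<bar>g y\<bar>"
  shows "level_set f = level_set g"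
proof -
  have "superlevel f t = superlevel g t" for t using assms by (auto simp: superlevel_def)
  then show ?thesis by (auto simp: fun_eq_iff mem_level_set_iff)
qed

lemma level_set_nonpos:
  assumes "t \<le> 0"
  shows "t \<in> level_set f x"
proof -
  have "of_nat n \<le> emeasure lborel {0::real..}" for n
    using emeasure_mono[of "{0..real n}" "{0..}" lborel] by (simp add: ennreal_of_nat_eq_real_of_nat)
  then have "(SUP n. of_nat n) \<le> emeasure lborel {0::real..}" by (rule SUP_least)
  then have "emeasure lborel {0::real..} = \<infinity>" by (simp add: ennreal_SUP_of_nat_eq_top top_unique)
  moreover have "superlevel f t = {0..}" using assms by (auto simp: superlevel_def)
  ultimately show ?thesis by (simp add: mem_level_set_iff)
qed

lemma level_set_antimono: "x \<le> y \<Longrightarrow> level_set f y \<subseteq> level_set f x"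
  by (auto simp: level_set_def intro: order_trans[OF ennreal_leI])

lemma level_set_mono:
  assumes "\<And>t. 0 < t \<Longrightarrow> emeasure lborel (superlevel f t) \<le> emeasure lborel (superlevel g t)"
  shows "level_set f x \<subseteq> level_set g x"
proof
  fix t assume "t \<in> level_set f x"
  then show "t \<in> level_set g x"
    using assms[of t] level_set_nonpos[of t g x]
    by (cases "t > 0") (auto simp: mem_level_set_iff intro: order_trans)
qed

definition rearr_finite :: "(real \<Rightarrow> real) \<Rightarrow> bool" where
  "rearr_finite f \<longleftrightarrow> (\<forall>x>0. bdd_above (level_set f x))"

lemma le_rearr: "rearr_finite f \<Longrightarrow> 0 < x \<Longrightarrow> t \<in> level_set f x \<Longrightarrow> t \<le> rearr f x"
  by (simp add: rearr_def rearr_finite_def cSup_upper)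

lemma rearr_nonneg: "rearr_finite f \<Longrightarrow> 0 < x \<Longrightarrow> 0 \<le> rearr f x"
  by (rule le_rearr) (auto intro: level_set_nonpos)

lemma
  assumes "0 \<le> c" "\<And>t. 0 < t \<Longrightarrow> t \<in> level_set f x \<Longrightarrow> t \<le> c"
  shows rearr_le: "rearr f x \<le> c" and bdd_above_level_set: "bdd_above (level_set f x)"
proof -
  have level_le: "t \<le> c" if "t \<in> level_set f x" for t using assms that by (cases "0 < t") auto
  show "rearr f x \<le> c"
    unfolding rearr_def using level_le level_set_nonpos[of 0 f x] by (intro cSup_least) auto
  show "bdd_above (level_set f x)" using level_le by (rule bdd_aboveI)
qed

lemma rearr_mono:
  assumes "rearr_finite g" "0 < x" "level_set f y \<subseteq> level_set g x"
  shows "rearr f y \<le> rearr g x"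
  using assms by (intro rearr_le) (auto intro: le_rearr rearr_nonneg)

lemma rearr_finite_mono:
  "rearr_finite g \<Longrightarrow> (\<And>x. 0 < x \<Longrightarrow> level_set f x \<subseteq> level_set g x) \<Longrightarrow> rearr_finite f"
  unfolding rearr_finite_def by (meson bdd_above_mono)

lemma decreasing_fun_rearr: "rearr_finite f \<Longrightarrow> decreasing_fun (rearr f)"
  by (intro decreasing_funI rearr_nonneg rearr_mono level_set_antimono)

lemma emeasure_greater_rearr_le:
  assumes f[measurable]: "f \<in> borel_measurable borel" and fin: "rearr_finite f" "0 < x"
  shows "emeasure lborel {y \<in> {0..}. rearr f x < \<bar>f y\<bar>} \<le> ennreal x"
proof -
  let ?A = "\<lambda>n. superlevel f (rearr f x + inverse (Suc n))"
  have "{y \<in> {0..}. rearr f x < \<bar>f y\<bar>} = (\<Union>n. ?A n)"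
  proof (intro equalityI subsetI)
    fix y assume y: "y \<in> {y \<in> {0..}. rearr f x < \<bar>f y\<bar>}"
    then obtain n where "inverse (real (Suc n)) < \<bar>f y\<bar> - rearr f x"
      using reals_Archimedean[of "\<bar>f y\<bar> - rearr f x"] by auto
    with y have "y \<in> ?A n" by (simp add: superlevel_def)
    then show "y \<in> (\<Union>n. ?A n)" by blast
  next
    fix y assume "y \<in> (\<Union>n. ?A n)"
    then obtain n where n: "0 \<le> y" "rearr f x + inverse (real (Suc n)) \<le> \<bar>f y\<bar>"
      unfolding superlevel_def by blast
    have "0 < inverse (real (Suc n))" by simp
    with n have "rearr f x < \<bar>f y\<bar>" by linarith
    with n show "y \<in> {y \<in> {0..}. rearr f x < \<bar>f y\<bar>}" by simp
  qed
  moreover have "incseq ?A"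
  proof (intro monoI subsetI)
    fix m n :: nat and y assume "m \<le> n" and y: "y \<in> ?A m"
    then have "rearr f x + inverse (Suc n) \<le> rearr f x + inverse (Suc m)"
      by (intro add_left_mono le_imp_inverse_le) auto
    with y show "y \<in> ?A n" unfolding superlevel_def by (blast intro: order_trans)
  qed
  moreover have "range ?A \<subseteq> sets lborel" using superlevel_sets[OF f] by auto
  ultimately have "emeasure lborel {y \<in> {0..}. rearr f x < \<bar>f y\<bar>} = (SUP n. emeasure lborel (?A n))"
    by (simp add: SUP_emeasure_incseq)
  also have "\<dots> \<le> ennreal x"
  proof (rule SUP_least)
    fix n :: nat
    have "rearr f x + inverse (Suc n) \<notin> level_set f x" using le_rearr[OF fin] by force
    then show "emeasure lborel (?A n) \<le> ennreal x" by (simp add: mem_level_set_iff)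
  qed
  finally show ?thesis .
qed

lemma emeasure_lborel_affine:
  fixes a b :: real
  assumes "0 < a" "A \<in> sets borel"
  shows "ennreal a * emeasure lborel {x. b + a * x \<in> A} = emeasure lborel A"
proof -
  have "emeasure lborel A
      = emeasure (density (distr lborel borel (\<lambda>x. b + a * x)) (\<lambda>_. ennreal \<bar>a\<bar>)) A"
    using lborel_real_affine[of a b] assms by simp
  also have "\<dots> = ennreal a * emeasure (distr lborel borel (\<lambda>x. b + a * x)) A"
    using assms by (subst emeasure_density) (auto simp: nn_integral_cmult_indicator)
  also have "emeasure (distr lborel borel (\<lambda>x. b + a * x)) A = emeasure lborel {x. b + a * x \<in> A}"
    using assms by (subst emeasure_distr) (auto simp: vimage_def)
  finally show ?thesis by simp
qed

lemma level_set_dil: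
  assumes a_pos: "0 < a" and f: "f \<in> borel_measurable borel"
  shows "level_set (dil a f) x = level_set f (a * x)"
proof -
  have "ennreal x \<le> emeasure lborel (superlevel (dil a f) t)
      \<longleftrightarrow> ennreal (a * x) \<le> emeasure lborel (superlevel f t)" for t
  proof -
    have "superlevel (dil a f) t = {y. 0 + a * y \<in> superlevel f t}"
      using a_pos by (simp add: superlevel_def dil_def zero_le_mult_iff)
    then have "emeasure lborel (superlevel f t) = ennreal a * emeasure lborel (superlevel (dil a f) t)"
      using emeasure_lborel_affine[OF a_pos superlevel_sets[OF f], of 0 t] by simp
    then show ?thesis using a_pos by (simp add: ennreal_mult' ennreal_mult_le_mult_iff)
  qed
  then show ?thesis by (auto simp: mem_level_set_iff)
qed

lemma superlevel_powr:
  assumes "0 < p" "0 < t"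
  shows "superlevel (\<lambda>x. \<bar>f x\<bar> powr p) t = superlevel f (t powr (1 / p))"
proof -
  have "t \<le> \<bar>f y\<bar> powr p \<longleftrightarrow> t powr (1 / p) \<le> \<bar>f y\<bar>" for y
    using phi_le_iff[OF phi_function_powr[OF assms(1)], of "t powr (1 / p)" "\<bar>f y\<bar>"] assms
    by (simp add: powr_powr)
  then show ?thesis by (simp add: superlevel_def)
qed

lemma mem_level_set_powr_iff:
  "0 < p \<Longrightarrow> 0 < t \<Longrightarrow> t \<in> level_set (\<lambda>x. \<bar>f x\<bar> powr p) x \<longleftrightarrow> t powr (1 / p) \<in> level_set f x"
  by (simp add: mem_level_set_iff superlevel_powr)

lemma
  assumes p_pos: "0 < p" and f: "rearr_finite f"
  shows rearr_finite_powr: "rearr_finite (\<lambda>x. \<bar>f x\<bar> powr p)"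
    and rearr_powr_le: "0 < x \<Longrightarrow> rearr (\<lambda>x. \<bar>f x\<bar> powr p) x \<le> rearr f x powr p"
proof -
  have level_le: "t \<le> rearr f x powr p" if "0 < t" "t \<in> level_set (\<lambda>x. \<bar>f x\<bar> powr p) x" "0 < x" for t x
  proof -
    have "t powr (1 / p) \<le> rearr f x"
      using that p_pos by (intro le_rearr[OF f]) (simp_all add: mem_level_set_powr_iff)
    then have "(t powr (1 / p)) powr p \<le> rearr f x powr p" using p_pos by (intro powr_mono2) auto
    then show ?thesis using that p_pos by (simp add: powr_powr)
  qed
  show "rearr_finite (\<lambda>x. \<bar>f x\<bar> powr p)"
    unfolding rearr_finite_def
    using level_le by (intro allI impI bdd_above_level_set[of "rearr f _ powr p"]) auto
  show "0 < x \<Longrightarrow> rearr (\<lambda>x. \<bar>f x\<bar> powr p) x \<le> rearr f x powr p"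
    using level_le by (intro rearr_le) auto
qed

lemma level_set_powr_powr:
  "0 < p \<Longrightarrow> level_set (\<lambda>x. \<bar>\<bar>f x\<bar> powr p\<bar> powr (1 / p)) = level_set f"
  by (rule level_set_cong) (simp add: powr_powr)

lemma rearr_finite_powr_iff:
  assumes "0 < p"
  shows "rearr_finite (\<lambda>x. \<bar>f x\<bar> powr p) \<longleftrightarrow> rearr_finite f"
proof
  assume "rearr_finite (\<lambda>x. \<bar>f x\<bar> powr p)"
  then have "rearr_finite (\<lambda>x. \<bar>\<bar>f x\<bar> powr p\<bar> powr (1 / p))"
    by (rule rearr_finite_powr[rotated]) (use assms in simp)
  then show "rearr_finite f"
    unfolding rearr_finite_def level_set_powr_powr[OF assms] .
qed (rule rearr_finite_powr[OF assms])

lemma rearr_powr: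
  assumes p_pos: "0 < p" and f: "rearr_finite f" and x_pos: "0 < x"
  shows "rearr (\<lambda>x. \<bar>f x\<bar> powr p) x = rearr f x powr p"
proof (rule antisym[OF rearr_powr_le[OF p_pos f x_pos]])
  have "rearr (\<lambda>x. \<bar>\<bar>f x\<bar> powr p\<bar> powr (1 / p)) x \<le> rearr (\<lambda>x. \<bar>f x\<bar> powr p) x powr (1 / p)"
    using p_pos x_pos by (intro rearr_powr_le rearr_finite_powr f) auto
  then have "rearr f x \<le> rearr (\<lambda>x. \<bar>f x\<bar> powr p) x powr (1 / p)"
    unfolding rearr_def level_set_powr_powr[OF p_pos] .
  then have "rearr f x powr p \<le> (rearr (\<lambda>x. \<bar>f x\<bar> powr p) x powr (1 / p)) powr p"
    using p_pos rearr_nonneg[OF f x_pos] by (intro powr_mono2) auto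
  then show "rearr f x powr p \<le> rearr (\<lambda>x. \<bar>f x\<bar> powr p) x"
    using p_pos rearr_nonneg[OF rearr_finite_powr[OF p_pos f] x_pos] by (simp add: powr_powr)
qed

section \<open>The Orlicz--Lorentz functional\<close>

definition reparam :: "(real \<Rightarrow> real) \<Rightarrow> (real \<Rightarrow> real) \<Rightarrow> real \<Rightarrow> real" where
  "reparam F G x = 1 / F (envelope G x)"

lemma phi_inv_tilde:
  assumes "phi_function G" "0 < x"
  shows "phi_inv (tilde G) x = 1 / envelope G x"
  unfolding phi_inv_def[of "tilde G"]
proof (rule the_equality)
  show "0 \<le> 1 / envelope G x \<and> tilde G (1 / envelope G x) = x"
    using envelope_pos[OF assms] assms by (simp add: tilde_def phi_envelope)
  fix z assume z: "0 \<le> z \<and> tilde G z = x"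
  then have "z > 0" "1 / G (1 / z) = x" using assms by (auto simp: tilde_def split: if_splits)
  then have "envelope G x = 1 / z"
    unfolding envelope_def using assms by (intro phi_inv_eqI) auto
  then show "z = 1 / envelope G x" by simp
qed

lemma tilde_phi_inv_tilde:
  assumes "phi_function G" "0 < x"
  shows "tilde F (phi_inv (tilde G) x) = reparam F G x"
  using envelope_pos[OF assms] assms by (simp add: phi_inv_tilde tilde_def reparam_def)

lemma reparam_pos: "phi_function F \<Longrightarrow> phi_function G \<Longrightarrow> 0 < x \<Longrightarrow> 0 < reparam F G x"
  by (simp add: reparam_def phi_pos envelope_pos)

lemma reparam_le_iff:
  assumes "phi_function F" "phi_function G" "0 < x" "0 < y"
  shows "reparam F G x \<le> reparam F G y \<longleftrightarrow> x \<le> y"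
proof -
  have env_pos: "0 < envelope G x" "0 < envelope G y" using assms by (simp_all add: envelope_pos)
  then have "reparam F G x \<le> reparam F G y \<longleftrightarrow> F (envelope G y) \<le> F (envelope G x)"
    using phi_pos[OF assms(1) env_pos(1)] phi_pos[OF assms(1) env_pos(2)]
      by (simp add: reparam_def field_simps)
  also have "\<dots> \<longleftrightarrow> x \<le> y" using assms env_pos by (simp add: phi_le_iff envelope_le_iff)
  finally show ?thesis .
qed

lemma reparam_inverse:
  assumes "phi_function F" "phi_function G" "0 < z"
  shows "0 < reparam G F z" "reparam F G (reparam G F z) = z"
  using assms by (simp_all add: reparam_pos)
    (simp add: reparam_def envelope_def phi_inv_phi phi_phi_inv phi_inv_nonneg)

lemma reparam_root_scale:
  assumes "phi_function G" "0 < p" "0 < x"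
  shows "reparam (root_scale p F) (root_scale p G) x = reparam F G x"
  using assms phi_inv_nonneg[OF assms(1), of "1 / x"]
  by (simp add: reparam_def envelope_def phi_inv_root_scale root_scale_def powr_powr)

lemma lorentz_eq_lux:
  assumes "phi_function F" "phi_function G" "rearr_finite f"
  shows "lorentz F G f = lux G (\<lambda>x. rearr f (reparam F G x))"
proof -
  have "lorentz F G f = lux G (\<lambda>x. rearr f (tilde F (phi_inv (tilde G) x)))"
    using assms(3) by (simp add: lorentz_def rearr_finite_def)
  also have "\<dots> = lux G (\<lambda>x. rearr f (reparam F G x))"
    by (rule lux_cong) (simp add: tilde_phi_inv_tilde assms)
  finally show ?thesis .
qed

lemma lorentz_not_rearr_finite: "\<not> rearr_finite f \<Longrightarrow> lorentz F G f = \<infinity>"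
  unfolding lorentz_def rearr_finite_def by (rule if_not_P)

lemma rearr_finite_of_lorentz: "lorentz F G f < \<infinity> \<Longrightarrow> rearr_finite f"
  using lorentz_not_rearr_finite by fastforce

lemma LFG_rearr_finite: "f \<in> LFG F G \<Longrightarrow> rearr_finite f"
  by (rule rearr_finite_of_lorentz[of F G]) (simp add: LFG_def)

lemma LFG_measurable: "f \<in> LFG F G \<Longrightarrow> f \<in> borel_measurable borel"
  by (simp add: LFG_def)

lemma LFG_lorentz: "f \<in> LFG F G \<Longrightarrow> lorentz F G f = ennreal (enn2real (lorentz F G f))"
  by (simp add: LFG_def)

lemma lorentz_cong:
  assumes "\<And>x. 0 \<le> x \<Longrightarrow> \<bar>f x\<bar> = \<bar>g x\<bar>"
  shows "lorentz F G f = lorentz F G g"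
proof -
  have "level_set f = level_set g" using assms by (rule level_set_cong)
  then show ?thesis by (simp only: lorentz_def rearr_def)
qed

lemma decreasing_fun_rearr_reparam:
  assumes "phi_function F" "phi_function G" "rearr_finite f" "0 < a"
  shows "decreasing_fun (\<lambda>x. rearr f (a * reparam F G x))"
  using decreasing_fun_rearr[OF assms(3)] assms
  by (auto simp: reparam_pos reparam_le_iff mult_left_mono
      intro!: decreasing_funI decreasing_fun_nonneg[of "rearr f"] decreasing_funD[of "rearr f"])

lemma lorentz_mono:
  assumes F: "phi_function F" and G: "phi_function G"
    and level_set_subset: "\<And>x. 0 < x \<Longrightarrow> level_set f x \<subseteq> level_set g x"
  shows "lorentz F G f \<le> lorentz F G g"
proof (cases "rearr_finite g")
  case True
  then have f: "rearr_finite f" using level_set_subset by (rule rearr_finite_mono)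
  have "\<bar>rearr f (reparam F G x)\<bar> \<le> \<bar>rearr g (reparam F G x)\<bar>" if "0 < x" for x
    using reparam_pos[OF F G that] level_set_subset rearr_mono[OF True, of _ f] rearr_nonneg f True
      by simp
  then show ?thesis
    unfolding lorentz_eq_lux[OF F G True] lorentz_eq_lux[OF F G f] by (rule lux_mono[OF G])
next
  case False
  then show ?thesis by (simp add: lorentz_not_rearr_finite)
qed

lemma rearr_eq_0_of_lorentz_eq_0:
  assumes F: "phi_function F" and G: "phi_function G" and "lorentz F G f = 0" and x_pos: "0 < x"
  shows "rearr f x = 0"
proof -
  have f: "rearr_finite f" using assms(3) by (intro rearr_finite_of_lorentz[of F G]) simp
  define z where "z = reparam G F x"
  have z: "0 < z" "reparam F G z = x" using reparam_inverse[OF F G x_pos] by (simp_all add: z_def)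
  have "rearr f (1 * reparam F G z) \<le> 0 * envelope G z"
    using assms(3) z(1) lorentz_eq_lux[OF F G f]
    by (intro decreasing_le_envelope[OF G decreasing_fun_rearr_reparam[OF F G f]]) auto
  then show ?thesis using z rearr_nonneg[OF f x_pos] by simp
qed

lemma lorentz_dil:
  assumes F: "phi_function F" and G: "phi_function G" and f: "f \<in> LFG F G" and a_pos: "0 < a"
  shows "lorentz F G (dil a f) = lux G (\<lambda>x. rearr f (a * reparam F G x))"
proof -
  note dil = level_set_dil[OF a_pos LFG_measurable[OF f]]
  have "rearr_finite (dil a f)"
    using LFG_rearr_finite[OF f] a_pos by (simp add: rearr_finite_def dil)
  then show ?thesis by (simp add: lorentz_eq_lux F G rearr_def dil)
qed

subsection \<open>Dilations and the Boyd index\<close>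

lemma dil_norm_le_iff:
  assumes F: "phi_function F" and G: "phi_function G" and a_pos: "0 < a" and d_nonneg: "0 \<le> d"
  shows "dil_norm F G a \<le> ennreal d \<longleftrightarrow>
    (\<forall>f\<in>LFG F G. lorentz F G (dil a f) \<le> ennreal d * lorentz F G f)"
proof (intro iffI ballI)
  fix f assume dil_norm_le: "dil_norm F G a \<le> ennreal d" and f: "f \<in> LFG F G"
  define N where "N = lorentz F G f"
  show "lorentz F G (dil a f) \<le> ennreal d * lorentz F G f"
  proof (cases "N = 0")
    case True
    then have "lorentz F G (dil a f) = lux G (\<lambda>x. 0)"
      unfolding lorentz_dil[OF F G f a_pos] N_def
      using rearr_eq_0_of_lorentz_eq_0[OF F G] reparam_pos[OF F G] a_pos by (intro lux_cong) simp
    then show ?thesis by (simp add: lux_zero[OF G])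
  next
    case False
    then have N: "0 < N" "N < \<infinity>" using f by (auto simp: N_def LFG_def zero_less_iff_neq_zero)
    then have "lorentz F G (dil a f) / N \<le> ennreal d"
      using f order_trans[OF SUP_upper dil_norm_le[unfolded dil_norm_def]] by (auto simp: N_def)
    then have "lorentz F G (dil a f) / N * N \<le> ennreal d * N" by (rule mult_right_mono) simp
    then show ?thesis using N by (simp add: N_def ennreal_divide_times mult_divide_eq_ennreal)
  qed
next
  assume lorentz_le: "\<forall>f\<in>LFG F G. lorentz F G (dil a f) \<le> ennreal d * lorentz F G f"
  show "dil_norm F G a \<le> ennreal d"
    unfolding dil_norm_def
  proof (rule SUP_least)
    fix f assume "f \<in> {f \<in> LFG F G. 0 < lorentz F G f}"
    then show "lorentz F G (dil a f) / lorentz F G f \<le> ennreal d"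
      using lorentz_le by (intro divide_le_posI_ennreal) (auto simp: LFG_def mult.commute)
  qed
qed

definition boyd_exponent :: "(real \<Rightarrow> real) \<Rightarrow> (real \<Rightarrow> real) \<Rightarrow> real \<Rightarrow> bool" where
  "boyd_exponent F G q \<longleftrightarrow> 0 < q \<and> (\<exists>c\<ge>0. \<forall>a. 0 < a \<and> a < 1 \<longrightarrow>
      (\<forall>f\<in>LFG F G. lorentz F G (dil a f) \<le> ennreal (c * a powr (-1 / q)) * lorentz F G f))"

lemma lower_boyd_eq_Sup:
  assumes "phi_function F" "phi_function G"
  shows "lower_boyd F G = Sup {ereal q | q. boyd_exponent F G q}"
proof -
  have "(\<exists>c. \<forall>a. 0 < a \<and> a < 1 \<longrightarrow> dil_norm F G a \<le> ennreal (c * a powr (-1 / q)))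
      \<longleftrightarrow> (\<exists>c\<ge>0. \<forall>a. 0 < a \<and> a < 1 \<longrightarrow> dil_norm F G a \<le> ennreal (c * a powr (-1 / q)))" for q
  proof (intro iffI; elim exE)
    fix c assume dil_norm_le: "\<forall>a. 0 < a \<and> a < 1 \<longrightarrow> dil_norm F G a \<le> ennreal (c * a powr (-1 / q))"
    have "c * a powr (-1 / q) \<le> max c 0 * a powr (-1 / q)" for a by (intro mult_right_mono) auto
    then show "\<exists>c\<ge>0. \<forall>a. 0 < a \<and> a < 1 \<longrightarrow> dil_norm F G a \<le> ennreal (c * a powr (-1 / q))"
      using dil_norm_le by (intro exI[of _ "max c 0"]) (auto intro: order_trans ennreal_leI)
  qed auto
  then show ?thesis
    by (simp add: lower_boyd_def boyd_exponent_def dil_norm_le_iff[OF assms] cong: conj_cong imp_cong)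
qed

subsection \<open>Reduction to exponent one\<close>

lemma lorentz_root_scale_le_iff:
  assumes F: "phi_function F" and G: "phi_function G" and p_pos: "0 < p" and c_nonneg: "0 \<le> c"
  shows "lorentz (root_scale p F) (root_scale p G) (\<lambda>x. \<bar>f x\<bar> powr p) \<le> ennreal (c powr p)
    \<longleftrightarrow> lorentz F G f \<le> ennreal c"
proof (cases "rearr_finite f")
  case True
  have "lorentz (root_scale p F) (root_scale p G) (\<lambda>x. \<bar>f x\<bar> powr p)
      = lux (root_scale p G) (\<lambda>x. rearr f (reparam F G x) powr p)"
    unfolding lorentz_eq_lux[OF phi_function_root_scale[OF F p_pos] phi_function_root_scale[OF G p_pos]
        rearr_finite_powr[OF p_pos True]]
    by (rule lux_cong) (simp add: reparam_root_scale F G p_pos rearr_powr[OF p_pos True] reparam_pos)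
  then show ?thesis
    using lux_root_scale_powr_le_iff[OF G p_pos c_nonneg] rearr_nonneg[OF True] reparam_pos[OF F G]
    by (simp add: lorentz_eq_lux[OF F G True])
next
  case False
  then show ?thesis using rearr_finite_powr_iff[OF p_pos]
    by (simp add: lorentz_not_rearr_finite top_unique)
qed

lemma lorentz_root_scale:
  assumes F: "phi_function F" and G: "phi_function G" and p_pos: "0 < p" and f: "f \<in> LFG F G"
  shows "lorentz (root_scale p F) (root_scale p G) (\<lambda>x. \<bar>f x\<bar> powr p)
    = ennreal (enn2real (lorentz F G f) powr p)"
proof -
  note iff = lorentz_root_scale_le_iff[OF F G p_pos]
  define N where "N = enn2real (lorentz F G f)"
  have N: "0 \<le> N" "lorentz F G f = ennreal N" using LFG_lorentz[OF f] by (simp_all add: N_def)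
  have lorentz_powr_le: "lorentz (root_scale p F) (root_scale p G) (\<lambda>x. \<bar>f x\<bar> powr p) \<le> ennreal (N powr p)"
    using iff[OF N(1)] N by simp
  then obtain M where M: "0 \<le> M" "lorentz (root_scale p F) (root_scale p G) (\<lambda>x. \<bar>f x\<bar> powr p) = ennreal M"
    by (auto simp: le_ennreal_iff)
  then have "lorentz F G f \<le> ennreal (M powr (1 / p))"
    using iff[of "M powr (1 / p)" f] p_pos by (simp add: powr_powr)
  then have "N powr p \<le> (M powr (1 / p)) powr p"
    using N p_pos by (intro powr_mono2) auto
  then have "N powr p \<le> M" using M p_pos by (simp add: powr_powr)
  then show ?thesis using lorentz_powr_le M by (simp add: N_def)
qed

lemma LFG_root_scale_iff:
  assumes F: "phi_function F" and G: "phi_function G" and p_pos: "0 < p"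
    and f[measurable]: "f \<in> borel_measurable borel"
  shows "(\<lambda>x. \<bar>f x\<bar> powr p) \<in> LFG (root_scale p F) (root_scale p G) \<longleftrightarrow> f \<in> LFG F G"
proof
  assume pow: "(\<lambda>x. \<bar>f x\<bar> powr p) \<in> LFG (root_scale p F) (root_scale p G)"
  define M where "M = enn2real (lorentz (root_scale p F) (root_scale p G) (\<lambda>x. \<bar>f x\<bar> powr p))"
  have "0 \<le> M" "lorentz (root_scale p F) (root_scale p G) (\<lambda>x. \<bar>f x\<bar> powr p) = ennreal M"
    using LFG_lorentz[OF pow] by (simp_all add: M_def)
  then have "lorentz F G f \<le> ennreal (M powr (1 / p))"
    using lorentz_root_scale_le_iff[OF F G p_pos, of "M powr (1 / p)" f] p_pos by (simp add: powr_powr)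
  then show "f \<in> LFG F G" by (simp add: LFG_def le_less_trans)
next
  assume "f \<in> LFG F G"
  from lorentz_root_scale[OF F G p_pos this]
  show "(\<lambda>x. \<bar>f x\<bar> powr p) \<in> LFG (root_scale p F) (root_scale p G)"
    by (simp add: LFG_def)
qed

definition normable :: "(real \<Rightarrow> real) \<Rightarrow> (real \<Rightarrow> real) \<Rightarrow> bool" where
  "normable F G \<longleftrightarrow> (\<exists>C\<ge>0. \<forall>n (fs :: nat \<Rightarrow> real \<Rightarrow> real). (\<forall>i<n. fs i \<in> LFG F G) \<longrightarrow>
      lorentz F G (\<lambda>x. \<Sum>i<n. \<bar>fs i x\<bar>) \<le> ennreal C * (\<Sum>i<n. lorentz F G (fs i)))"

lemma LFG_root_scaleE:
  assumes F: "phi_function F" and G: "phi_function G" and p_pos: "0 < p"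
    and f: "f \<in> LFG (root_scale p F) (root_scale p G)"
  obtains g where "g \<in> LFG F G" "\<And>x. \<bar>f x\<bar> = \<bar>g x\<bar> powr p"
    "lorentz (root_scale p F) (root_scale p G) f = ennreal (enn2real (lorentz F G g) powr p)"
proof -
  define g where "g x = \<bar>f x\<bar> powr (1 / p)" for x
  have [measurable]: "f \<in> borel_measurable borel" using LFG_measurable[OF f] .
  have fg: "\<bar>f x\<bar> = \<bar>g x\<bar> powr p" for x using p_pos by (simp add: g_def powr_powr)
  have lorentz: "lorentz (root_scale p F) (root_scale p G) f
      = lorentz (root_scale p F) (root_scale p G) (\<lambda>x. \<bar>g x\<bar> powr p)"
    by (rule lorentz_cong) (simp add: fg)
  then have "(\<lambda>x. \<bar>g x\<bar> powr p) \<in> LFG (root_scale p F) (root_scale p G)"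
    using f by (simp add: LFG_def fg[symmetric])
  then have g: "g \<in> LFG F G"
    by (subst (asm) LFG_root_scale_iff[OF F G p_pos]) (simp_all add: g_def[abs_def])
  show thesis
    by (rule that[OF g fg]) (simp add: lorentz lorentz_root_scale[OF F G p_pos g])
qed

lemma boyd_exponent_root_scale:
  assumes F: "phi_function F" and G: "phi_function G" and p_pos: "0 < p"
    and boyd: "boyd_exponent F G q"
  shows "boyd_exponent (root_scale p F) (root_scale p G) (q / p)"
proof -
  from boyd obtain c where q_pos: "0 < q" and c_nonneg: "0 \<le> c"
    and lorentz_dil_le: "\<And>a f. 0 < a \<Longrightarrow> a < 1 \<Longrightarrow> f \<in> LFG F G \<Longrightarrow>
      lorentz F G (dil a f) \<le> ennreal (c * a powr (-1 / q)) * lorentz F G f"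
    unfolding boyd_exponent_def by blast
  have "lorentz (root_scale p F) (root_scale p G) (dil a f)
      \<le> ennreal (c powr p * a powr (-1 / (q / p))) * lorentz (root_scale p F) (root_scale p G) f"
    if a: "0 < a" "a < 1" and f: "f \<in> LFG (root_scale p F) (root_scale p G)" for a f
  proof -
    obtain g where g: "g \<in> LFG F G" and fg: "\<And>x. \<bar>f x\<bar> = \<bar>g x\<bar> powr p"
      and lorentz_f: "lorentz (root_scale p F) (root_scale p G) f = ennreal (enn2real (lorentz F G g) powr p)"
      using LFG_root_scaleE[OF F G p_pos f] by blast
    define N where "N = enn2real (lorentz F G g)"
    have N: "0 \<le> N" "lorentz F G g = ennreal N" using LFG_lorentz[OF g] by (simp_all add: N_def)
    have "lorentz F G (dil a g) \<le> ennreal (c * a powr (-1 / q) * N)"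
      using lorentz_dil_le[OF a g] c_nonneg N by (simp add: ennreal_mult)
    then have "lorentz (root_scale p F) (root_scale p G) (\<lambda>x. \<bar>dil a g x\<bar> powr p)
        \<le> ennreal ((c * a powr (-1 / q) * N) powr p)"
      using c_nonneg N by (subst lorentz_root_scale_le_iff[OF F G p_pos]) auto
    also have "(c * a powr (-1 / q) * N) powr p = c powr p * a powr (-1 / (q / p)) * N powr p"
      using c_nonneg N p_pos q_pos by (simp add: powr_mult powr_powr)
    also have "ennreal \<dots> = ennreal (c powr p * a powr (-1 / (q / p))) * ennreal (N powr p)"
      by (intro ennreal_mult) auto
    also have "ennreal (N powr p) = lorentz (root_scale p F) (root_scale p G) f"
      by (simp add: N_def lorentz_f)
    also have "lorentz (root_scale p F) (root_scale p G) (\<lambda>x. \<bar>dil a g x\<bar> powr p)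
        = lorentz (root_scale p F) (root_scale p G) (dil a f)"
      by (rule lorentz_cong) (simp add: dil_def fg)
    finally show ?thesis .
  qed
  then show ?thesis
    unfolding boyd_exponent_def using q_pos p_pos by (intro conjI exI[of _ "c powr p"]) auto
qed

lemma boyd_exponent_of_root_scale:
  assumes F: "phi_function F" and G: "phi_function G" and p_pos: "0 < p"
    and boyd: "boyd_exponent (root_scale p F) (root_scale p G) (q / p)"
  shows "boyd_exponent F G q"
proof -
  from boyd obtain c where q_pos: "0 < q" and c_nonneg: "0 \<le> c"
    and lorentz_dil_le: "\<And>a f. 0 < a \<Longrightarrow> a < 1 \<Longrightarrow> f \<in> LFG (root_scale p F) (root_scale p G) \<Longrightarrow>
      lorentz (root_scale p F) (root_scale p G) (dil a f)
        \<le> ennreal (c * a powr (-1 / (q / p))) * lorentz (root_scale p F) (root_scale p G) f"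
    using p_pos unfolding boyd_exponent_def by (auto simp: zero_less_divide_iff)
  have "lorentz F G (dil a f) \<le> ennreal (c powr (1 / p) * a powr (-1 / q)) * lorentz F G f"
    if a: "0 < a" "a < 1" and f: "f \<in> LFG F G" for a f
  proof -
    define N where "N = enn2real (lorentz F G f)"
    have N: "0 \<le> N" "lorentz F G f = ennreal N" using LFG_lorentz[OF f] by (simp_all add: N_def)
    have pow: "(\<lambda>x. \<bar>f x\<bar> powr p) \<in> LFG (root_scale p F) (root_scale p G)"
      using LFG_root_scale_iff[OF F G p_pos LFG_measurable[OF f]] f by simp
    have "lorentz (root_scale p F) (root_scale p G) (\<lambda>x. \<bar>dil a f x\<bar> powr p)
        \<le> ennreal (c * a powr (-1 / (q / p))) * ennreal (N powr p)"
      using lorentz_dil_le[OF a pow] lorentz_root_scale[OF F G p_pos f]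
        by (simp add: N_def dil_def[abs_def])
    also have "\<dots> = ennreal ((c powr (1 / p) * a powr (-1 / q) * N) powr p)"
      using c_nonneg N p_pos q_pos by (simp add: ennreal_mult[symmetric] powr_mult powr_powr)
    finally have "lorentz F G (dil a f) \<le> ennreal (c powr (1 / p) * a powr (-1 / q) * N)"
      using N by (subst (asm) lorentz_root_scale_le_iff[OF F G p_pos]) auto
    then show ?thesis using N by (simp add: ennreal_mult)
  qed
  then show ?thesis
    unfolding boyd_exponent_def using q_pos by (intro conjI exI[of _ "c powr (1 / p)"]) auto
qed

lemma normable_of_p_convex:
  assumes F: "phi_function F" and G: "phi_function G" and p_pos: "0 < p"
    and pc: "p_convex F G p"
  shows "normable (root_scale p F) (root_scale p G)"
proof -
  from pc obtain C0 where C0: "\<And>n (fs :: nat \<Rightarrow> real \<Rightarrow> real). (\<forall>i<n. fs i \<in> LFG F G) \<Longrightarrow>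
      lorentz F G (\<lambda>x. (\<Sum>i<n. \<bar>fs i x\<bar> powr p) powr (1 / p))
        \<le> ennreal (C0 * (\<Sum>i<n. enn2real (lorentz F G (fs i)) powr p) powr (1 / p))"
    unfolding p_convex_def by blast
  show ?thesis
    unfolding normable_def
  proof (intro exI[of _ "max C0 0 powr p"] conjI allI impI)
    fix n and fs :: "nat \<Rightarrow> real \<Rightarrow> real"
    assume fs: "\<forall>i<n. fs i \<in> LFG (root_scale p F) (root_scale p G)"
    have "\<exists>h. h \<in> LFG F G \<and> (\<forall>x. \<bar>fs i x\<bar> = \<bar>h x\<bar> powr p) \<and>
        lorentz (root_scale p F) (root_scale p G) (fs i) = ennreal (enn2real (lorentz F G h) powr p)"
      if "i < n" for i
      using LFG_root_scaleE[OF F G p_pos, of "fs i"] fs that by (metis (no_types))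
    then obtain g where g: "\<And>i. i < n \<Longrightarrow> g i \<in> LFG F G \<and> (\<forall>x. \<bar>fs i x\<bar> = \<bar>g i x\<bar> powr p) \<and>
        lorentz (root_scale p F) (root_scale p G) (fs i) = ennreal (enn2real (lorentz F G (g i)) powr p)"
      by metis
    define N where "N i = enn2real (lorentz F G (g i))" for i
    define S where "S = (\<Sum>i<n. N i powr p)"
    have S_nonneg: "0 \<le> S" by (simp add: S_def sum_nonneg)
    have "lorentz F G (\<lambda>x. (\<Sum>i<n. \<bar>g i x\<bar> powr p) powr (1 / p)) \<le> ennreal (C0 * S powr (1 / p))"
      unfolding S_def N_def using g by (intro C0) simp
    also have "\<dots> \<le> ennreal (max C0 0 * S powr (1 / p))" by (intro ennreal_leI mult_right_mono) auto
    finally have "lorentz (root_scale p F) (root_scale p G)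
        (\<lambda>x. \<bar>(\<Sum>i<n. \<bar>g i x\<bar> powr p) powr (1 / p)\<bar> powr p) \<le> ennreal ((max C0 0 * S powr (1 / p)) powr p)"
      by (subst lorentz_root_scale_le_iff[OF F G p_pos]) auto
    also have "(max C0 0 * S powr (1 / p)) powr p = max C0 0 powr p * S"
      using p_pos S_nonneg by (simp add: powr_mult powr_powr)
    also have "ennreal (max C0 0 powr p * S) = ennreal (max C0 0 powr p) * (\<Sum>i<n. ennreal (N i powr p))"
      using S_nonneg by (simp add: ennreal_mult S_def sum_ennreal)
    also have "(\<Sum>i<n. ennreal (N i powr p)) = (\<Sum>i<n. lorentz (root_scale p F) (root_scale p G) (fs i))"
      using g by (intro sum.cong) (auto simp: N_def)
    also have "lorentz (root_scale p F) (root_scale p G)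
        (\<lambda>x. \<bar>(\<Sum>i<n. \<bar>g i x\<bar> powr p) powr (1 / p)\<bar> powr p)
        = lorentz (root_scale p F) (root_scale p G) (\<lambda>x. \<Sum>i<n. \<bar>fs i x\<bar>)"
      using p_pos g by (intro lorentz_cong) (simp add: powr_powr sum_nonneg)
    finally show "lorentz (root_scale p F) (root_scale p G) (\<lambda>x. \<Sum>i<n. \<bar>fs i x\<bar>)
      \<le> ennreal (max C0 0 powr p) * (\<Sum>i<n. lorentz (root_scale p F) (root_scale p G) (fs i))" .
  qed simp
qed

lemma p_convex_of_normable:
  assumes F: "phi_function F" and G: "phi_function G" and p_pos: "0 < p"
    and norm: "normable (root_scale p F) (root_scale p G)"
  shows "p_convex F G p"
proof -
  from norm obtain C where C_nonneg: "0 \<le> C" and lorentz_sum_le: "\<And>n (fs :: nat \<Rightarrow> real \<Rightarrow> real).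
      (\<forall>i<n. fs i \<in> LFG (root_scale p F) (root_scale p G)) \<Longrightarrow>
      lorentz (root_scale p F) (root_scale p G) (\<lambda>x. \<Sum>i<n. \<bar>fs i x\<bar>)
        \<le> ennreal C * (\<Sum>i<n. lorentz (root_scale p F) (root_scale p G) (fs i))"
    unfolding normable_def by blast
  show ?thesis
    unfolding p_convex_def
  proof (intro exI[of _ "C powr (1 / p)"] allI impI)
    fix n and fs :: "nat \<Rightarrow> real \<Rightarrow> real" assume fs: "\<forall>i<n. fs i \<in> LFG F G"
    define S where "S = (\<Sum>i<n. enn2real (lorentz F G (fs i)) powr p)"
    have S_nonneg: "0 \<le> S" by (simp add: S_def sum_nonneg)
    have "lorentz (root_scale p F) (root_scale p G) (\<lambda>x. \<bar>(\<Sum>i<n. \<bar>fs i x\<bar> powr p) powr (1 / p)\<bar> powr p)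
        = lorentz (root_scale p F) (root_scale p G) (\<lambda>x. \<Sum>i<n. \<bar>\<bar>fs i x\<bar> powr p\<bar>)"
      using p_pos by (intro lorentz_cong) (simp add: powr_powr sum_nonneg)
    also have "\<dots> \<le> ennreal C *
        (\<Sum>i<n. lorentz (root_scale p F) (root_scale p G) (\<lambda>x. \<bar>fs i x\<bar> powr p))"
      using fs LFG_root_scale_iff[OF F G p_pos]
        by (intro lorentz_sum_le allI impI) (simp add: LFG_measurable[of _ F G])
    also have "\<dots> = ennreal ((C powr (1 / p) * S powr (1 / p)) powr p)"
      using fs C_nonneg S_nonneg p_pos lorentz_root_scale[OF F G p_pos]
      by (simp add: powr_mult powr_powr ennreal_mult sum_ennreal S_def)
    finally show "lorentz F G (\<lambda>x. (\<Sum>i<n. \<bar>fs i x\<bar> powr p) powr (1 / p))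
        \<le> ennreal (C powr (1 / p) * (\<Sum>i<n. enn2real (lorentz F G (fs i)) powr p) powr (1 / p))"
      unfolding S_def[symmetric] by (subst (asm) lorentz_root_scale_le_iff[OF F G p_pos]) auto
  qed
qed

section \<open>Linearization on decreasing functions\<close>

lemma convex_on_scale_le:
  fixes K :: "real \<Rightarrow> real"
  assumes "convex_on {0..} K" "K 0 = 0" "0 \<le> a" "a \<le> 1" "0 \<le> u"
  shows "K (a * u) \<le> a * K u"
proof -
  have "K ((1 - a) *\<^sub>R 0 + a *\<^sub>R u) \<le> (1 - a) * K 0 + a * K u"
    using assms by (intro convex_onD) auto
  then show ?thesis using assms by simp
qed

lemma phi_function_of_convex:
  fixes K :: "real \<Rightarrow> real"
  assumes conv: "convex_on {0..} K" and zero: "K 0 = 0" and K_pos: "\<And>u. 0 < u \<Longrightarrow> 0 < K u"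
  shows "phi_function K"
proof (rule phi_functionI_surj)
  note scale = convex_on_scale_le[OF conv zero]
  show "K s < K t" if "0 \<le> s" "s < t" for s t
  proof -
    have "K (s / t * t) \<le> s / t * K t" using that by (intro scale) auto
    also have "\<dots> < 1 * K t" using that K_pos[of t] by (intro mult_strict_right_mono) auto
    finally show ?thesis using that by simp
  qed
  fix y :: real assume "0 \<le> y"
  show "\<exists>x\<ge>0. K x = y"
  proof (cases "y = 0")
    case False
    define s t where "s = min 1 (y / K 1)" and "t = max 1 (y / K 1)"
    have st: "0 < s" "s \<le> 1" "1 \<le> t" "s * K 1 \<le> y" "y \<le> t * K 1"
      using K_pos[of 1] \<open>0 \<le> y\<close> False by (auto simp: s_def t_def min_def max_def field_simps)
    have "K (s * 1) \<le> s * K 1" "K (1 / t * t) \<le> 1 / t * K t" using st by (intro scale; simp)+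
    then have "K s \<le> y" "y \<le> K t" using st by (auto simp: field_simps)
    moreover have "continuous_on {s..t} K"
    proof (rule continuous_on_subset)
      have "convex_on {0<..} K" using conv by (rule convex_on_subset) auto
      then show "continuous_on {0<..} K" by (intro convex_on_continuous) auto
    qed (use st in auto)
    ultimately obtain x where "s \<le> x" "K x = y" using IVT'[of K s y t] st by auto
    then show ?thesis using st by (intro exI[of _ x]) simp
  qed (use zero in auto)
qed (rule zero)

lemma integral_indicator_tendsto_0_at_top:
  fixes f :: "'a \<Rightarrow> real" and A :: "real \<Rightarrow> 'a set"
  assumes f: "integrable M f" and A[measurable]: "\<And>y. A y \<in> sets M"
    and ev: "\<And>x. x \<in> space M \<Longrightarrow> eventually (\<lambda>y. x \<notin> A y) at_top"
  shows "((\<lambda>y. \<integral>x. indicator (A y) x * f x \<partial>M) \<longlongrightarrow> 0) at_top"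
proof -
  have [measurable]: "f \<in> borel_measurable M" using f by simp
  have "((\<lambda>y. \<integral>x. indicator (A y) x * f x \<partial>M) \<longlongrightarrow> (\<integral>x. 0 \<partial>M)) at_top"
  proof (rule integral_dominated_convergence_at_top)
    show "integrable M (\<lambda>x. \<bar>f x\<bar>)" using f by simp
    show "AE x in M. ((\<lambda>y. indicator (A y) x * f x) \<longlongrightarrow> 0) at_top"
    proof (rule AE_I2)
      fix x assume "x \<in> space M"
      then have "eventually (\<lambda>y. indicator (A y) x * f x = 0) at_top"
        using ev[of x] by (auto elim: eventually_mono)
      then show "((\<lambda>y. indicator (A y) x * f x) \<longlongrightarrow> 0) at_top" by (rule tendsto_eventually)
    qed
    show "eventually (\<lambda>y. AE x in M. norm (indicator (A y) x * f x) \<le> \<bar>f x\<bar>) at_top"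
      by (simp add: indicator_def)
  qed measurable
  then show ?thesis by simp
qed

lemma decreasing_fun_integrable:
  assumes "decreasing_fun g" "(\<integral>\<^sup>+ x. ennreal (g x) \<partial>half_line) < \<infinity>"
  shows "integrable half_line g"
  using decreasing_fun_measurable assms
  by (intro integrableI_nonneg AE_I2) (simp_all add: space_restrict_space decreasing_fun_nonneg)

lemma decreasing_fun_le_integral:
  assumes g: "decreasing_fun g" "integrable half_line g"
    and uv: "0 \<le> u" "u < v" and A: "{u<..v} \<subseteq> A" "A \<in> sets half_line"
  shows "(v - u) * g v \<le> (\<integral>x. indicator A x * g x \<partial>half_line)"
proof -
  have Ioc: "{u<..v} \<in> sets half_line" "{u<..v} \<inter> {0<..} = {u<..v}"
    using uv by (auto simp: sets_restrict_space_iff)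
  have "measure half_line {u<..v} = v - u" "emeasure half_line {u<..v} < \<infinity>"
    using uv by (subst measure_restrict_space emeasure_restrict_space; auto)+
  then have Ioc_int: "integrable half_line (\<lambda>x. indicator {u<..v} x * g v)"
    and integral_const: "(v - u) * g v = (\<integral>x. indicator {u<..v} x * g v \<partial>half_line)"
    using Ioc by (auto simp: integrable_mult_left space_restrict_space)
  note integral_const
  also have "\<dots> \<le> (\<integral>x. indicator A x * g x \<partial>half_line)"
  proof (rule integral_mono[OF Ioc_int])
    show "integrable half_line (\<lambda>x. indicator A x * g x)"
      using integrable_mult_indicator[OF A(2) g(2)] by simp
    show "indicator {u<..v} x * g v \<le> indicator A x * g x" if "x \<in> space half_line" for x
      using that A(1) decreasing_funD[OF g(1), of x v] decreasing_fun_nonneg[OF g(1), of x]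
      by (auto simp: indicator_def space_restrict_space)
  qed
  finally show ?thesis .
qed

lemma decreasing_integrable_at_top:
  assumes g: "decreasing_fun g" and integrable: "integrable half_line g"
  shows "((\<lambda>x. x * g x) \<longlongrightarrow> 0) at_top"
proof (rule tendsto_sandwich[of "\<lambda>_. 0"])
  have "filterlim (\<lambda>x::real. x / 2) at_top at_top" by real_asymp
  moreover have "((\<lambda>y. \<integral>x. indicator {max 0 y<..} x * g x \<partial>half_line) \<longlongrightarrow> 0) at_top"
    using integrable
  proof (rule integral_indicator_tendsto_0_at_top)
    show "eventually (\<lambda>y. x \<notin> {max 0 y<..}) at_top" for x :: real
      using eventually_ge_at_top[of x] by eventually_elim simp
  qed (auto simp: sets_restrict_space_iff)
  ultimately show "((\<lambda>y. 2 * (\<integral>x. indicator {max 0 (y / 2)<..} x * g x \<partial>half_line)) \<longlongrightarrow> 0) at_top"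
    by (intro tendsto_mult_right_zero) (rule filterlim_compose)
  show "eventually (\<lambda>x. x * g x \<le> 2 * (\<integral>y. indicator {max 0 (x / 2)<..} y * g y \<partial>half_line)) at_top"
    using eventually_gt_at_top[of 0]
  proof eventually_elim
    case (elim x)
    then show ?case using decreasing_fun_le_integral[OF g integrable, of "x / 2" x "{max 0 (x / 2)<..}"]
      by (auto simp: sets_restrict_space_iff subset_iff)
  qed
  show "eventually (\<lambda>x. 0 \<le> x * g x) at_top"
    using eventually_gt_at_top[of 0] by eventually_elim (simp add: decreasing_fun_nonneg[OF g])
qed simp

lemma decreasing_integrable_at_right_0:
  assumes g: "decreasing_fun g" and integrable: "integrable half_line g"
  shows "((\<lambda>x. x * g x) \<longlongrightarrow> 0) (at_right 0)"
proof -
  have "((\<lambda>y. inverse y * g (inverse y)) \<longlongrightarrow> 0) at_top"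
  proof (rule tendsto_sandwich[of "\<lambda>_. 0"])
    show "((\<lambda>y. \<integral>x. indicator {0<..inverse y} x * g x \<partial>half_line) \<longlongrightarrow> 0) at_top"
      using integrable
    proof (rule integral_indicator_tendsto_0_at_top)
      fix x assume "x \<in> space half_line"
      then have x_pos: "0 < x" by (simp add: space_restrict_space)
      show "eventually (\<lambda>y. x \<notin> {0<..inverse y}) at_top"
        using eventually_gt_at_top[of "max 0 (inverse x)"]
      proof eventually_elim
        case (elim y)
        then show ?case using less_imp_inverse_less[of "inverse x" y] x_pos by simp
      qed
    qed (auto simp: sets_restrict_space_iff)
    show "eventually (\<lambda>y. inverse y * g (inverse y) \<le> (\<integral>x. indicator {0<..inverse y} x * g x \<partial>half_line)) at_top"
      using eventually_gt_at_top[of 0]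
    proof eventually_elim
      case (elim y)
      then show ?case using decreasing_fun_le_integral[OF g integrable, of 0 "inverse y" "{0<..inverse y}"]
        by (auto simp: sets_restrict_space_iff subset_iff)
    qed
    show "eventually (\<lambda>y. 0 \<le> inverse y * g (inverse y)) at_top"
      using eventually_gt_at_top[of 0] by eventually_elim (simp add: decreasing_fun_nonneg[OF g])
  qed simp
  then show ?thesis by (simp add: filterlim_at_right_to_top)
qed

locale condJ_factorization =
  fixes G H Hs K :: "real \<Rightarrow> real" and a b d0 :: real
  assumes G: "phi_function G" and H: "phi_function H" and Hs: "phi_function Hs"
    and K_convex: "convex_on {0..} K" and a_pos: "0 < a" and b_pos: "0 < b" and d0: "0 < d0"
    and complementary_ge: "\<And>t. 0 \<le> t \<Longrightarrow> t / a \<le> phi_inv H t * phi_inv Hs t"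
    and complementary_le: "\<And>t. 0 \<le> t \<Longrightarrow> phi_inv H t * phi_inv Hs t \<le> a * t"
    and GH_le_K: "\<And>u. 0 \<le> u \<Longrightarrow> G (H (u / b)) \<le> K u"
    and K_le_GH: "\<And>u. 0 \<le> u \<Longrightarrow> K u \<le> G (H (b * u))"
    and J: "modular Hs (\<lambda>x. phi_inv Hs (1 / x) / d0) \<le> 1"
begin

lemma K_zero: "K 0 = 0"
  using GH_le_K[of 0] K_le_GH[of 0] by (simp add: phi_zero G H)

lemma K: "phi_function K"
proof (rule phi_function_of_convex[OF K_convex K_zero])
  fix u :: real assume u_pos: "0 < u"
  then have "0 < G (H (u / b))" using b_pos by (simp add: phi_pos G H)
  also have "\<dots> \<le> K u" using u_pos by (intro GH_le_K) simp
  finally show "0 < K u" .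
qed

lemma K_scale_le: "0 \<le> s \<Longrightarrow> s \<le> 1 \<Longrightarrow> 0 \<le> u \<Longrightarrow> K (s * u) \<le> s * K u"
  by (rule convex_on_scale_le[OF K_convex K_zero])

lemma K_mono: "0 \<le> u \<Longrightarrow> u \<le> v \<Longrightarrow> K u \<le> K v"
  by (simp add: phi_le_iff K)

definition \<rho> :: "real \<Rightarrow> real" where "\<rho> = phi_inv Hs"

definition \<kappa> :: real where "\<kappa> = max 1 (max (a * b) (a * a))"

definition \<delta> :: real where "\<delta> = max d0 (2 * \<kappa>)"

lemma kappa: "1 \<le> \<kappa>" "a * b \<le> \<kappa>" "a * a \<le> \<kappa>"
  by (auto simp: \<kappa>_def)

lemma delta: "0 < \<delta>" "d0 \<le> \<delta>" "2 * \<kappa> \<le> \<delta>"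
  using d0 by (auto simp: \<delta>_def)

lemma rho: "phi_function \<rho>"
  unfolding \<rho>_def by (rule phi_function_phi_inv[OF Hs])

lemma rho_pos: "0 < t \<Longrightarrow> 0 < \<rho> t"
  by (rule phi_pos[OF rho])

lemma ratio_pos: "0 < t \<Longrightarrow> 0 < t / \<rho> t"
  by (simp add: rho_pos)

lemma
  assumes "0 < t"
  shows ratio_le_phi_inv: "t / \<rho> t \<le> a * phi_inv H t" and phi_inv_le_ratio: "phi_inv H t \<le> a * (t / \<rho> t)"
  using complementary_ge[of t] complementary_le[of t] assms a_pos rho_pos[OF assms]
  by (auto simp: \<rho>_def field_simps)

lemma K_le_G:
  assumes t_pos: "0 < t"
  shows "K (t / \<rho> t / \<kappa>) \<le> G t"
proof -
  have phi_inv_H_pos: "0 < phi_inv H t" using H t_pos by (rule phi_inv_pos)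
  define r where "r = t / \<rho> t"
  have "b * r \<le> b * (a * phi_inv H t)"
    unfolding r_def using ratio_le_phi_inv[OF t_pos] b_pos by (intro mult_left_mono) auto
  also have "\<dots> = (a * b) * phi_inv H t" by simp
  also have "\<dots> \<le> \<kappa> * phi_inv H t" using kappa phi_inv_H_pos by (intro mult_right_mono) auto
  finally have "r / \<kappa> \<le> phi_inv H t / b" using kappa b_pos by (simp add: field_simps)
  moreover have "0 \<le> r / \<kappa>" using kappa t_pos rho_pos[OF t_pos] by (simp add: r_def)
  ultimately have "K (r / \<kappa>) \<le> K (phi_inv H t / b)" by (intro K_mono)
  also have "\<dots> \<le> G (H (b * (phi_inv H t / b)))" using b_pos phi_inv_H_pos by (intro K_le_GH) auto
  also have "\<dots> = G t" using b_pos t_pos by (simp add: phi_phi_inv H)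
  finally show ?thesis by (simp add: r_def)
qed

lemma G_le_K:
  assumes t_pos: "0 < t"
  shows "G t \<le> K (\<kappa> * (t / \<rho> t))"
proof -
  have phi_inv_H_pos: "0 < phi_inv H t" using H t_pos by (rule phi_inv_pos)
  have "G t = G (H (b * phi_inv H t / b))" using b_pos t_pos by (simp add: phi_phi_inv H)
  also have "\<dots> \<le> K (b * phi_inv H t)" using b_pos phi_inv_H_pos by (intro GH_le_K) auto
  also have "\<dots> \<le> K (\<kappa> * (t / \<rho> t))"
  proof (rule K_mono)
    show "0 \<le> b * phi_inv H t" using b_pos phi_inv_H_pos by simp
    have "b * phi_inv H t \<le> b * (a * (t / \<rho> t))"
      using phi_inv_le_ratio[OF t_pos] b_pos by (intro mult_left_mono) auto
    also have "\<dots> = (a * b) * (t / \<rho> t)" by simp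
    also have "\<dots> \<le> \<kappa> * (t / \<rho> t)" using kappa ratio_pos[OF t_pos] by (intro mult_right_mono) auto
    finally show "b * phi_inv H t \<le> \<kappa> * (t / \<rho> t)" .
  qed
  finally show ?thesis .
qed

lemma ratio_quasi_mono:
  assumes "0 < s" "s \<le> t"
  shows "s / \<rho> s \<le> \<kappa> * (t / \<rho> t)"
proof -
  have t_pos: "0 < t" using assms by simp
  have "s / \<rho> s \<le> a * phi_inv H s" by (rule ratio_le_phi_inv[OF assms(1)])
  also have "\<dots> \<le> a * phi_inv H t" using assms a_pos by (simp add: phi_inv_le_iff H)
  also have "\<dots> \<le> a * (a * (t / \<rho> t))"
    using a_pos phi_inv_le_ratio[OF t_pos] by (intro mult_left_mono) auto
  also have "\<dots> = (a * a) * (t / \<rho> t)" by simp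
  also have "\<dots> \<le> \<kappa> * (t / \<rho> t)" using kappa ratio_pos[OF t_pos] by (intro mult_right_mono) auto
  finally show ?thesis .
qed

lemma ratio_unbounded: obtains t where "0 < t" "L \<le> t / \<rho> t"
proof
  let ?t = "H (max 1 (a * L))"
  show t: "0 < ?t" by (simp add: phi_pos H)
  have "a * L \<le> phi_inv H ?t" by (simp add: phi_inv_phi H)
  also have "\<dots> \<le> a * (?t / \<rho> ?t)" by (rule phi_inv_le_ratio[OF t])
  finally show "L \<le> ?t / \<rho> ?t" using a_pos by (subst (asm) mult_le_cancel_left_pos) auto
qed

definition threshold :: "real \<Rightarrow> real" where
  "threshold t = Hs (\<rho> t / \<delta>)"

lemma threshold: "phi_function threshold"
proof (rule phi_functionI_surj)
  show "threshold s < threshold t" if "0 \<le> s" "s < t" for s t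
    using that delta(1) by (simp add: threshold_def phi_less_iff Hs rho phi_nonneg divide_strict_right_mono)
  show "\<exists>t\<ge>0. threshold t = s" if "0 \<le> s" for s
    using that delta(1)
    by (intro exI[of _ "Hs (\<delta> * \<rho> s)"])
      (simp add: threshold_def \<rho>_def phi_inv_phi phi_phi_inv phi_inv_nonneg phi_nonneg Hs)
qed (simp add: threshold_def phi_zero Hs rho)

lemma threshold_pos: "0 < t \<Longrightarrow> 0 < threshold t"
  by (rule phi_pos[OF threshold])

lemma rho_threshold: "0 < t \<Longrightarrow> \<rho> (threshold t) = \<rho> t / \<delta>"
  using delta(1) rho_pos[of t] by (simp add: threshold_def \<rho>_def phi_inv_phi Hs)

lemma threshold_le:
  assumes t_pos: "0 < t"
  shows "threshold t \<le> t / 2"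
proof -
  have "(t / 2) / \<rho> (t / 2) \<le> \<kappa> * (t / \<rho> t)" using t_pos by (intro ratio_quasi_mono) auto
  then have "\<rho> t \<le> 2 * \<kappa> * \<rho> (t / 2)"
    using t_pos rho_pos[of t] rho_pos[of "t / 2"] by (simp add: field_simps)
  also have "\<dots> \<le> \<delta> * \<rho> (t / 2)" using delta rho_pos[of "t / 2"] t_pos by (intro mult_right_mono) auto
  finally have "\<rho> (threshold t) \<le> \<rho> (t / 2)"
    using t_pos delta(1) by (simp add: rho_threshold field_simps)
  then show ?thesis using t_pos threshold_pos[OF t_pos] by (simp add: phi_le_iff rho)
qed

lemma decreasing_fun_threshold: "decreasing_fun (\<lambda>x. threshold (1 / x))"
  by (intro decreasing_fun_phi[OF threshold]) (auto intro!: decreasing_funI frac_le)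

lemma nn_integral_threshold_le: "(\<integral>\<^sup>+ x. ennreal (threshold (1 / x)) \<partial>half_line) \<le> 1"
proof -
  have "(\<integral>\<^sup>+ x. ennreal (threshold (1 / x)) \<partial>half_line) = modular Hs (\<lambda>x. \<rho> (1 / x) / \<delta>)"
    by (simp add: modular_def threshold_def)
  also have "\<dots> \<le> modular Hs (\<lambda>x. phi_inv Hs (1 / x) / d0)"
    using d0 delta by (intro modular_mono Hs) (auto simp: \<rho>_def phi_inv_nonneg Hs intro!: divide_left_mono)
  also note J
  finally show ?thesis .
qed

lemma threshold_small:
  assumes e_pos: "0 < e"
  obtains \<alpha> \<beta> where "0 < \<alpha>" "0 < \<beta>" "\<And>t. 0 < t \<Longrightarrow> t \<le> \<alpha> \<or> \<beta> \<le> t \<Longrightarrow> threshold t < e * t"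
proof -
  have fin: "(\<integral>\<^sup>+ x. ennreal (threshold (1 / x)) \<partial>half_line) < \<infinity>"
    using nn_integral_threshold_le by (rule le_less_trans) simp
  note int = decreasing_fun_integrable[OF decreasing_fun_threshold fin]
  have "eventually (\<lambda>x. x * threshold (1 / x) < e) at_top"
    "eventually (\<lambda>x. x * threshold (1 / x) < e) (at_right 0)"
    using decreasing_integrable_at_top[OF decreasing_fun_threshold int]
      decreasing_integrable_at_right_0[OF decreasing_fun_threshold int] e_pos
        by (auto dest: order_tendstoD)
  then obtain N r where N: "\<And>x. N \<le> x \<Longrightarrow> x * threshold (1 / x) < e"
    and r: "0 < r" "\<And>x. 0 < x \<Longrightarrow> x < r \<Longrightarrow> x * threshold (1 / x) < e"
    unfolding eventually_at_top_linorder eventually_at_right_field by auto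
  define m where "m = max 1 N"
  have m: "0 < m" "N \<le> m" by (auto simp: m_def)
  show thesis
  proof
    show "0 < 1 / m" "0 < 2 / r" using r m by auto
    fix t :: real assume t: "0 < t" "t \<le> 1 / m \<or> 2 / r \<le> t"
    from t(2) have "1 / t * threshold (1 / (1 / t)) < e"
    proof
      assume "t \<le> 1 / m"
      then have "m \<le> 1 / t" using t(1) m by (simp add: field_simps)
      then show ?thesis using m by (intro N) simp
    next
      assume "2 / r \<le> t"
      then have "1 / t < r" using t(1) r(1) mult_pos_pos[of t r] by (simp add: field_simps)
      then show ?thesis using t(1) by (intro r) auto
    qed
    then show "threshold t < e * t" using t(1) by (simp add: field_simps)
  qed
qed

end

definition decreasing_sum_bound :: "(real \<Rightarrow> real) \<Rightarrow> real \<Rightarrow> bool" where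
  "decreasing_sum_bound G C \<longleftrightarrow> 0 \<le> C \<and> (\<forall>n (f :: nat \<Rightarrow> real \<Rightarrow> real). (\<forall>i<n. decreasing_fun (f i)) \<longrightarrow>
      lux G (\<lambda>x. \<Sum>i<n. f i x) \<le> ennreal C * (\<Sum>i<n. lux G (f i)))"

lemma decreasing_sum_boundD:
  "decreasing_sum_bound G C \<Longrightarrow> (\<And>i. i < n \<Longrightarrow> decreasing_fun (f i)) \<Longrightarrow>
    lux G (\<lambda>x. \<Sum>i<n::nat. f i x) \<le> ennreal C * (\<Sum>i<n. lux G (f i))"
  by (simp add: decreasing_sum_bound_def)

lemma decreasing_sum_bound_nonneg: "decreasing_sum_bound G C \<Longrightarrow> 0 \<le> C"
  by (simp add: decreasing_sum_bound_def)

context condJ_factorization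
begin

lemma ratio_dilate_ge:
  assumes s_pos: "0 < s" and l_pos: "0 < l" and rho_le: "\<rho> (l * s) \<le> \<delta> * \<rho> s"
  shows "l / \<delta> * (s / \<rho> s) \<le> l * s / \<rho> (l * s)"
proof -
  have "l * s / (\<delta> * \<rho> s) \<le> l * s / \<rho> (l * s)"
    using s_pos l_pos rho_le rho_pos[OF s_pos] rho_pos[of "l * s"] delta(1)
      by (intro divide_left_mono) auto
  then show ?thesis by (simp add: mult_ac)
qed

text \<open>For \<open>s = threshold t\<close> with \<open>t\<close> close to \<open>0\<close> or \<open>\<infinity>\<close>, \<open>s\<close> is much smaller than \<open>t\<close> although
  \<open>\<rho> t = \<delta> * \<rho> s\<close>; the remaining values of \<open>s\<close> are bounded and bounded away from \<open>0\<close>.\<close>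

lemma ratio_growth:
  assumes l_ge_1: "1 \<le> l"
  obtains C where "1 \<le> C" "\<And>s. 0 < s \<Longrightarrow> l * (s / \<rho> s) \<le> C * s / \<rho> (C * s)"
proof -
  define L where "L = l * \<kappa> * \<delta>"
  have L_ge_1: "1 \<le> L"
    using mult_mono[OF mult_mono[OF l_ge_1 kappa(1)], of 1 \<delta>] l_ge_1 kappa delta by (simp add: L_def)
  obtain \<alpha> \<beta> where ab: "0 < \<alpha>" "0 < \<beta>"
    and small: "\<And>t. 0 < t \<Longrightarrow> t \<le> \<alpha> \<or> \<beta> \<le> t \<Longrightarrow> threshold t < 1 / L * t"
    using threshold_small[of "1 / L"] L_ge_1 by auto
  obtain T where T: "0 < T" "l * \<kappa> * \<kappa> * (\<beta> / \<rho> \<beta>) \<le> T / \<rho> T" using ratio_unbounded by blast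
  define C where "C = max L (T * L / \<alpha>)"
  have C: "L \<le> C" "1 \<le> C" "T * L / \<alpha> \<le> C" using L_ge_1 by (auto simp: C_def)
  have "l * (s / \<rho> s) \<le> C * s / \<rho> (C * s)" if s_pos: "0 < s" for s
  proof -
    define t where "t = Hs (\<delta> * \<rho> s)"
    have t: "0 < t" "\<rho> t = \<delta> * \<rho> s"
      using delta(1) rho_pos[OF s_pos] Hs by (auto simp: t_def phi_pos \<rho>_def phi_inv_phi)
    have threshold_t: "threshold t = s"
      using delta(1) t s_pos Hs by (simp add: threshold_def \<rho>_def phi_phi_inv)
    have "\<kappa> * (l * (s / \<rho> s)) \<le> \<kappa> * (C * s / \<rho> (C * s))"
    proof (cases "L * s \<le> t")
      case True
      then have "\<rho> (L * s) \<le> \<delta> * \<rho> s" using t L_ge_1 s_pos by (simp add: phi_le_iff[OF rho] flip: t(2))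
      then have "L / \<delta> * (s / \<rho> s) \<le> L * s / \<rho> (L * s)"
        using s_pos L_ge_1 by (intro ratio_dilate_ge) auto
      also have "\<dots> \<le> \<kappa> * (C * s / \<rho> (C * s))" using C L_ge_1 s_pos by (intro ratio_quasi_mono) auto
      finally show ?thesis using delta(1) by (simp add: L_def mult_ac)
    next
      case False
      then have "\<not> threshold t < 1 / L * t" using threshold_t L_ge_1 by (simp add: field_simps)
      then have "\<alpha> < t" "t < \<beta>" using small[OF t(1)] by force+
      moreover have "s \<le> t" using threshold_le[OF t(1)] threshold_t t by simp
      ultimately have s_bounds: "s \<le> \<beta>" "\<alpha> \<le> L * s" using False by auto
      have "T \<le> (T * L / \<alpha>) * s" using T s_bounds ab by (simp add: field_simps)
      also have "\<dots> \<le> C * s" using C s_pos by (intro mult_right_mono) auto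
      finally have "T / \<rho> T \<le> \<kappa> * (C * s / \<rho> (C * s))" using T by (intro ratio_quasi_mono) auto
      moreover have "s / \<rho> s \<le> \<kappa> * (\<beta> / \<rho> \<beta>)" using s_pos s_bounds by (intro ratio_quasi_mono)
      then have "l * \<kappa> * (s / \<rho> s) \<le> l * \<kappa> * (\<kappa> * (\<beta> / \<rho> \<beta>))"
        using l_ge_1 kappa by (intro mult_left_mono) auto
      ultimately show ?thesis using T by (simp add: mult_ac)
    qed
    then show ?thesis using kappa(1) by (subst (asm) mult_le_cancel_left_pos) auto
  qed
  with C(2) show thesis by (rule that)
qed

lemma G_growth:
  assumes l_ge_1: "1 \<le> l"
  obtains C where "1 \<le> C" "\<And>t. 0 \<le> t \<Longrightarrow> l * G t \<le> G (C * t)"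
proof -
  have "1 \<le> \<kappa> * \<kappa>" using mult_mono[OF kappa(1) kappa(1)] kappa(1) by simp
  then have "1 \<le> l * (\<kappa> * \<kappa>)" using mult_mono[OF l_ge_1, of 1 "\<kappa> * \<kappa>"] l_ge_1 by simp
  then obtain C where C_ge_1: "1 \<le> C"
    and growth: "\<And>t. 0 < t \<Longrightarrow> l * (\<kappa> * \<kappa>) * (t / \<rho> t) \<le> C * t / \<rho> (C * t)"
    using ratio_growth by blast
  have "l * G t \<le> G (C * t)" if t_pos: "0 < t" for t
  proof -
    define r where "r = \<kappa> * (t / \<rho> t)"
    have r_nonneg: "0 \<le> r"
      using kappa(1) ratio_pos[OF t_pos] unfolding r_def by (intro mult_nonneg_nonneg) auto
    have Ct: "0 < C * t" using C_ge_1 t_pos by simp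
    have "G t \<le> K r" unfolding r_def by (rule G_le_K[OF t_pos])
    also have "K (1 / l * (l * r)) \<le> 1 / l * K (l * r)" using l_ge_1 r_nonneg by (intro K_scale_le) auto
    then have "K r \<le> K (l * r) / l" using l_ge_1 by simp
    finally have "l * G t \<le> K (l * r)" using l_ge_1 by (simp add: field_simps)
    also have "\<dots> \<le> K (C * t / \<rho> (C * t) / \<kappa>)"
    proof (rule K_mono)
      show "0 \<le> l * r" using l_ge_1 r_nonneg by simp
      have "\<kappa> * (l * r) \<le> C * t / \<rho> (C * t)" using growth[OF t_pos] by (simp add: r_def mult_ac)
      then show "l * r \<le> C * t / \<rho> (C * t) / \<kappa>"
        using kappa(1) by (subst pos_le_divide_eq) (auto simp: mult_ac)
    qed
    also have "\<dots> \<le> G (C * t)" by (rule K_le_G[OF Ct])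
    finally show ?thesis .
  qed
  moreover have "l * G 0 \<le> G (C * 0)" by (simp add: phi_zero G)
  ultimately show thesis using C_ge_1 by (intro that[of C]) (auto simp: le_less)
qed

lemma G_threshold_le:
  assumes t_pos: "0 < t"
  shows "G (threshold t) \<le> 2 * \<kappa>\<^sup>2 * \<delta> * (threshold t / t) * G (t / 2)"
proof -
  define \<theta> where "\<theta> = 2 * \<kappa>\<^sup>2 * \<delta> * (threshold t / t)"
  have \<theta>: "0 \<le> \<theta>" using kappa delta threshold_pos[OF t_pos] t_pos by (simp add: \<theta>_def)
  have "G (threshold t) \<le> \<theta> * G (t / 2)"
  proof (cases "1 \<le> \<theta>")
    case True
    have "G (threshold t) \<le> G (t / 2)"
      using t_pos threshold_le[OF t_pos] threshold_pos[OF t_pos] by (simp add: phi_le_iff G)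
    also have "\<dots> \<le> \<theta> * G (t / 2)"
      using mult_right_mono[OF True, of "G (t / 2)"] t_pos by (simp add: phi_nonneg G)
    finally show ?thesis .
  next
    case False
    have "G (threshold t) \<le> K (\<kappa> * (threshold t / \<rho> (threshold t)))"
      by (rule G_le_K[OF threshold_pos[OF t_pos]])
    also have "\<kappa> * (threshold t / \<rho> (threshold t)) = \<theta> * (t / \<rho> t / (2 * \<kappa>))"
      using t_pos kappa(1) delta(1) rho_pos[OF t_pos]
        by (simp add: rho_threshold \<theta>_def field_simps power2_eq_square)
    also have "K \<dots> \<le> \<theta> * K (t / \<rho> t / (2 * \<kappa>))"
      using False \<theta> t_pos rho_pos[OF t_pos] kappa(1) by (intro K_scale_le) auto
    also have "K (t / \<rho> t / (2 * \<kappa>)) \<le> K ((t / 2) / \<rho> (t / 2) / \<kappa>)"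
    proof (rule K_mono)
      show "0 \<le> t / \<rho> t / (2 * \<kappa>)" using t_pos rho_pos[OF t_pos] kappa(1) by simp
      have "\<rho> (t / 2) \<le> \<rho> t" using t_pos by (simp add: phi_le_iff rho)
      then show "t / \<rho> t / (2 * \<kappa>) \<le> (t / 2) / \<rho> (t / 2) / \<kappa>"
        using t_pos kappa(1) rho_pos[of t] rho_pos[of "t / 2"] by (simp add: field_simps)
    qed
    then have "\<theta> * K (t / \<rho> t / (2 * \<kappa>)) \<le> \<theta> * G (t / 2)"
      using K_le_G[of "t / 2"] t_pos \<theta> by (intro mult_left_mono) auto
    finally show ?thesis .
  qed
  then show ?thesis by (simp add: \<theta>_def)
qed

text \<open>Averaging over a window of length comparable to \<open>1 / envelope G x\<close> transfers the integral of
  \<open>G \<circ> threshold \<circ> envelope G\<close> to the variable in which (J) is stated.\<close>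

definition window :: "real \<Rightarrow> real \<Rightarrow> ennreal" where
  "window x y = (if 1 \<le> 2 * envelope G x * y \<and> envelope G x * y \<le> 1
     then ennreal (G (threshold (1 / y)) / y) else 0)"

lemma window_measurable: "case_prod window \<in> borel_measurable (half_line \<Otimes>\<^sub>M half_line)"
proof -
  have [measurable]: "envelope G \<in> borel_measurable half_line"
    by (intro decreasing_fun_measurable decreasing_fun_envelope G)
  have [measurable]: "(\<lambda>y. G (threshold (1 / y))) \<in> borel_measurable half_line"
    by (intro decreasing_fun_measurable decreasing_fun_phi[OF G] decreasing_fun_threshold)
  have [measurable]: "(\<lambda>y. y) \<in> borel_measurable half_line" by (rule measurable_restrict_space1) simp
  show ?thesis unfolding window_def by measurable
qed

lemma le_nn_integral_window:
  assumes x_pos: "0 < x"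
  shows "ennreal (G (threshold (envelope G x))) \<le> 2 * (\<integral>\<^sup>+ y. window x y \<partial>half_line)"
proof -
  define t where "t = envelope G x"
  have t_pos: "0 < t" using x_pos by (simp add: t_def envelope_pos G)
  have inverse_le: "1 / (2 * t) \<le> 1 / t" using t_pos by (simp add: field_simps)
  have G_nonneg: "0 \<le> G (threshold t)" using phi_nonneg[OF G] threshold_pos[OF t_pos] by simp
  have "ennreal (G (threshold t) * t * (1 / t - 1 / (2 * t)))
      = (\<integral>\<^sup>+ y. ennreal (G (threshold t) * t) * indicator {1 / (2 * t)<..1 / t} y \<partial>half_line)"
    using inverse_le t_pos G_nonneg by (intro nn_integral_half_line_Ioc[symmetric]) auto
  also have "\<dots> \<le> (\<integral>\<^sup>+ y. window x y \<partial>half_line)"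
  proof (rule nn_integral_mono)
    fix y :: real assume "y \<in> space half_line"
    then have y_pos: "0 < y" by (simp add: space_restrict_space)
    show "ennreal (G (threshold t) * t) * indicator {1 / (2 * t)<..1 / t} y \<le> window x y"
    proof (cases "y \<in> {1 / (2 * t)<..1 / t}")
      case True
      then have ty: "t \<le> 1 / y" "1 \<le> 2 * t * y" "t * y \<le> 1"
        using y_pos t_pos by (auto simp: field_simps)
      have "G (threshold t) \<le> G (threshold (1 / y))"
        using ty t_pos y_pos by (simp add: phi_le_iff G threshold phi_nonneg)
      then have "G (threshold t) * t \<le> G (threshold (1 / y)) * (1 / y)"
        using ty t_pos y_pos by (intro mult_mono) (auto simp: phi_nonneg G threshold)
      then show ?thesis using True t_pos ty y_pos by (simp add: window_def t_def ennreal_leI)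
    qed simp
  qed
  finally have half: "ennreal (G (threshold t) / 2) \<le> (\<integral>\<^sup>+ y. window x y \<partial>half_line)"
    using t_pos by (simp add: field_simps)
  have "ennreal (G (threshold t)) = 2 * ennreal (G (threshold t) / 2)"
    using G_nonneg ennreal_mult[of 2 "G (threshold t) / 2"] by simp
  also have "\<dots> \<le> 2 * (\<integral>\<^sup>+ y. window x y \<partial>half_line)" by (intro mult_left_mono half) simp
  finally show ?thesis by (simp add: t_def)
qed

lemma nn_integral_window_le:
  assumes y_pos: "0 < y"
  shows "(\<integral>\<^sup>+ x. window x y \<partial>half_line) \<le> ennreal (2 * \<kappa>\<^sup>2 * \<delta>) * ennreal (threshold (1 / y))"
proof -
  define s where "s = G (1 / (2 * y))"
  have s_pos: "0 < s" using y_pos by (simp add: s_def phi_pos G)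
  have nonneg: "0 \<le> G (threshold (1 / y)) / y" using y_pos by (simp add: phi_nonneg G threshold)
  have "(\<integral>\<^sup>+ x. window x y \<partial>half_line)
      \<le> (\<integral>\<^sup>+ x. ennreal (G (threshold (1 / y)) / y) * indicator {0<..1 / s} x \<partial>half_line)"
  proof (rule nn_integral_mono)
    fix x :: real assume "x \<in> space half_line"
    then have x_pos: "0 < x" by (simp add: space_restrict_space)
    show "window x y \<le> ennreal (G (threshold (1 / y)) / y) * indicator {0<..1 / s} x"
    proof (cases "1 \<le> 2 * envelope G x * y")
      case True
      then have "1 / (2 * y) \<le> envelope G x" using y_pos by (simp add: field_simps)
      then have "s \<le> G (envelope G x)"
        using y_pos envelope_pos[OF G x_pos] by (simp add: s_def phi_le_iff G)
      then have "x \<in> {0<..1 / s}" using x_pos s_pos by (simp add: phi_envelope G field_simps)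
      then show ?thesis by (simp add: window_def)
    qed (simp add: window_def)
  qed
  also have "\<dots> = ennreal (G (threshold (1 / y)) / y * (1 / s - 0))"
    using s_pos nonneg by (intro nn_integral_half_line_Ioc) auto
  also have "\<dots> \<le> ennreal (2 * \<kappa>\<^sup>2 * \<delta> * threshold (1 / y))"
  proof (rule ennreal_leI)
    have "G (threshold (1 / y)) \<le> 2 * \<kappa>\<^sup>2 * \<delta> * (threshold (1 / y) / (1 / y)) * s"
      using G_threshold_le[of "1 / y"] y_pos by (simp add: s_def field_simps)
    then show "G (threshold (1 / y)) / y * (1 / s - 0) \<le> 2 * \<kappa>\<^sup>2 * \<delta> * threshold (1 / y)"
      using y_pos s_pos by (simp add: field_simps)
  qed
  also have "\<dots> = ennreal (2 * \<kappa>\<^sup>2 * \<delta>) * ennreal (threshold (1 / y))"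
    using delta(1) threshold_pos[of "1 / y"] y_pos by (intro ennreal_mult) auto
  finally show ?thesis .
qed

lemma modular_threshold_envelope_le: "modular G (\<lambda>x. threshold (envelope G x)) \<le> ennreal (4 * \<kappa>\<^sup>2 * \<delta>)"
proof -
  interpret half_line: sigma_finite_measure half_line
    by (intro sigma_finite_measure_restrict_space sigma_finite_lborel) auto
  interpret pair: pair_sigma_finite half_line half_line ..
  have "(\<integral>\<^sup>+ x. (\<integral>\<^sup>+ y. window x y \<partial>half_line) \<partial>half_line) = (\<integral>\<^sup>+ y. (\<integral>\<^sup>+ x. window x y \<partial>half_line) \<partial>half_line)"
    by (rule pair.Fubini'[OF window_measurable, symmetric])
  also have "\<dots> \<le> (\<integral>\<^sup>+ y. ennreal (2 * \<kappa>\<^sup>2 * \<delta>) * ennreal (threshold (1 / y)) \<partial>half_line)"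
    by (intro nn_integral_mono nn_integral_window_le) (simp add: space_restrict_space)
  also have "\<dots> = ennreal (2 * \<kappa>\<^sup>2 * \<delta>) * (\<integral>\<^sup>+ y. ennreal (threshold (1 / y)) \<partial>half_line)"
    using decreasing_fun_measurable[OF decreasing_fun_threshold] by (intro nn_integral_cmult) simp
  also have "\<dots> \<le> ennreal (2 * \<kappa>\<^sup>2 * \<delta>) * 1" by (intro mult_left_mono nn_integral_threshold_le) auto
  finally have double: "(\<integral>\<^sup>+ x. (\<integral>\<^sup>+ y. window x y \<partial>half_line) \<partial>half_line) \<le> ennreal (2 * \<kappa>\<^sup>2 * \<delta>)"
    by simp
  have "modular G (\<lambda>x. threshold (envelope G x)) \<le> (\<integral>\<^sup>+ x. 2 * (\<integral>\<^sup>+ y. window x y \<partial>half_line) \<partial>half_line)"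
    unfolding modular_def
    by (intro nn_integral_mono le_nn_integral_window) (simp add: space_restrict_space)
  also have "\<dots> = 2 * (\<integral>\<^sup>+ x. (\<integral>\<^sup>+ y. window x y \<partial>half_line) \<partial>half_line)"
    using half_line.borel_measurable_nn_integral[OF window_measurable] by (intro nn_integral_cmult) simp
  also have "\<dots> \<le> 2 * ennreal (2 * \<kappa>\<^sup>2 * \<delta>)" by (intro mult_left_mono double) simp
  also have "\<dots> = ennreal (4 * \<kappa>\<^sup>2 * \<delta>)"
    using delta(1) ennreal_mult[of 2 "2 * \<kappa>\<^sup>2 * \<delta>"] by (simp add: mult.assoc)
  finally show ?thesis .
qed

definition weight :: "real \<Rightarrow> real" where
  "weight x = \<kappa> * \<rho> (envelope G x)"

lemma weight_pos: "0 < x \<Longrightarrow> 0 < weight x"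
  using kappa(1) by (simp add: weight_def rho_pos envelope_pos G)

lemma weight_measurable: "weight \<in> borel_measurable half_line"
proof -
  have "decreasing_fun weight"
    unfolding weight_def[abs_def] using kappa(1)
    by (intro decreasing_fun_mult decreasing_fun_phi[OF rho] decreasing_fun_envelope G) simp
  then show ?thesis by (rule decreasing_fun_measurable)
qed

lemma K_div_weight_le_G:
  assumes x_pos: "0 < x" and y: "0 \<le> y" "y \<le> envelope G x"
  shows "K (y / weight x) \<le> G y"
proof (cases "y = 0")
  case False
  then have "0 < y" using y by simp
  have "\<rho> y \<le> \<rho> (envelope G x)" using y by (simp add: phi_le_iff rho)
  then have "y / weight x \<le> y / \<rho> y / \<kappa>"
    using \<open>0 < y\<close> kappa(1) rho_pos[OF \<open>0 < y\<close>] by (simp add: weight_def frac_le)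
  then have "K (y / weight x) \<le> K (y / \<rho> y / \<kappa>)"
    using y weight_pos[OF x_pos] by (intro K_mono) auto
  also have "\<dots> \<le> G y" by (rule K_le_G[OF \<open>0 < y\<close>])
  finally show ?thesis .
qed (simp add: K_zero phi_zero G)

lemma lux_K_le_lux_G:
  assumes f: "decreasing_fun f"
  shows "lux K (\<lambda>x. f x / weight x) \<le> lux G f"
proof (cases "lux G f")
  case (real c)
  have "modular K (\<lambda>x. \<bar>f x / weight x\<bar> / e) \<le> 1" if e: "c < e" for e
  proof -
    define g where "g x = 1 / e * f x" for x
    have g: "decreasing_fun g" unfolding g_def[abs_def]
      using e real by (intro decreasing_fun_mult f) simp
    have "modular G g = modular G (\<lambda>x. \<bar>f x\<bar> / e)"
      by (rule modular_cong) (simp add: g_def decreasing_fun_nonneg[OF f])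
    also have "\<dots> \<le> 1" using lux_le_iff[OF G, of c f] real e by simp
    finally have G_le: "modular G g \<le> 1" .
    have "modular K (\<lambda>x. \<bar>f x / weight x\<bar> / e) \<le> modular G g"
      unfolding modular_def
    proof (rule nn_integral_mono)
      fix x assume "x \<in> space half_line"
      then have x_pos: "0 < x" by (simp add: space_restrict_space)
      have "K (g x / weight x) \<le> G (g x)"
        using x_pos by (intro K_div_weight_le_G decreasing_fun_nonneg[OF g] decreasing_le_envelope_of_modular[OF G g G_le])
      moreover have "\<bar>f x / weight x\<bar> / e = g x / weight x"
        using weight_pos[OF x_pos] decreasing_fun_nonneg[OF f x_pos] by (simp add: g_def)
      ultimately show "ennreal (K (\<bar>f x / weight x\<bar> / e)) \<le> ennreal (G (g x))"
        by (simp add: ennreal_leI)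
    qed
    then show ?thesis using G_le by simp
  qed
  then show ?thesis using lux_le_iff[OF K, of c] real by simp
qed simp

lemma G_le_K_div_weight_plus_threshold:
  assumes x_pos: "0 < x" and y_nonneg: "0 \<le> y"
  shows "G (y / (\<kappa>\<^sup>2 * \<delta>)) \<le> K (y / weight x) + G (threshold (envelope G x))"
proof -
  define z t where "z = y / (\<kappa>\<^sup>2 * \<delta>)" and "t = envelope G x"
  have t_pos: "0 < t" using x_pos by (simp add: t_def envelope_pos G)
  have K_nonneg: "0 \<le> K (y / weight x)" using y_nonneg weight_pos[OF x_pos] by (simp add: phi_nonneg K)
  have G_nonneg: "0 \<le> G (threshold t)" using t_pos by (simp add: phi_nonneg G threshold)
  have z_nonneg: "0 \<le> z" using y_nonneg kappa(1) delta(1) by (simp add: z_def)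
  show ?thesis
  proof (cases "\<rho> t / \<delta> \<le> \<rho> z")
    case True
    moreover have "0 < \<rho> t / \<delta>" using rho_pos[OF t_pos] delta(1) by simp
    ultimately have rz: "0 < \<rho> z" by linarith
    then have z_pos: "0 < z" using z_nonneg phi_zero[OF rho] by (cases "z = 0") auto
    have "G z \<le> K (\<kappa> * (z / \<rho> z))" by (rule G_le_K[OF z_pos])
    also have "\<dots> \<le> K (y / weight x)"
    proof (rule K_mono)
      show "0 \<le> \<kappa> * (z / \<rho> z)" using z_pos kappa(1) rz by simp
      have "z / \<rho> z \<le> z / (\<rho> t / \<delta>)"
        using True z_pos rho_pos[OF t_pos] delta(1) rz by (intro divide_left_mono mult_pos_pos) auto
      then have "\<kappa> * (z / \<rho> z) \<le> \<kappa> * (z / (\<rho> t / \<delta>))" using kappa(1) by (intro mult_left_mono) auto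
      also have "\<dots> = y / weight x" using kappa(1) delta(1)
        by (simp add: z_def weight_def t_def field_simps power2_eq_square)
      finally show "\<kappa> * (z / \<rho> z) \<le> y / weight x" .
    qed
    finally show ?thesis using G_nonneg by (simp add: z_def t_def)
  next
    case False
    then have "\<rho> z \<le> \<rho> (threshold t)" using t_pos by (simp add: rho_threshold)
    then have "z \<le> threshold t" using z_nonneg threshold_pos[OF t_pos] by (simp add: phi_le_iff rho)
    then have "G z \<le> G (threshold t)" using z_nonneg threshold_pos[OF t_pos] by (simp add: phi_le_iff G)
    then show ?thesis using K_nonneg by (simp add: z_def t_def)
  qed
qed

lemma G_dilated_le_average:
  assumes L_ge_1: "1 \<le> L"
  obtains C where "1 \<le> C" "\<And>x y. 0 < x \<Longrightarrow> 0 \<le> y \<Longrightarrow>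
    G (y / C) \<le> 1 / L * (K (y / weight x) + G (threshold (envelope G x)))"
proof -
  obtain C1 where C1_ge_1: "1 \<le> C1" and growth: "\<And>t. 0 \<le> t \<Longrightarrow> L * G t \<le> G (C1 * t)"
    using G_growth[OF L_ge_1] by blast
  define C2 where "C2 = \<kappa>\<^sup>2 * \<delta>"
  have C2_ge_1: "1 \<le> C2" using mult_mono[of 1 "\<kappa>\<^sup>2" 1 \<delta>] kappa delta by (simp add: C2_def)
  have "G (y / (C1 * C2)) \<le> 1 / L * (K (y / weight x) + G (threshold (envelope G x)))"
    if x_pos: "0 < x" and y_nonneg: "0 \<le> y" for x y
  proof -
    have "L * G (y / (C1 * C2)) \<le> G (C1 * (y / (C1 * C2)))"
      using C1_ge_1 C2_ge_1 y_nonneg by (intro growth) simp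
    also have "C1 * (y / (C1 * C2)) = y / C2" using C1_ge_1 by simp
    also have "G (y / C2) \<le> K (y / weight x) + G (threshold (envelope G x))"
      unfolding C2_def by (rule G_le_K_div_weight_plus_threshold[OF x_pos y_nonneg])
    finally show ?thesis using L_ge_1 by (simp add: field_simps)
  qed
  moreover have "1 \<le> C1 * C2" using mult_mono[OF C1_ge_1 C2_ge_1] C1_ge_1 C2_ge_1 by simp
  ultimately show thesis using that by blast
qed

lemma modular_G_le_1_of_modular_K:
  obtains C where "1 \<le> C" "\<And>f e. decreasing_fun f \<Longrightarrow> 0 < e \<Longrightarrow>
    modular K (\<lambda>x. \<bar>f x / weight x\<bar> / e) \<le> 1 \<Longrightarrow> modular G (\<lambda>x. \<bar>f x\<bar> / (C * e)) \<le> 1"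
proof -
  define L where "L = 1 + 4 * \<kappa>\<^sup>2 * \<delta>"
  have L_ge_1: "1 \<le> L" using delta(1) by (simp add: L_def)
  obtain C where C_ge_1: "1 \<le> C" and G_le: "\<And>x y. 0 < x \<Longrightarrow> 0 \<le> y \<Longrightarrow>
      G (y / C) \<le> 1 / L * (K (y / weight x) + G (threshold (envelope G x)))"
    using G_dilated_le_average[OF L_ge_1] by blast
  have "modular G (\<lambda>x. \<bar>f x\<bar> / (C * e)) \<le> 1"
    if f: "decreasing_fun f" and e_pos: "0 < e" and K_le: "modular K (\<lambda>x. \<bar>f x / weight x\<bar> / e) \<le> 1" for f e
  proof -
    note [measurable] = decreasing_fun_measurable[OF f] weight_measurable
    define k m where "k x = K (\<bar>f x / weight x\<bar> / e)" and "m x = G (threshold (envelope G x))" for x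
    have [measurable]: "k \<in> borel_measurable half_line"
      unfolding k_def[abs_def] using e_pos by (intro phi_measurable_compose[OF K]) auto
    have [measurable]: "m \<in> borel_measurable half_line"
      unfolding m_def[abs_def] by (intro decreasing_fun_measurable decreasing_fun_phi[OF G]
          decreasing_fun_phi[OF threshold] decreasing_fun_envelope G)
    have "modular G (\<lambda>x. \<bar>f x\<bar> / (C * e)) \<le> (\<integral>\<^sup>+ x. ennreal (1 / L) * (ennreal (k x) + ennreal (m x)) \<partial>half_line)"
      unfolding modular_def
    proof (rule nn_integral_mono)
      fix x assume "x \<in> space half_line"
      then have x_pos: "0 < x" by (simp add: space_restrict_space)
      have "G (\<bar>f x\<bar> / (C * e)) \<le> 1 / L * (k x + m x)"
        using G_le[OF x_pos, of "\<bar>f x\<bar> / e"] e_pos weight_pos[OF x_pos]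
          by (simp add: k_def m_def mult_ac)
      moreover have "0 \<le> k x" "0 \<le> m x"
        using e_pos x_pos by (auto simp: k_def m_def phi_nonneg K G threshold envelope_pos less_imp_le)
      ultimately show "ennreal (G (\<bar>f x\<bar> / (C * e))) \<le> ennreal (1 / L) * (ennreal (k x) + ennreal (m x))"
        using L_ge_1 by (simp add: ennreal_mult[symmetric] ennreal_plus[symmetric] ennreal_leI del: ennreal_plus)
    qed
    also have "\<dots> = ennreal (1 / L) * (modular K (\<lambda>x. \<bar>f x / weight x\<bar> / e) + modular G (\<lambda>x. threshold (envelope G x)))"
      by (simp add: nn_integral_cmult nn_integral_add) (simp add: modular_def k_def m_def)
    also have "\<dots> \<le> ennreal (1 / L) * (1 + ennreal (4 * \<kappa>\<^sup>2 * \<delta>))"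
      by (intro mult_left_mono add_mono K_le modular_threshold_envelope_le) auto
    also have "1 + ennreal (4 * \<kappa>\<^sup>2 * \<delta>) = ennreal L"
      using delta(1) by (simp add: L_def ennreal_plus)
    also have "ennreal (1 / L) * ennreal L = 1"
      using L_ge_1 by (simp add: ennreal_mult[symmetric])
    finally show ?thesis .
  qed
  with C_ge_1 show thesis by (rule that)
qed

lemma lux_G_le_lux_K:
  obtains C where "1 \<le> C"
    "\<And>f. decreasing_fun f \<Longrightarrow> lux G f \<le> ennreal C * lux K (\<lambda>x. f x / weight x)"
proof -
  obtain C where C_ge_1: "1 \<le> C" and modular: "\<And>f e. decreasing_fun f \<Longrightarrow> 0 < e \<Longrightarrow>
      modular K (\<lambda>x. \<bar>f x / weight x\<bar> / e) \<le> 1 \<Longrightarrow> modular G (\<lambda>x. \<bar>f x\<bar> / (C * e)) \<le> 1"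
    using modular_G_le_1_of_modular_K by blast
  have "lux G f \<le> ennreal C * lux K (\<lambda>x. f x / weight x)" if f: "decreasing_fun f" for f
  proof (cases "lux K (\<lambda>x. f x / weight x)")
    case (real c)
    have "modular G (\<lambda>x. \<bar>f x\<bar> / e) \<le> 1" if e: "C * c < e" for e
    proof -
      have "c < e / C" using e C_ge_1 by (simp add: pos_less_divide_eq mult.commute)
      then show ?thesis
        using modular[OF f, of "e / C"] lux_le_iff[OF K, of c "\<lambda>x. f x / weight x"] real C_ge_1
          by fastforce
    qed
    then have "lux G f \<le> ennreal (C * c)" using lux_le_iff[OF G, of "C * c"] real C_ge_1 by simp
    then show ?thesis using real C_ge_1 by (simp add: ennreal_mult)
  qed (use C_ge_1 in \<open>simp add: ennreal_mult_top\<close>)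
  with C_ge_1 show thesis by (rule that)
qed

theorem ex_decreasing_sum_bound: "\<exists>C. decreasing_sum_bound G C"
proof -
  obtain C where C_ge_1: "1 \<le> C"
    and lux_le: "\<And>f. decreasing_fun f \<Longrightarrow> lux G f \<le> ennreal C * lux K (\<lambda>x. f x / weight x)"
    using lux_G_le_lux_K by blast
  have "lux G (\<lambda>x. \<Sum>i<n. f i x) \<le> ennreal C * (\<Sum>i<n. lux G (f i))"
    if f: "\<forall>i<n. decreasing_fun (f i)" for n and f :: "nat \<Rightarrow> real \<Rightarrow> real"
  proof -
    have "lux G (\<lambda>x. \<Sum>i<n. f i x) \<le> ennreal C * lux K (\<lambda>x. (\<Sum>i<n. f i x) / weight x)"
      using f by (intro lux_le decreasing_fun_sum) simp
    also have "lux K (\<lambda>x. (\<Sum>i<n. f i x) / weight x) = lux K (\<lambda>x. \<Sum>i<n. f i x / weight x)"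
      by (simp add: sum_divide_distrib)
    also have "\<dots> \<le> (\<Sum>i<n. lux K (\<lambda>x. f i x / weight x))"
      using f weight_pos decreasing_fun_measurable weight_measurable
      by (intro lux_sum_le K K_convex borel_measurable_divide)
        (auto intro!: divide_nonneg_pos decreasing_fun_nonneg[of "f _"])
    also have "\<dots> \<le> (\<Sum>i<n. lux G (f i))" using f by (intro sum_mono lux_K_le_lux_G) simp
    finally show ?thesis by (simp add: mult_left_mono)
  qed
  then show ?thesis unfolding decreasing_sum_bound_def using C_ge_1 by (intro exI[of _ C]) auto
qed

end

lemma ex_decreasing_sum_bound_of_condJ:
  assumes G: "phi_function G" and H: "phi_function H" and "condJ H"
    and K: "convex_on {0..} K" "phi_equiv (\<lambda>u. G (H u)) K"
  shows "\<exists>C. decreasing_sum_bound G C"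
proof -
  obtain Hs where Hs: "complementary H Hs" "lux Hs (\<lambda>x. 1 / phi_inv (tilde Hs) x) < \<infinity>"
    using \<open>condJ H\<close> by (auto simp: condJ_def)
  then have phi_Hs: "phi_function Hs" by (simp add: complementary_def)
  obtain a where a: "0 < a" "\<And>t. 0 \<le> t \<Longrightarrow> t / a \<le> phi_inv H t * phi_inv Hs t"
      "\<And>t. 0 \<le> t \<Longrightarrow> phi_inv H t * phi_inv Hs t \<le> a * t"
    using Hs(1) by (auto simp: complementary_def)
  obtain b where b: "0 < b" "\<And>u. 0 \<le> u \<Longrightarrow> G (H (u / b)) \<le> K u" "\<And>u. 0 \<le> u \<Longrightarrow> K u \<le> G (H (b * u))"
    using K(2) by (auto simp: phi_equiv_def)
  obtain r where r: "0 \<le> r" "lux Hs (\<lambda>x. 1 / phi_inv (tilde Hs) x) = ennreal r"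
    using Hs(2) by (cases "lux Hs (\<lambda>x. 1 / phi_inv (tilde Hs) x)") auto
  have "modular Hs (\<lambda>x. phi_inv Hs (1 / x) / (r + 1)) = modular Hs (\<lambda>x. \<bar>1 / phi_inv (tilde Hs) x\<bar> / (r + 1))"
    by (rule modular_cong) (simp add: phi_inv_tilde phi_Hs envelope_def phi_inv_nonneg)
  also have "\<dots> \<le> 1"
    using r by (intro modular_le_1_of_lux_less[OF phi_Hs]) (simp add: ennreal_less_iff)
  finally have "condJ_factorization G H Hs K a b (r + 1)"
    using G H phi_Hs K(1) a b r(1) by unfold_locales auto
  then show ?thesis by (rule condJ_factorization.ex_decreasing_sum_bound)
qed

section \<open>Sufficiency\<close>

definition dyadic_average :: "(real \<Rightarrow> real) \<Rightarrow> real \<Rightarrow> real" where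
  "dyadic_average f x = (\<Sum>k. rearr f (x / 2 ^ k) / 2 ^ k)"

lemma AE_ex_abs_le_rearr:
  assumes f[measurable]: "f \<in> borel_measurable borel" and fin: "rearr_finite f" and x_pos: "0 < x"
  shows "AE y in lborel. 0 \<le> y \<longrightarrow> (\<exists>k::nat. \<bar>f y\<bar> \<le> rearr f (x / 2 ^ k))"
proof (rule AE_I')
  let ?Z = "\<Inter>k::nat. {y \<in> {0..}. rearr f (x / 2 ^ k) < \<bar>f y\<bar>}"
  have "emeasure lborel ?Z \<le> ennreal (x / 2 ^ k)" for k :: nat
  proof -
    have "emeasure lborel ?Z \<le> emeasure lborel {y \<in> {0..}. rearr f (x / 2 ^ k) < \<bar>f y\<bar>}"
      by (rule emeasure_mono) auto
    also have "\<dots> \<le> ennreal (x / 2 ^ k)" using x_pos by (intro emeasure_greater_rearr_le f fin) simp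
    finally show ?thesis .
  qed
  moreover have "(\<lambda>k. ennreal (x / 2 ^ k)) \<longlonglongrightarrow> ennreal 0"
    by (intro tendsto_ennrealI LIMSEQ_divide_realpow_zero) auto
  ultimately have "emeasure lborel ?Z \<le> ennreal 0"
    by (intro LIMSEQ_le_const[of "\<lambda>k. ennreal (x / 2 ^ k)"]) auto
  moreover have "?Z \<in> sets lborel" by measurable
  ultimately show "?Z \<in> null_sets lborel" by (auto simp: null_sets_def)
  show "{y \<in> space lborel. \<not> (0 \<le> y \<longrightarrow> (\<exists>k::nat. \<bar>f y\<bar> \<le> rearr f (x / 2 ^ k)))} \<subseteq> ?Z"
    by (auto simp: not_le)
qed

lemma ennreal_le_layers:
  fixes r :: "nat \<Rightarrow> real"
  assumes "\<exists>k. a \<le> r k"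
  shows "ennreal a \<le> ennreal (r 0) + (\<Sum>k. ennreal (r (Suc k)) * indicator {r k<..} a)"
proof -
  define k where "k = (LEAST k. a \<le> r k)"
  have k: "a \<le> r k" unfolding k_def using assms by (rule LeastI_ex)
  show ?thesis
  proof (cases k)
    case 0
    then show ?thesis using k by (simp add: add_increasing2 ennreal_leI)
  next
    case (Suc j)
    then have "r j < a" using not_less_Least[of j "\<lambda>k. a \<le> r k"] by (simp add: k_def not_le)
    then have "ennreal a \<le> (\<Sum>k\<in>{j}. ennreal (r (Suc k)) * indicator {r k<..} a)"
      using k Suc by (simp add: ennreal_leI)
    also have "\<dots> \<le> (\<Sum>k. ennreal (r (Suc k)) * indicator {r k<..} a)"
      by (rule sum_le_suminf) auto
    finally show ?thesis by (simp add: add_increasing)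
  qed
qed

lemma nn_integral_le_rearr_layers:
  assumes f[measurable]: "f \<in> borel_measurable borel" and fin: "rearr_finite f" and x_pos: "0 < x"
    and E[measurable]: "E \<in> sets borel" "E \<subseteq> {0..}"
  shows "(\<integral>\<^sup>+ y\<in>E. ennreal \<bar>f y\<bar> \<partial>lborel)
    \<le> ennreal (rearr f x) * emeasure lborel E
      + (\<Sum>k. ennreal (rearr f (x / 2 ^ Suc k)) * ennreal (x / 2 ^ k))"
proof -
  define r where "r k = rearr f (x / 2 ^ k)" for k :: nat
  define A where "A k = {y \<in> {0..}. r k < \<bar>f y\<bar>}" for k
  have A[measurable]: "A k \<in> sets borel" for k unfolding A_def by measurable
  have "(\<integral>\<^sup>+ y\<in>E. ennreal \<bar>f y\<bar> \<partial>lborel)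
      \<le> (\<integral>\<^sup>+ y. ennreal (r 0) * indicator E y + (\<Sum>k. ennreal (r (Suc k)) * indicator (A k) y) \<partial>lborel)"
  proof (rule nn_integral_mono_AE, use AE_ex_abs_le_rearr[OF f fin x_pos] in eventually_elim)
    case (elim y)
    show "ennreal \<bar>f y\<bar> * indicator E y
        \<le> ennreal (r 0) * indicator E y + (\<Sum>k. ennreal (r (Suc k)) * indicator (A k) y)"
    proof (cases "y \<in> E")
      case True
      then have "indicator {r k<..} \<bar>f y\<bar> = (indicator (A k) y :: ennreal)" for k
        using E(2) by (auto simp: A_def indicator_def)
      then show ?thesis using ennreal_le_layers[of "\<bar>f y\<bar>" r] elim True E(2) by (auto simp: r_def)
    qed simp
  qed
  also have "\<dots> = ennreal (r 0) * emeasure lborel E + (\<Sum>k. ennreal (r (Suc k)) * emeasure lborel (A k))"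
    by (simp add: nn_integral_add nn_integral_suminf nn_integral_cmult)
  also have "\<dots> \<le> ennreal (r 0) * emeasure lborel E + (\<Sum>k. ennreal (r (Suc k)) * ennreal (x / 2 ^ k))"
    using x_pos emeasure_greater_rearr_le[OF f fin]
    by (intro add_left_mono suminf_le mult_left_mono) (auto simp: A_def r_def)
  finally show ?thesis by (simp add: r_def)
qed

lemma nn_integral_le_dyadic_average:
  assumes f: "f \<in> borel_measurable borel" and fin: "rearr_finite f"
    and summable: "summable (\<lambda>k. rearr f (x / 2 ^ k) / 2 ^ k)"
    and E: "E \<in> sets borel" "E \<subseteq> {0..}"
    and \<mu>: "emeasure lborel E = ennreal \<mu>" "x \<le> \<mu>" and x_pos: "0 < x"
  shows "(\<integral>\<^sup>+ y\<in>E. ennreal \<bar>f y\<bar> \<partial>lborel) \<le> ennreal (2 * dyadic_average f x * \<mu>)"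
proof -
  define r where "r k = rearr f (x / 2 ^ k)" for k :: nat
  have r: "0 \<le> r k" for k using x_pos by (simp add: r_def rearr_nonneg fin)
  define R where "R = (\<Sum>k. r (Suc k) / 2 ^ Suc k)"
  have sum_Suc: "summable (\<lambda>k. r (Suc k) / 2 ^ Suc k)"
    using summable by (subst summable_Suc_iff) (simp add: r_def)
  have R_nonneg: "0 \<le> R" unfolding R_def using sum_Suc r by (intro suminf_nonneg) auto
  have average: "dyadic_average f x = R + r 0"
    using suminf_split_head[OF summable] by (simp add: dyadic_average_def R_def r_def)
  have tail: "(\<lambda>k. r (Suc k) * (x / 2 ^ k)) sums (2 * x * R)"
    using sums_mult[OF summable_sums[OF sum_Suc], of "2 * x"] by (simp add: R_def field_simps)
  have "ennreal (r (Suc k)) * ennreal (x / 2 ^ k) = ennreal (r (Suc k) * (x / 2 ^ k))" for k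
    using r x_pos by (intro ennreal_mult[symmetric]) auto
  moreover have "(\<Sum>k. ennreal (r (Suc k) * (x / 2 ^ k))) = ennreal (2 * x * R)"
    using r x_pos by (intro suminf_ennreal_eq tail mult_nonneg_nonneg) auto
  ultimately have tail_ennreal: "(\<Sum>k. ennreal (r (Suc k)) * ennreal (x / 2 ^ k)) = ennreal (2 * x * R)"
    by (simp only:)
  have "(\<integral>\<^sup>+ y\<in>E. ennreal \<bar>f y\<bar> \<partial>lborel)
      \<le> ennreal (r 0) * ennreal \<mu> + (\<Sum>k. ennreal (r (Suc k)) * ennreal (x / 2 ^ k))"
    using nn_integral_le_rearr_layers[OF f fin x_pos E] by (simp only: \<mu>(1) r_def power_0 div_by_1)
  also have "\<dots> = ennreal (r 0 * \<mu> + 2 * x * R)"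
    unfolding tail_ennreal using r R_nonneg \<mu>(2) x_pos by (simp add: ennreal_mult)
  also have "\<dots> \<le> ennreal (2 * dyadic_average f x * \<mu>)"
  proof (rule ennreal_leI)
    have "2 * x * R \<le> 2 * \<mu> * R" "0 \<le> r 0 * \<mu>"
      using \<mu>(2) R_nonneg r x_pos by (auto intro!: mult_right_mono)
    then show "r 0 * \<mu> + 2 * x * R \<le> 2 * dyadic_average f x * \<mu>"
      unfolding average by (simp add: algebra_simps)
  qed
  finally show ?thesis .
qed

lemma dyadic_average_nonneg:
  assumes "rearr_finite f" "summable (\<lambda>k. rearr f (x / 2 ^ k) / 2 ^ k)" "0 < x"
  shows "0 \<le> dyadic_average f x"
  unfolding dyadic_average_def using assms by (intro suminf_nonneg divide_nonneg_pos rearr_nonneg) auto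

lemma level_set_sum_le:
  fixes f :: "nat \<Rightarrow> real \<Rightarrow> real"
  assumes f: "\<And>i. i < n \<Longrightarrow> f i \<in> borel_measurable borel" "\<And>i. i < n \<Longrightarrow> rearr_finite (f i)"
    and summable: "\<And>i. i < n \<Longrightarrow> summable (\<lambda>k. rearr (f i) (x / 2 ^ k) / 2 ^ k)"
    and x_pos: "0 < x" and t: "t \<in> level_set (\<lambda>y. \<Sum>i<n. \<bar>f i y\<bar>) x" "0 < t"
  shows "t \<le> 2 * (\<Sum>i<n. dyadic_average (f i) x)"
proof -
  let ?S = "superlevel (\<lambda>y. \<Sum>i<n. \<bar>f i y\<bar>) t"
  have abs_f: "(\<lambda>y. \<bar>f i y\<bar>) \<in> borel_measurable borel" if "i < n" for i
    using f(1)[OF that] by measurable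
  have S: "?S \<in> sets borel" "ennreal x \<le> emeasure lborel ?S"
    using abs_f t by (auto intro!: superlevel_sets borel_measurable_sum simp: mem_level_set_iff)
  obtain E \<mu> where E: "E \<in> sets borel" "E \<subseteq> ?S" "emeasure lborel E = ennreal \<mu>" "x \<le> \<mu>"
  proof (cases "emeasure lborel ?S")
    case (real m)
    then show ?thesis using that[of ?S m] S x_pos by (simp add: ennreal_le_iff)
  next
    case top
    then obtain E where E: "E \<in> sets borel" "E \<subseteq> ?S" "emeasure lborel E < \<infinity>" "ennreal x < emeasure lborel E"
      using lborel.approx_PInf_emeasure_with_finite[of ?S x] S(1) by (auto simp: infinity_ennreal_def)
    then obtain m where "emeasure lborel E = ennreal m" "0 \<le> m" by (cases "emeasure lborel E") auto
    then show ?thesis using that[of E m] E x_pos by (auto simp: ennreal_less_iff)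
  qed
  have \<mu>: "0 < \<mu>" using E x_pos by simp
  have average_nonneg: "0 \<le> dyadic_average (f i) x" if "i < n" for i
    using that f(2) summable x_pos by (intro dyadic_average_nonneg) auto
  have "ennreal (t * \<mu>) = (\<integral>\<^sup>+ y\<in>E. ennreal t \<partial>lborel)"
    using E t \<mu> by (simp add: nn_integral_cmult_indicator ennreal_mult)
  also have "\<dots> \<le> (\<integral>\<^sup>+ y. (\<Sum>i<n. ennreal \<bar>f i y\<bar> * indicator E y) \<partial>lborel)"
    using E(2) by (intro nn_integral_mono)
      (auto simp: indicator_def superlevel_def sum_ennreal sum_nonneg intro!: ennreal_leI)
  also have "\<dots> = (\<Sum>i<n. \<integral>\<^sup>+ y\<in>E. ennreal \<bar>f i y\<bar> \<partial>lborel)"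
    using abs_f E(1) by (intro nn_integral_sum) simp
  also have "\<dots> \<le> (\<Sum>i<n. ennreal (2 * dyadic_average (f i) x * \<mu>))"
    using E x_pos f summable
      by (intro sum_mono nn_integral_le_dyadic_average) (auto simp: superlevel_def)
  also have "\<dots> = ennreal (2 * (\<Sum>i<n. dyadic_average (f i) x) * \<mu>)"
    using average_nonneg \<mu> by (subst sum_ennreal) (auto simp: sum_distrib_left sum_distrib_right)
  finally have "t * \<mu> \<le> 2 * (\<Sum>i<n. dyadic_average (f i) x) * \<mu>"
    using \<mu> average_nonneg by (subst (asm) ennreal_le_iff) (auto intro!: mult_nonneg_nonneg sum_nonneg)
  then show ?thesis using \<mu> by simp
qed

lemma
  fixes f :: "nat \<Rightarrow> real \<Rightarrow> real"
  assumes f: "\<And>i. i < n \<Longrightarrow> f i \<in> borel_measurable borel" "\<And>i. i < n \<Longrightarrow> rearr_finite (f i)"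
    and summable: "\<And>i x. i < n \<Longrightarrow> 0 < x \<Longrightarrow> summable (\<lambda>k. rearr (f i) (x / 2 ^ k) / 2 ^ k)"
  shows rearr_finite_sum: "rearr_finite (\<lambda>y. \<Sum>i<n. \<bar>f i y\<bar>)"
    and rearr_sum_le: "0 < x \<Longrightarrow> rearr (\<lambda>y. \<Sum>i<n. \<bar>f i y\<bar>) x \<le> 2 * (\<Sum>i<n. dyadic_average (f i) x)"
proof -
  have nonneg: "0 \<le> 2 * (\<Sum>i<n. dyadic_average (f i) x)" if "0 < x" for x
    using that f(2) summable by (auto intro!: sum_nonneg dyadic_average_nonneg)
  have level: "t \<le> 2 * (\<Sum>i<n. dyadic_average (f i) x)"
    if "0 < x" "0 < t" "t \<in> level_set (\<lambda>y. \<Sum>i<n. \<bar>f i y\<bar>) x" for t x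
    using that f summable by (intro level_set_sum_le) auto
  show "rearr_finite (\<lambda>y. \<Sum>i<n. \<bar>f i y\<bar>)"
    unfolding rearr_finite_def using nonneg level by (meson bdd_above_level_set)
  show "0 < x \<Longrightarrow> rearr (\<lambda>y. \<Sum>i<n. \<bar>f i y\<bar>) x \<le> 2 * (\<Sum>i<n. dyadic_average (f i) x)"
    using nonneg level by (rule rearr_le)
qed

lemma
  fixes f :: "nat \<Rightarrow> real \<Rightarrow> real"
  assumes G: "phi_function G" and bound: "decreasing_sum_bound G C"
    and f: "\<And>k. decreasing_fun (f k)" and c: "\<And>k. 0 \<le> c k" "summable c"
    and lux_le: "\<And>k. lux G (f k) \<le> ennreal (c k)"
  shows summable_of_lux: "\<And>x. 0 < x \<Longrightarrow> summable (\<lambda>k. f k x)"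
    and lux_suminf_le: "lux G (\<lambda>x. \<Sum>k. f k x) \<le> ennreal (C * suminf c)"
proof -
  have C_nonneg: "0 \<le> C" using bound by (rule decreasing_sum_bound_nonneg)
  have dec: "decreasing_fun (\<lambda>x. \<Sum>k<n. f k x)" for n by (intro decreasing_fun_sum f)
  have B: "0 \<le> C * suminf c" using C_nonneg c by (intro mult_nonneg_nonneg suminf_nonneg) auto
  have lux_le: "lux G (\<lambda>x. \<Sum>k<n. f k x) \<le> ennreal (C * suminf c)" for n
  proof -
    have "lux G (\<lambda>x. \<Sum>k<n. f k x) \<le> ennreal C * (\<Sum>k<n. lux G (f k))"
      by (rule decreasing_sum_boundD[OF bound f])
    also have "\<dots> \<le> ennreal C * (\<Sum>k<n. ennreal (c k))" by (intro mult_left_mono sum_mono lux_le) simp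
    also have "\<dots> = ennreal (C * (\<Sum>k<n. c k))"
      using C_nonneg c by (simp add: sum_ennreal ennreal_mult sum_nonneg)
    also have "\<dots> \<le> ennreal (C * suminf c)"
      using C_nonneg c by (intro ennreal_leI mult_left_mono sum_le_suminf) auto
    finally show ?thesis .
  qed
  show summable: "summable (\<lambda>k. f k x)" if x_pos: "0 < x" for x
  proof (rule summableI_nonneg_bounded)
    show "(\<Sum>k<n. f k x) \<le> C * suminf c * envelope G x" for n
      by (rule decreasing_le_envelope[OF G dec B lux_le x_pos])
  qed (rule decreasing_fun_nonneg[OF f x_pos])
  show "lux G (\<lambda>x. \<Sum>k. f k x) \<le> ennreal (C * suminf c)"
    using decreasing_fun_measurable[OF dec] decreasing_fun_nonneg[OF dec] summable_LIMSEQ[OF summable] lux_le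
    by (rule lux_le_of_tendsto[OF G B])
qed

lemma lux_rearr_dilated_le:
  assumes F: "phi_function F" and G: "phi_function G" and boyd: "boyd_exponent F G q"
  obtains D where "0 \<le> D" "\<And>f a. f \<in> LFG F G \<Longrightarrow> 0 < a \<Longrightarrow> a \<le> 1 \<Longrightarrow>
    lux G (\<lambda>x. rearr f (a * reparam F G x)) \<le> ennreal (D * a powr (-1 / q)) * lorentz F G f"
proof -
  obtain c where dil_le: "\<And>a f. 0 < a \<Longrightarrow> a < 1 \<Longrightarrow> f \<in> LFG F G \<Longrightarrow>
      lorentz F G (dil a f) \<le> ennreal (c * a powr (-1 / q)) * lorentz F G f"
    using boyd unfolding boyd_exponent_def by blast
  have "lux G (\<lambda>x. rearr f (a * reparam F G x)) \<le> ennreal (max c 1 * a powr (-1 / q)) * lorentz F G f"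
    if f: "f \<in> LFG F G" and a: "0 < a" "a \<le> 1" for f a
  proof (cases "a = 1")
    case True
    have "1 * lorentz F G f \<le> ennreal (max c 1) * lorentz F G f" by (intro mult_right_mono) simp_all
    then show ?thesis using True lorentz_eq_lux[OF F G LFG_rearr_finite[OF f]] by simp
  next
    case False
    then have "lux G (\<lambda>x. rearr f (a * reparam F G x)) \<le> ennreal (c * a powr (-1 / q)) * lorentz F G f"
      using dil_le[OF a(1) _ f] lorentz_dil[OF F G f a(1)] a(2) by simp
    also have "\<dots> \<le> ennreal (max c 1 * a powr (-1 / q)) * lorentz F G f"
      by (intro mult_right_mono ennreal_leI) simp_all
    finally show ?thesis .
  qed
  then show thesis by (intro that[of "max c 1"]) auto
qed

lemma lux_rearr_dyadic_le:
  assumes F: "phi_function F" and G: "phi_function G" and boyd: "boyd_exponent F G q"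
  obtains D where "0 \<le> D" "\<And>f k. f \<in> LFG F G \<Longrightarrow>
    lux G (\<lambda>x. rearr f (reparam F G x / 2 ^ k) / 2 ^ k) \<le> ennreal (D * (2 powr (1 / q - 1)) ^ k) * lorentz F G f"
proof -
  obtain D where D_nonneg: "0 \<le> D" and dilated_le: "\<And>f a. f \<in> LFG F G \<Longrightarrow> 0 < a \<Longrightarrow> a \<le> 1 \<Longrightarrow>
      lux G (\<lambda>x. rearr f (a * reparam F G x)) \<le> ennreal (D * a powr (-1 / q)) * lorentz F G f"
    using lux_rearr_dilated_le[OF F G boyd] by blast
  have "lux G (\<lambda>x. rearr f (reparam F G x / 2 ^ k) / 2 ^ k)
      \<le> ennreal (D * (2 powr (1 / q - 1)) ^ k) * lorentz F G f" if f: "f \<in> LFG F G" for f k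
  proof -
    define a where "a = (1 / 2 :: real) ^ k"
    have a: "0 < a" "a \<le> 1" "a = 2 powr (- real k)"
      by (auto simp: a_def power_le_one powr_minus powr_realpow power_one_over inverse_eq_divide)
    have "lux G (\<lambda>x. a * rearr f (a * reparam F G x)) \<le> ennreal a * lux G (\<lambda>x. rearr f (a * reparam F G x))"
      by (rule lux_scale_le[OF G a(1)])
    also have "\<dots> \<le> ennreal a * (ennreal (D * a powr (-1 / q)) * lorentz F G f)"
      by (intro mult_left_mono dilated_le[OF f a(1,2)]) simp
    also have "\<dots> = ennreal (a * (D * a powr (-1 / q))) * lorentz F G f"
      using a(1) D_nonneg by (subst ennreal_mult) (simp_all add: mult.assoc)
    also have "a * (D * a powr (-1 / q)) = D * (a powr 1 * a powr (-1 / q))"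
      using a(1) by simp
    also have "a powr 1 * a powr (-1 / q) = (2 powr (1 / q - 1)) ^ k"
      unfolding a(3) by (simp add: powr_powr powr_add[symmetric] powr_realpow[symmetric] algebra_simps)
    finally show ?thesis by (simp add: a_def power_one_over)
  qed
  with D_nonneg show thesis by (rule that)
qed

lemma decreasing_fun_dyadic_average:
  assumes F: "phi_function F" and G: "phi_function G" and f: "rearr_finite f"
    and summable: "\<And>x. 0 < x \<Longrightarrow> summable (\<lambda>k. rearr f (x / 2 ^ k) / 2 ^ k)"
  shows "decreasing_fun (\<lambda>x. dyadic_average f (reparam F G x))"
proof (rule decreasing_funI)
  show "0 \<le> dyadic_average f (reparam F G x)" if "0 < x" for x
    using that by (intro dyadic_average_nonneg f summable reparam_pos F G)
  show "dyadic_average f (reparam F G y) \<le> dyadic_average f (reparam F G x)" if "0 < x" "x \<le> y" for x y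
    unfolding dyadic_average_def
  proof (intro suminf_le summable reparam_pos F G)
    show "rearr f (reparam F G y / 2 ^ k) / 2 ^ k \<le> rearr f (reparam F G x / 2 ^ k) / 2 ^ k" for k
      using that by (intro divide_right_mono decreasing_funD[OF decreasing_fun_rearr[OF f]])
        (simp_all add: reparam_pos reparam_le_iff F G divide_right_mono)
  qed (use that in auto)
qed

lemma lux_dyadic_average_le:
  assumes F: "phi_function F" and G: "phi_function G"
    and boyd: "boyd_exponent F G q" "1 < q" and bound: "decreasing_sum_bound G C"
  obtains B where "0 \<le> B"
    "\<And>f x. f \<in> LFG F G \<Longrightarrow> 0 < x \<Longrightarrow> summable (\<lambda>k. rearr f (x / 2 ^ k) / 2 ^ k)"
    "\<And>f. f \<in> LFG F G \<Longrightarrow> lux G (\<lambda>x. dyadic_average f (reparam F G x)) \<le> ennreal B * lorentz F G f"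
proof -
  define b where "b = 2 powr (1 / q - 1)"
  have b: "0 \<le> b" "b < 1" using boyd(2) powr_less_mono[of "1 / q - 1" 0 2] by (simp_all add: b_def)
  obtain D where D_nonneg: "0 \<le> D" and dyadic_le: "\<And>f k. f \<in> LFG F G \<Longrightarrow>
      lux G (\<lambda>x. rearr f (reparam F G x / 2 ^ k) / 2 ^ k) \<le> ennreal (D * b ^ k) * lorentz F G f"
    using lux_rearr_dyadic_le[OF F G boyd(1)] unfolding b_def by blast
  have C_nonneg: "0 \<le> C" using bound by (rule decreasing_sum_bound_nonneg)
  have series: "\<And>x. 0 < x \<Longrightarrow> summable (\<lambda>k. rearr f (reparam F G x / 2 ^ k) / 2 ^ k)"
    "lux G (\<lambda>x. dyadic_average f (reparam F G x)) \<le> ennreal (C * (D / (1 - b))) * lorentz F G f"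
    if f: "f \<in> LFG F G" for f
  proof -
    define N where "N = enn2real (lorentz F G f)"
    have N: "0 \<le> N" "lorentz F G f = ennreal N" using LFG_lorentz[OF f] by (simp_all add: N_def)
    have dec: "decreasing_fun (\<lambda>x. rearr f (reparam F G x / 2 ^ k) / 2 ^ k)" for k
      using decreasing_fun_mult[OF decreasing_fun_rearr_reparam[OF F G LFG_rearr_finite[OF f], of "1 / 2 ^ k"], of "1 / 2 ^ k"]
      by simp
    have geo: "summable (\<lambda>k. D * N * b ^ k)" "(\<Sum>k. D * N * b ^ k) = D * N * (1 / (1 - b))"
      using b by (auto intro!: summable_mult summable_geometric simp: suminf_mult suminf_geometric)
    have lux_le: "lux G (\<lambda>x. rearr f (reparam F G x / 2 ^ k) / 2 ^ k) \<le> ennreal (D * N * b ^ k)" for k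
      using dyadic_le[OF f, of k] D_nonneg N b by (simp add: ennreal_mult[symmetric] mult_ac)
    have nonneg: "0 \<le> D * N * b ^ k" for k using D_nonneg N b by simp
    show "0 < x \<Longrightarrow> summable (\<lambda>k. rearr f (reparam F G x / 2 ^ k) / 2 ^ k)" for x
      by (rule summable_of_lux[OF G bound dec nonneg geo(1) lux_le])
    have "lux G (\<lambda>x. dyadic_average f (reparam F G x)) \<le> ennreal (C * (D * N * (1 / (1 - b))))"
      using lux_suminf_le[OF G bound dec nonneg geo(1) lux_le] by (simp add: dyadic_average_def geo(2))
    then show "lux G (\<lambda>x. dyadic_average f (reparam F G x)) \<le> ennreal (C * (D / (1 - b))) * lorentz F G f"
      using C_nonneg D_nonneg N b by (simp add: ennreal_mult[symmetric] mult_ac)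
  qed
  have "summable (\<lambda>k. rearr f (x / 2 ^ k) / 2 ^ k)" if "f \<in> LFG F G" "0 < x" for f x
    using series(1)[OF that(1) reparam_inverse(1)[OF F G that(2)]] reparam_inverse(2)[OF F G that(2)]
      by simp
  then show thesis using C_nonneg D_nonneg b series(2) by (intro that[of "C * (D / (1 - b))"]) auto
qed

theorem normable_of_boyd_exponent:
  assumes F: "phi_function F" and G: "phi_function G"
    and boyd: "boyd_exponent F G q" "1 < q" and bound: "decreasing_sum_bound G C"
  shows "normable F G"
proof -
  obtain B where B_nonneg: "0 \<le> B"
    and summable: "\<And>f x. f \<in> LFG F G \<Longrightarrow> 0 < x \<Longrightarrow> summable (\<lambda>k. rearr f (x / 2 ^ k) / 2 ^ k)"
    and lux_le: "\<And>f. f \<in> LFG F G \<Longrightarrow>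
      lux G (\<lambda>x. dyadic_average f (reparam F G x)) \<le> ennreal B * lorentz F G f"
    using lux_dyadic_average_le[OF F G boyd bound] by blast
  have C_nonneg: "0 \<le> C" using bound by (rule decreasing_sum_bound_nonneg)
  show ?thesis
    unfolding normable_def
  proof (intro exI[of _ "2 * (C * B)"] conjI allI impI)
    fix n and fs :: "nat \<Rightarrow> real \<Rightarrow> real" assume "\<forall>i<n. fs i \<in> LFG F G"
    then have fs: "fs i \<in> LFG F G" if "i < n" for i using that by blast
    define A where "A x = (\<Sum>i<n. dyadic_average (fs i) (reparam F G x))" for x
    have fin: "rearr_finite (\<lambda>x. \<Sum>i<n. \<bar>fs i x\<bar>)"
      by (rule rearr_finite_sum[OF LFG_measurable[OF fs] LFG_rearr_finite[OF fs] summable[OF fs]])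
    have "\<bar>rearr (\<lambda>x. \<Sum>i<n. \<bar>fs i x\<bar>) (reparam F G x)\<bar> \<le> \<bar>2 * A x\<bar>" if "0 < x" for x
    proof -
      have "rearr (\<lambda>x. \<Sum>i<n. \<bar>fs i x\<bar>) (reparam F G x) \<le> 2 * A x"
        unfolding A_def
        by (rule rearr_sum_le[OF LFG_measurable[OF fs] LFG_rearr_finite[OF fs] summable[OF fs]
              reparam_pos[OF F G that]])
      then show ?thesis using rearr_nonneg[OF fin reparam_pos[OF F G that]] by linarith
    qed
    then have "lorentz F G (\<lambda>x. \<Sum>i<n. \<bar>fs i x\<bar>) \<le> lux G (\<lambda>x. 2 * A x)"
      unfolding lorentz_eq_lux[OF F G fin] by (rule lux_mono[OF G])
    also have "\<dots> \<le> ennreal 2 * lux G A" by (rule lux_scale_le[OF G]) simp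
    also have "\<dots> \<le> ennreal 2 * (ennreal C * (\<Sum>i<n. lux G (\<lambda>x. dyadic_average (fs i) (reparam F G x))))"
      unfolding A_def[abs_def]
      by (intro mult_left_mono decreasing_sum_boundD[OF bound] decreasing_fun_dyadic_average F G
          LFG_rearr_finite[OF fs] summable[OF fs]) auto
    also have "\<dots> \<le> ennreal 2 * (ennreal C * (\<Sum>i<n. ennreal B * lorentz F G (fs i)))"
      using fs lux_le by (intro mult_left_mono sum_mono) auto
    also have "\<dots> = ennreal (2 * (C * B)) * (\<Sum>i<n. lorentz F G (fs i))"
      using B_nonneg C_nonneg by (simp add: sum_distrib_left[symmetric] ennreal_mult mult.assoc)
    finally show "lorentz F G (\<lambda>x. \<Sum>i<n. \<bar>fs i x\<bar>) \<le> ennreal (2 * (C * B)) * (\<Sum>i<n. lorentz F G (fs i))" .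
  qed (use B_nonneg C_nonneg in simp)
qed

section \<open>Equimeasurable copies and the Boyd index\<close>

text \<open>Cutting the half-line into unit intervals and spreading every \<open>n\<close>-th of them out
  produces \<open>n\<close> disjoint equimeasurable copies of a function.\<close>

definition unit_spread :: "nat \<Rightarrow> real \<Rightarrow> real" where
  "unit_spread n x = of_int (\<lfloor>x\<rfloor> div int n) + frac x"

definition spread_copy :: "nat \<Rightarrow> (real \<Rightarrow> real) \<Rightarrow> nat \<Rightarrow> real \<Rightarrow> real" where
  "spread_copy n f i x = (if \<lfloor>x\<rfloor> mod int n = int i then f (unit_spread n x) else 0)"

lemma unit_spread_nonneg: "0 \<le> x \<Longrightarrow> 0 \<le> unit_spread n x"
  by (cases "n = 0") (simp_all add: unit_spread_def pos_imp_zdiv_nonneg_iff)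

lemma unit_spread_measurable[measurable]: "unit_spread n \<in> borel_measurable borel"
proof -
  have [measurable]: "(\<lambda>x::real. \<lfloor>x\<rfloor>) \<in> borel \<rightarrow>\<^sub>M count_space UNIV" by measurable
  have "(\<lambda>x::real. real_of_int (\<lfloor>x\<rfloor> div int n)) \<in> borel_measurable borel"
    by (rule measurable_compose[where N = "count_space UNIV"]) measurable
  then show ?thesis unfolding unit_spread_def[abs_def] frac_def by measurable
qed

lemma residue_measurable[measurable]: "Measurable.pred borel (\<lambda>x::real. \<lfloor>x\<rfloor> mod int n = int i)"
  by (rule measurable_compose[where N = "count_space UNIV" and f = floor]) measurable

lemma floor_eq_measurable[measurable]: "Measurable.pred borel (\<lambda>x::real. \<lfloor>x\<rfloor> = z)"
  by (rule measurable_compose[where N = "count_space UNIV" and f = floor]) measurable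

lemma floor_mod_eq_iff:
  fixes x :: real
  assumes i: "i < n"
  shows "0 \<le> x \<and> \<lfloor>x\<rfloor> mod int n = int i \<longleftrightarrow> (\<exists>m. \<lfloor>x\<rfloor> = int (n * m + i))"
proof
  assume x: "0 \<le> x \<and> \<lfloor>x\<rfloor> mod int n = int i"
  define m where "m = nat (\<lfloor>x\<rfloor> div int n)"
  have "\<lfloor>x\<rfloor> div int n = int m" using x i by (simp add: m_def pos_imp_zdiv_nonneg_iff)
  moreover have "\<lfloor>x\<rfloor> = int n * (\<lfloor>x\<rfloor> div int n) + \<lfloor>x\<rfloor> mod int n" by simp
  ultimately show "\<exists>m. \<lfloor>x\<rfloor> = int (n * m + i)" using x by (intro exI[of _ m]) simp
next
  assume "\<exists>m. \<lfloor>x\<rfloor> = int (n * m + i)"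
  then obtain m where m: "\<lfloor>x\<rfloor> = int (n * m + i)" ..
  have "\<lfloor>x\<rfloor> mod int n = int i" unfolding m using i by (simp flip: zmod_int)
  moreover have "0 \<le> \<lfloor>x\<rfloor>" unfolding m by simp
  ultimately show "0 \<le> x \<and> \<lfloor>x\<rfloor> mod int n = int i" by simp
qed

lemma unit_spread_eq:
  assumes "i < n" and x: "\<lfloor>x\<rfloor> = int (n * m + i)"
  shows "unit_spread n x = x + of_int (int m - int (n * m + i))"
proof -
  have "\<lfloor>x\<rfloor> div int n = int m" unfolding x using assms(1) by (simp flip: zdiv_int)
  then show ?thesis by (simp add: unit_spread_def frac_def x)
qed

lemma emeasure_unit_spread_piece:
  assumes [measurable]: "A \<in> sets borel" and i: "i < n"
  shows "emeasure lborel {x. \<lfloor>x\<rfloor> = int (n * m + i) \<and> unit_spread n x \<in> A}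
    = emeasure lborel {x \<in> A. \<lfloor>x\<rfloor> = int m}"
proof -
  define z where "z = int m - int (n * m + i)"
  have "\<lfloor>of_int z + 1 * x\<rfloor> = int m \<longleftrightarrow> \<lfloor>x\<rfloor> = int (n * m + i)" for x :: real
  proof -
    have "\<lfloor>of_int z + 1 * x\<rfloor> = z + \<lfloor>x\<rfloor>" by simp
    then show ?thesis by (auto simp: z_def)
  qed
  moreover have "unit_spread n x = of_int z + 1 * x" if "\<lfloor>x\<rfloor> = int (n * m + i)" for x
    using unit_spread_eq[OF i that] by (simp add: z_def)
  ultimately have "{x. \<lfloor>x\<rfloor> = int (n * m + i) \<and> unit_spread n x \<in> A}
      = {x. of_int z + 1 * x \<in> {x \<in> A. \<lfloor>x\<rfloor> = int m}}"
    by auto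
  then show ?thesis using emeasure_lborel_affine[of 1 "{x \<in> A. \<lfloor>x\<rfloor> = int m}" "of_int z"] by simp
qed

lemma emeasure_unit_spread_vimage:
  assumes A[measurable]: "A \<in> sets borel" and A_nonneg: "A \<subseteq> {0..}" and i: "i < n"
  shows "emeasure lborel {x \<in> {0..}. \<lfloor>x\<rfloor> mod int n = int i \<and> unit_spread n x \<in> A} = emeasure lborel A"
proof -
  define B where "B m = {x \<in> A. \<lfloor>x\<rfloor> = int m}" for m
  define S where "S m = {x. \<lfloor>x\<rfloor> = int (n * m + i) \<and> unit_spread n x \<in> A}" for m
  have [measurable]: "B m \<in> sets borel" "S m \<in> sets borel" for m
    unfolding B_def S_def by measurable
  have "{x \<in> {0..}. \<lfloor>x\<rfloor> mod int n = int i \<and> unit_spread n x \<in> A} = (\<Union>m. S m)"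
    using floor_mod_eq_iff[OF i] by (auto simp: S_def)
  moreover have "A = (\<Union>m. B m)"
  proof (intro equalityI subsetI)
    fix x assume x: "x \<in> A"
    then have "x \<in> B (nat \<lfloor>x\<rfloor>)" using A_nonneg by (auto simp: B_def)
    then show "x \<in> (\<Union>m. B m)" by blast
  qed (auto simp: B_def)
  moreover have "disjoint_family S" "disjoint_family B"
    using i by (auto simp: disjoint_family_on_def S_def B_def)
  then have "emeasure lborel (\<Union>m. S m) = (\<Sum>m. emeasure lborel (S m))"
    "emeasure lborel (\<Union>m. B m) = (\<Sum>m. emeasure lborel (B m))"
    by (auto intro!: suminf_emeasure[symmetric])
  moreover have "emeasure lborel (S m) = emeasure lborel (B m)" for m
    unfolding S_def B_def by (rule emeasure_unit_spread_piece[OF A i])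
  ultimately show ?thesis by simp
qed

lemma superlevel_spread_copy:
  "0 < t \<Longrightarrow> superlevel (spread_copy n f i) t
    = {x \<in> {0..}. \<lfloor>x\<rfloor> mod int n = int i \<and> unit_spread n x \<in> superlevel f t}"
  by (auto simp: superlevel_def spread_copy_def unit_spread_nonneg split: if_splits)

lemma
  assumes f: "f \<in> borel_measurable borel" and n: "i < n"
  shows emeasure_superlevel_spread_copy:
      "0 < t \<Longrightarrow> emeasure lborel (superlevel (spread_copy n f i) t) = emeasure lborel (superlevel f t)"
    and emeasure_superlevel_unit_spread:
      "emeasure lborel (superlevel (\<lambda>x. f (unit_spread n x)) t) = of_nat n * emeasure lborel (superlevel f t)"
proof -
  let ?D = "\<lambda>i. {x \<in> {0..}. \<lfloor>x\<rfloor> mod int n = int i \<and> unit_spread n x \<in> superlevel f t}"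
  have [measurable]: "superlevel f t \<in> sets borel" by (rule superlevel_sets[OF f])
  have D: "emeasure lborel (?D i) = emeasure lborel (superlevel f t)" if "i < n" for i
    using that by (intro emeasure_unit_spread_vimage superlevel_sets f) (auto simp: superlevel_def)
  show "0 < t \<Longrightarrow> emeasure lborel (superlevel (spread_copy n f i) t) = emeasure lborel (superlevel f t)"
    using D[OF n] by (simp add: superlevel_spread_copy)
  have "\<exists>i\<in>{..<n}. \<lfloor>x\<rfloor> mod int n = int i" for x :: real
    using n by (intro bexI[of _ "nat (\<lfloor>x\<rfloor> mod int n)"]) (simp_all add: nat_less_iff)
  then have "superlevel (\<lambda>x. f (unit_spread n x)) t = (\<Union>i<n. ?D i)"
    by (auto simp: superlevel_def unit_spread_nonneg)
  also have "emeasure lborel \<dots> = (\<Sum>i<n. emeasure lborel (?D i))"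
    by (intro sum_emeasure[symmetric]) (auto simp: disjoint_family_on_def)
  also have "\<dots> = of_nat n * emeasure lborel (superlevel f t)"
    using D by simp
  finally show "emeasure lborel (superlevel (\<lambda>x. f (unit_spread n x)) t) = of_nat n * emeasure lborel (superlevel f t)" .
qed

lemma spread_copy_measurable:
  assumes [measurable]: "f \<in> borel_measurable borel"
  shows "spread_copy n f i \<in> borel_measurable borel"
  unfolding spread_copy_def[abs_def] by measurable

lemma sum_abs_spread_copy:
  assumes "0 < n"
  shows "(\<Sum>i<n. \<bar>spread_copy n f i x\<bar>) = \<bar>f (unit_spread n x)\<bar>"
proof -
  define j where "j = nat (\<lfloor>x\<rfloor> mod int n)"
  have j: "j < n" "\<lfloor>x\<rfloor> mod int n = int j" using assms by (auto simp: j_def nat_less_iff)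
  then have "(\<Sum>i<n. \<bar>spread_copy n f i x\<bar>) = (\<Sum>i<n. if i = j then \<bar>f (unit_spread n x)\<bar> else 0)"
    by (intro sum.cong) (auto simp: spread_copy_def)
  then show ?thesis using j by simp
qed

lemma level_set_dil_subset:
  assumes f: "f \<in> borel_measurable borel" and a_pos: "0 < a" and n: "1 \<le> real n * a" and x_pos: "0 < x"
  shows "level_set (dil a f) x \<subseteq> level_set (\<lambda>x. f (unit_spread n x)) x"
proof
  fix t assume "t \<in> level_set (dil a f) x"
  then have "ennreal (a * x) \<le> emeasure lborel (superlevel f t)"
    using level_set_dil[OF a_pos f] by (simp add: mem_level_set_iff)
  then have "of_nat n * ennreal (a * x) \<le> of_nat n * emeasure lborel (superlevel f t)"
    by (rule mult_left_mono) simp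
  moreover have "ennreal x \<le> ennreal (real n * (a * x))"
    using mult_right_mono[OF n, of x] x_pos by (intro ennreal_leI) (simp add: mult.assoc)
  moreover have "ennreal (real n * (a * x)) = of_nat n * ennreal (a * x)"
    using a_pos x_pos by (simp add: ennreal_mult ennreal_of_nat_eq_real_of_nat)
  moreover have "0 < n" using n by (cases n) auto
  ultimately show "t \<in> level_set (\<lambda>x. f (unit_spread n x)) x"
    using emeasure_superlevel_unit_spread[OF f] by (simp add: mem_level_set_iff)
qed

theorem boyd_exponent_1_of_normable:
  assumes F: "phi_function F" and G: "phi_function G" and norm: "normable F G"
  shows "boyd_exponent F G 1"
proof -
  obtain C where C_nonneg: "0 \<le> C" and lorentz_sum_le: "\<And>n (fs :: nat \<Rightarrow> real \<Rightarrow> real). (\<And>i. i < n \<Longrightarrow> fs i \<in> LFG F G) \<Longrightarrow>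
      lorentz F G (\<lambda>x. \<Sum>i<n. \<bar>fs i x\<bar>) \<le> ennreal C * (\<Sum>i<n. lorentz F G (fs i))"
    using norm unfolding normable_def by blast
  have "lorentz F G (dil a f) \<le> ennreal (2 * C * a powr (-1 / 1)) * lorentz F G f"
    if a: "0 < a" "a < 1" and f: "f \<in> LFG F G" for a f
  proof -
    note f_meas = LFG_measurable[OF f]
    define n where "n = nat \<lceil>1 / a\<rceil>"
    have n: "1 / a \<le> real n" by (simp add: n_def real_nat_ceiling_ge)
    moreover have "1 < 1 / a" using a by simp
    ultimately have n_le: "real n \<le> 2 / a" and n_pos: "0 < n" unfolding n_def by linarith+
    have copy_le: "lorentz F G (spread_copy n f i) \<le> lorentz F G f" if "i < n" for i
      using that emeasure_superlevel_spread_copy[OF f_meas]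
        by (intro lorentz_mono F G level_set_mono) simp
    then have copy: "spread_copy n f i \<in> LFG F G" if "i < n" for i
      using that f spread_copy_measurable[OF f_meas] by (auto simp: LFG_def intro: le_less_trans)
    have "lorentz F G (dil a f) \<le> lorentz F G (\<lambda>x. f (unit_spread n x))"
      using n a(1) by (intro lorentz_mono F G level_set_dil_subset f_meas) (simp_all add: field_simps)
    also have "\<dots> = lorentz F G (\<lambda>x. \<Sum>i<n. \<bar>spread_copy n f i x\<bar>)"
      using n_pos by (intro lorentz_cong) (simp add: sum_abs_spread_copy)
    also have "\<dots> \<le> ennreal C * (\<Sum>i<n. lorentz F G (spread_copy n f i))"
      by (rule lorentz_sum_le[OF copy])
    also have "\<dots> \<le> ennreal C * (\<Sum>i<n. lorentz F G f)"
      using copy_le by (intro mult_left_mono sum_mono) auto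
    also have "\<dots> = ennreal (C * real n) * lorentz F G f"
      using C_nonneg by (simp add: ennreal_mult ennreal_of_nat_eq_real_of_nat mult.assoc)
    also have "\<dots> \<le> ennreal (2 * C * a powr (-1 / 1)) * lorentz F G f"
      using mult_left_mono[OF n_le C_nonneg] a(1)
      by (intro mult_right_mono ennreal_leI) (simp_all add: powr_minus field_simps)
    finally show ?thesis .
  qed
  then show ?thesis unfolding boyd_exponent_def using C_nonneg by (intro conjI exI[of _ "2 * C"]) auto
qed

section \<open>Testing normability on indicator functions\<close>

lemma lorentz_indicator_le:
  assumes F: "phi_function F" and G: "phi_function G" and x_pos: "0 < x" and b_pos: "0 < b"
  shows "lorentz F G (\<lambda>y. b * indicator {0..reparam F G x} y) \<le> ennreal (b / envelope G x)"
proof -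
  define w g where "w = reparam F G x" and "g y = b * indicator {0..w} y" for y :: real
  have w_pos: "0 < w" using F G x_pos by (simp add: w_def reparam_pos)
  have env: "0 < envelope G x" using G x_pos by (rule envelope_pos)
  have level: "t \<le> (if z \<le> w then b else 0)" if "0 < z" "0 < t" "t \<in> level_set g z" for z t
  proof -
    have "superlevel g t = (if t \<le> b then {0..w} else {})"
      using that(2) b_pos by (auto simp: superlevel_def g_def indicator_def)
    then show ?thesis using that w_pos by (auto simp: mem_level_set_iff ennreal_le_iff split: if_splits)
  qed
  have "t \<le> b" if "0 < z" "0 < t" "t \<in> level_set g z" for z t
    using level[OF that] b_pos by (auto split: if_splits)
  then have fin: "rearr_finite g"
    unfolding rearr_finite_def using b_pos by (intro allI impI bdd_above_level_set[of b]) auto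
  have "modular G (\<lambda>y. \<bar>rearr g (reparam F G y)\<bar> / (b / envelope G x))
      \<le> (\<integral>\<^sup>+ y. ennreal (1 / x) * indicator {0<..x} y \<partial>half_line)"
    unfolding modular_def
  proof (rule nn_integral_mono)
    fix y assume "y \<in> space half_line"
    then have y_pos: "0 < y" by (simp add: space_restrict_space)
    have pos: "0 < reparam F G y" using F G y_pos by (rule reparam_pos)
    have nonneg: "0 \<le> rearr g (reparam F G y)" by (rule rearr_nonneg[OF fin pos])
    have "rearr g (reparam F G y) \<le> (if y \<le> x then b else 0)"
      using b_pos level[OF pos] reparam_le_iff[OF F G y_pos x_pos]
        by (intro rearr_le) (auto simp: w_def)
    then have quotient_le: "\<bar>rearr g (reparam F G y)\<bar> / (b / envelope G x) \<le> (if y \<le> x then envelope G x else 0)"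
      using nonneg b_pos env by (auto simp: field_simps split: if_splits)
    have "G (\<bar>rearr g (reparam F G y)\<bar> / (b / envelope G x)) \<le> G (if y \<le> x then envelope G x else 0)"
      using quotient_le b_pos env by (subst phi_le_iff[OF G]) auto
    also have "\<dots> = (if y \<le> x then 1 / x else 0)" using x_pos by (simp add: phi_envelope G phi_zero)
    finally show "ennreal (G (\<bar>rearr g (reparam F G y)\<bar> / (b / envelope G x)))
        \<le> ennreal (1 / x) * indicator {0<..x} y"
      using y_pos by (auto simp: indicator_def ennreal_eq_0_iff intro: ennreal_leI split: if_splits)
  qed
  also have "\<dots> = 1" using x_pos by (subst nn_integral_half_line_Ioc) auto
  finally have "lux G (\<lambda>y. rearr g (reparam F G y)) \<le> ennreal (b / envelope G x)"
    using b_pos env by (intro lux_le_of_modular_le_1) auto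
  then show ?thesis using lorentz_eq_lux[OF F G fin] by (simp add: g_def[abs_def] w_def)
qed

lemma sum_le_modular:
  assumes I: "finite I" and J: "disjoint_family_on J I" "\<And>i. i \<in> I \<Longrightarrow> J i \<in> sets half_line"
    and c: "\<And>i x. i \<in> I \<Longrightarrow> x \<in> J i \<Longrightarrow> c i \<le> G (h x)"
  shows "(\<Sum>i\<in>I. ennreal (c i) * emeasure half_line (J i)) \<le> modular G h"
proof -
  have "(\<Sum>i\<in>I. ennreal (c i) * emeasure half_line (J i))
      = (\<integral>\<^sup>+ x. (\<Sum>i\<in>I. ennreal (c i) * indicator (J i) x) \<partial>half_line)"
    using J by (simp add: nn_integral_sum nn_integral_cmult_indicator)
  also have "\<dots> \<le> modular G h"
    unfolding modular_def
  proof (rule nn_integral_mono)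
    fix x
    show "(\<Sum>i\<in>I. ennreal (c i) * indicator (J i) x) \<le> ennreal (G (h x))"
    proof (cases "\<exists>i\<in>I. x \<in> J i")
      case True
      then obtain i where i: "i \<in> I" "x \<in> J i" by blast
      then have "(\<Sum>i\<in>I. ennreal (c i) * indicator (J i) x) = ennreal (c i)"
        by (rule sum_indicator_disjoint_family[OF J(1) _ I, rotated])
      then show ?thesis using c i by (simp add: ennreal_leI)
    next
      case False
      then have "(\<Sum>i\<in>I. ennreal (c i) * indicator (J i) x) = 0" by (intro sum.neutral) auto
      then show ?thesis by simp
    qed
  qed
  finally show ?thesis .
qed

lemma normable_finite_sum:
  assumes "normable F G"
  obtains C where "0 \<le> C" "\<And>(I :: 'i set) f. finite I \<Longrightarrow> (\<And>i. i \<in> I \<Longrightarrow> f i \<in> LFG F G) \<Longrightarrow>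
    lorentz F G (\<lambda>x. \<Sum>i\<in>I. \<bar>f i x\<bar>) \<le> ennreal C * (\<Sum>i\<in>I. lorentz F G (f i))"
proof -
  obtain C where C_nonneg: "0 \<le> C" and lorentz_sum_le: "\<And>n (fs :: nat \<Rightarrow> real \<Rightarrow> real). (\<And>i. i < n \<Longrightarrow> fs i \<in> LFG F G) \<Longrightarrow>
      lorentz F G (\<lambda>x. \<Sum>i<n. \<bar>fs i x\<bar>) \<le> ennreal C * (\<Sum>i<n. lorentz F G (fs i))"
    using assms unfolding normable_def by blast
  have "lorentz F G (\<lambda>x. \<Sum>i\<in>I. \<bar>f i x\<bar>) \<le> ennreal C * (\<Sum>i\<in>I. lorentz F G (f i))"
    if I: "finite I" and f: "\<And>i. i \<in> I \<Longrightarrow> f i \<in> LFG F G" for I :: "'i set" and f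
  proof -
    obtain e where e: "bij_betw e {..<card I} I"
      using ex_bij_betw_nat_finite[OF I] by (auto simp: atLeast0LessThan)
    have "lorentz F G (\<lambda>x. \<Sum>i<card I. \<bar>f (e i) x\<bar>) \<le> ennreal C * (\<Sum>i<card I. lorentz F G (f (e i)))"
      using f bij_betwE[OF e] by (intro lorentz_sum_le) auto
    also have "(\<Sum>i<card I. lorentz F G (f (e i))) = (\<Sum>i\<in>I. lorentz F G (f i))"
      by (rule sum.reindex_bij_betw[OF e])
    also have "(\<lambda>x. \<Sum>i<card I. \<bar>f (e i) x\<bar>) = (\<lambda>x. \<Sum>i\<in>I. \<bar>f i x\<bar>)"
      by (rule ext, rule sum.reindex_bij_betw[OF e])
    finally show ?thesis .
  qed
  with C_nonneg show thesis by (rule that)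
qed

lemma rearr_ge_of_initial_segment:
  assumes "rearr_finite f" "f \<in> borel_measurable borel" "0 < x" "x \<le> w"
    and "\<And>y. y \<in> {0..w} \<Longrightarrow> s \<le> f y"
  shows "s \<le> rearr f x"
proof (rule le_rearr)
  have "{0..w} \<subseteq> superlevel f s" using assms(5) by (force simp: superlevel_def)
  then have "emeasure lborel {0..w} \<le> emeasure lborel (superlevel f s)"
    by (rule emeasure_mono) (simp add: superlevel_sets assms(2))
  moreover have "ennreal x \<le> emeasure lborel {0..w}" using assms(3,4) by (simp add: ennreal_leI)
  ultimately show "s \<in> level_set f x" by (simp add: mem_level_set_iff)
qed (use assms in auto)

lemma disjoint_family_on_dyadic:
  assumes "inj_on k I"
  shows "disjoint_family_on (\<lambda>i. {2 powr - real_of_int (k i) / 2<..2 powr - real_of_int (k i)}) I"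
  unfolding disjoint_family_on_def
proof (intro ballI impI)
  fix i i' assume "i \<in> I" "i' \<in> I" "i \<noteq> i'"
  then have "k i \<noteq> k i'" using assms by (auto dest: inj_onD)
  have half_le: "2 powr - real_of_int m \<le> 2 powr - real_of_int l / 2" if "l < m" for l m
  proof -
    have "2 powr - real_of_int m \<le> 2 powr (- real_of_int l - 1)" using that by (intro powr_mono) auto
    then show ?thesis by (simp add: powr_diff)
  qed
  from \<open>k i \<noteq> k i'\<close> have "k i < k i' \<or> k i' < k i" by linarith
  then show "{2 powr - real_of_int (k i) / 2<..2 powr - real_of_int (k i)}
      \<inter> {2 powr - real_of_int (k i') / 2<..2 powr - real_of_int (k i')} = {}"
    using half_le[of "k i" "k i'"] half_le[of "k i'" "k i"] by auto
qed

lemma modular_rearr_reparam_le_1: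
  assumes F: "phi_function F" and G: "phi_function G" and less: "lorentz F G f < 1"
  shows "rearr_finite f" "modular G (\<lambda>x. rearr f (reparam F G x)) \<le> 1"
proof -
  show fin: "rearr_finite f"
    using less by (intro rearr_finite_of_lorentz[of F G]) (auto intro: less_trans)
  have "modular G (\<lambda>x. rearr f (reparam F G x)) = modular G (\<lambda>x. \<bar>rearr f (reparam F G x)\<bar> / 1)"
    by (rule modular_cong) (simp add: rearr_nonneg fin reparam_pos F G)
  also have "\<dots> \<le> 1"
    using less lorentz_eq_lux[OF F G fin] by (intro modular_le_1_of_lux_less[OF G]) simp
  finally show "modular G (\<lambda>x. rearr f (reparam F G x)) \<le> 1" .
qed

lemma sum_levels_le:
  fixes k :: "'i \<Rightarrow> int"
  assumes F: "phi_function F" and G: "phi_function G"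
    and f: "f \<in> borel_measurable borel" "lorentz F G f < 1"
    and I: "finite I" "inj_on k I" and s: "\<And>i. i \<in> I \<Longrightarrow> 0 \<le> s i"
    and level_le: "\<And>i y. i \<in> I \<Longrightarrow> y \<in> {0..reparam F G (2 powr - of_int (k i))} \<Longrightarrow> s i \<le> f y"
  shows "(\<Sum>i\<in>I. G (s i) * 2 powr - of_int (k i)) \<le> 2"
proof -
  define u where "u i = 2 powr (- of_int (k i) :: real)" for i
  have u: "0 < u i" for i by (simp add: u_def)
  note fin = modular_rearr_reparam_le_1(1)[OF F G f(2)]
  have rearr_ge: "s i \<le> rearr f (reparam F G x)" if i: "i \<in> I" and x: "0 < x" "x \<le> u i" for i x
    using level_le[OF i] x u
      by (intro rearr_ge_of_initial_segment[OF fin f(1), of _ "reparam F G (u i)"])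
      (auto simp: u_def reparam_pos reparam_le_iff F G)
  have "ennreal (G (s i) * u i / 2) = ennreal (G (s i)) * emeasure half_line {u i / 2<..u i}" if "i \<in> I" for i
    using s[OF that] u[of i] by (simp add: emeasure_half_line_Ioc ennreal_mult[symmetric] phi_nonneg G)
  then have "ennreal ((\<Sum>i\<in>I. G (s i) * u i) / 2) = (\<Sum>i\<in>I. ennreal (G (s i)) * emeasure half_line {u i / 2<..u i})"
    using s u by (simp add: sum_divide_distrib phi_nonneg G less_imp_le sum_ennreal[symmetric])
  also have "\<dots> \<le> modular G (\<lambda>x. rearr f (reparam F G x))"
  proof (rule sum_le_modular[OF I(1)])
    show "disjoint_family_on (\<lambda>i. {u i / 2<..u i}) I"
      unfolding u_def by (rule disjoint_family_on_dyadic[OF I(2)])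
    fix i x assume i: "i \<in> I" and x: "x \<in> {u i / 2<..u i}"
    then have "0 < x" using u[of i] by auto
    then have "s i \<le> rearr f (reparam F G x)" using rearr_ge[OF i] x by simp
    then show "G (s i) \<le> G (rearr f (reparam F G x))" using s[OF i] phi_le_iff[OF G] by simp
  qed (use u in \<open>simp add: sets_half_line_Ioc less_imp_le\<close>)
  also note modular_rearr_reparam_le_1(2)[OF F G f(2)]
  finally show ?thesis by (simp add: u_def)
qed

theorem normable_levels:
  assumes F: "phi_function F" and G: "phi_function G" and norm: "normable F G"
  defines "T \<equiv> \<lambda>k::int. phi_inv G (2 powr of_int k)"
  obtains \<delta> where "0 < \<delta>" "\<And>(I :: 'i set) j k. finite I \<Longrightarrow> inj_on k I \<Longrightarrow> (\<Sum>i\<in>I. T (j i) / T (k i)) < \<delta> \<Longrightarrow>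
    (\<Sum>i\<in>I. 2 powr of_int (j i - k i)) \<le> (2::real)"
proof -
  obtain C where C_nonneg: "0 \<le> C" and lorentz_sum_le: "\<And>(I :: 'i set) f. finite I \<Longrightarrow> (\<And>i. i \<in> I \<Longrightarrow> f i \<in> LFG F G) \<Longrightarrow>
      lorentz F G (\<lambda>x. \<Sum>i\<in>I. \<bar>f i x\<bar>) \<le> ennreal C * (\<Sum>i\<in>I. lorentz F G (f i))"
    using normable_finite_sum[OF norm] by blast
  have T: "T k = envelope G (2 powr - of_int k)" "G (T k) = 2 powr of_int k" "0 < T k" for k
    by (simp_all add: T_def envelope_def powr_minus inverse_eq_divide phi_phi_inv phi_inv_pos G)
  show thesis
  proof
    show "0 < 1 / (C + 1)" using C_nonneg by simp
    fix I :: "'i set" and j k :: "'i \<Rightarrow> int"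
    assume I: "finite I" "inj_on k I" and small: "(\<Sum>i\<in>I. T (j i) / T (k i)) < 1 / (C + 1)"
    define g where "g i = (\<lambda>y. T (j i) * indicator {0..reparam F G (2 powr - of_int (k i))} y)" for i
    have g_le: "lorentz F G (g i) \<le> ennreal (T (j i) / T (k i))" for i
      unfolding g_def T(1)[of "k i"] by (rule lorentz_indicator_le[OF F G _ T(3)]) simp
    have g: "g i \<in> LFG F G" for i
      using g_le[of i] by (auto simp: LFG_def g_def intro: le_less_trans)
    define f where "f x = (\<Sum>i\<in>I. \<bar>g i x\<bar>)" for x
    have "lorentz F G f \<le> ennreal C * (\<Sum>i\<in>I. lorentz F G (g i))"
      unfolding f_def[abs_def] by (rule lorentz_sum_le[OF I(1) g])
    also have "\<dots> \<le> ennreal C * (\<Sum>i\<in>I. ennreal (T (j i) / T (k i)))"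
      by (intro mult_left_mono sum_mono g_le) simp
    also have "\<dots> = ennreal (C * (\<Sum>i\<in>I. T (j i) / T (k i)))"
      using C_nonneg T(3) by (simp add: ennreal_mult sum_nonneg less_imp_le)
    also have "\<dots> < ennreal 1"
    proof (rule ennreal_lessI)
      have "C * (\<Sum>i\<in>I. T (j i) / T (k i)) \<le> C * (1 / (C + 1))"
        using C_nonneg small by (intro mult_left_mono) auto
      also have "\<dots> < 1" using C_nonneg by simp
      finally show "C * (\<Sum>i\<in>I. T (j i) / T (k i)) < 1" .
    qed simp
    finally have lorentz_f: "lorentz F G f < 1" by simp
    have f_meas: "f \<in> borel_measurable borel" unfolding f_def[abs_def] g_def by measurable
    have "T (j i) \<le> f y" if "i \<in> I" "y \<in> {0..reparam F G (2 powr - of_int (k i))}" for i y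
    proof -
      have "T (j i) = \<bar>g i y\<bar>" using that T(3)[of "j i"] by (simp add: g_def)
      also have "\<dots> \<le> f y" unfolding f_def using I that by (intro member_le_sum) auto
      finally show ?thesis .
    qed
    from sum_levels_le[OF F G f_meas lorentz_f I _ this]
    show "(\<Sum>i\<in>I. 2 powr of_int (j i - k i)) \<le> (2::real)"
      using T by (simp add: less_imp_le powr_add[symmetric])
  qed
qed

section \<open>Blocks of levels\<close>

lemma greedy_int_sequence:
  fixes P :: "nat \<Rightarrow> int \<Rightarrow> int \<Rightarrow> bool"
  assumes ex: "\<And>n u. \<exists>v>u. P n u v"
  obtains s where "s 0 = 0" "\<And>n. s n < s (Suc n)" "\<And>n. P n (s n) (s (Suc n))"
    "\<And>n v. s n < v \<Longrightarrow> v < s (Suc n) \<Longrightarrow> \<not> P n (s n) v"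
proof -
  have least: "\<exists>v>u. P n u v \<and> (\<forall>v'. u < v' \<and> v' < v \<longrightarrow> \<not> P n u v')" for n u
  proof -
    obtain v where v: "u < v" "P n u v" using ex by blast
    define w where "w = u + 1 + int (LEAST m. P n u (u + 1 + int m))"
    have "P n u (u + 1 + int (nat (v - u - 1)))" using v by simp
    then have "P n u w" unfolding w_def by (rule LeastI)
    moreover have "\<forall>v'. u < v' \<and> v' < w \<longrightarrow> \<not> P n u v'"
    proof (intro allI impI)
      fix v' assume v': "u < v' \<and> v' < w"
      then have "nat (v' - u - 1) < (LEAST m. P n u (u + 1 + int m))" by (auto simp: w_def)
      from not_less_Least[OF this] show "\<not> P n u v'" using v' by simp
    qed
    moreover have "u < w" by (simp add: w_def)
    ultimately show ?thesis by blast
  qed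
  have "\<exists>s. \<forall>n. (n = 0 \<longrightarrow> s n = 0) \<and> (s n < s (Suc n) \<and> P n (s n) (s (Suc n)) \<and>
      (\<forall>v. s n < v \<and> v < s (Suc n) \<longrightarrow> \<not> P n (s n) v))"
    by (rule dependent_nat_choice) (use least in auto)
  then obtain s where "\<forall>n. (n = 0 \<longrightarrow> s n = 0) \<and> (s n < s (Suc n) \<and> P n (s n) (s (Suc n)) \<and>
      (\<forall>v. s n < v \<and> v < s (Suc n) \<longrightarrow> \<not> P n (s n) v))" by blast
  then show thesis by (intro that[of s]) auto
qed

lemma strict_mono_int:
  fixes f :: "int \<Rightarrow> 'a :: order"
  assumes "\<And>i. f i < f (i + 1)"
  shows "strict_mono f"
proof (rule strict_monoI)
  fix i j :: int assume "i < j"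
  then show "f i < f j"
    by (induction j rule: int_gr_induct) (use assms in \<open>auto intro: less_trans\<close>)
qed

definition block_rank :: "int \<Rightarrow> nat" where
  "block_rank i = (if 0 \<le> i then nat i else nat (- 1 - i))"

lemma two_sided_greedy_sequence:
  fixes P :: "nat \<Rightarrow> int \<Rightarrow> int \<Rightarrow> bool"
  assumes right: "\<And>n u. \<exists>v>u. P n u v" and left: "\<And>n v. \<exists>u<v. P n u v"
  obtains a where "strict_mono a" "\<And>i. P (block_rank i) (a i) (a (i + 1))"
    "\<And>i. (\<forall>v. a i < v \<and> v < a (i + 1) \<longrightarrow> \<not> P (block_rank i) (a i) v)
      \<or> (\<forall>u. a i < u \<and> u < a (i + 1) \<longrightarrow> \<not> P (block_rank i) u (a (i + 1)))"
proof -
  obtain s where s: "s 0 = 0" "\<And>n. s n < s (Suc n)" "\<And>n. P n (s n) (s (Suc n))"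
    "\<And>n v. s n < v \<Longrightarrow> v < s (Suc n) \<Longrightarrow> \<not> P n (s n) v"
    using greedy_int_sequence[of P, OF right] by metis
  have "\<exists>v>u. P n (- v) (- u)" for n u
  proof -
    obtain v where "v < - u" "P n v (- u)" using left by blast
    then show ?thesis by (intro exI[of _ "- v"]) auto
  qed
  then obtain s' where s': "s' 0 = 0" "\<And>n. s' n < s' (Suc n)" "\<And>n. P n (- s' (Suc n)) (- s' n)"
    "\<And>n v. s' n < v \<Longrightarrow> v < s' (Suc n) \<Longrightarrow> \<not> P n (- v) (- s' n)"
    using greedy_int_sequence[of "\<lambda>n u v. P n (- v) (- u)"] by metis
  define a where "a i = (if 0 \<le> i then s (nat i) else - s' (nat (- i)))" for i
  have a: "(a i = s (block_rank i) \<and> a (i + 1) = s (Suc (block_rank i)))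
      \<or> (a i = - s' (Suc (block_rank i)) \<and> a (i + 1) = - s' (block_rank i))" for i
  proof (cases "0 \<le> i")
    case True
    then have "nat (i + 1) = Suc (nat i)" by simp
    with True show ?thesis by (simp add: a_def block_rank_def)
  next
    case False
    then have "nat (- i) = Suc (nat (- 1 - i))" by simp
    moreover have "a (i + 1) = - s' (nat (- 1 - i))"
      using False s(1) s'(1) by (cases "i = -1") (simp_all add: a_def algebra_simps)
    ultimately show ?thesis using False by (simp add: a_def block_rank_def)
  qed
  show thesis
  proof (rule that)
    have "a i < a (i + 1)" for i using a[of i] s(2) s'(2) by auto
    then show "strict_mono a" by (rule strict_mono_int)
    show "P (block_rank i) (a i) (a (i + 1))" for i using a[of i] s(3) s'(3) by auto
    show "(\<forall>v. a i < v \<and> v < a (i + 1) \<longrightarrow> \<not> P (block_rank i) (a i) v)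
      \<or> (\<forall>u. a i < u \<and> u < a (i + 1) \<longrightarrow> \<not> P (block_rank i) u (a (i + 1)))" for i
      using a[of i]
    proof
      assume "a i = - s' (Suc (block_rank i)) \<and> a (i + 1) = - s' (block_rank i)"
      then show ?thesis using s'(4)[of "block_rank i" "- _"] by force
    qed (use s(4) in auto)
  qed
qed

lemma sum_half_powers_le:
  assumes "finite I"
  shows "(\<Sum>n\<in>I. (1 / 2) ^ n) \<le> (2::real)"
proof -
  have "(\<Sum>n\<in>I. (1 / 2) ^ n) \<le> (\<Sum>n. (1 / 2 :: real) ^ n)"
    using assms by (intro sum_le_suminf summable_geometric) auto
  also have "\<dots> = 2" by (simp add: suminf_geometric)
  finally show ?thesis .
qed

lemma sum_half_powers_block_rank_le:
  assumes "finite I"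
  shows "(\<Sum>i\<in>I. (1 / 2) ^ block_rank i) \<le> (4::real)"
proof -
  have half: "(\<Sum>i\<in>J. (1 / 2) ^ block_rank i) \<le> (2::real)" if "finite J" "inj_on block_rank J" for J
    using sum_half_powers_le[of "block_rank ` J"] that by (simp add: sum.reindex)
  have "(\<Sum>i\<in>I. (1 / 2) ^ block_rank i)
      = (\<Sum>i\<in>I \<inter> {0..}. (1 / 2) ^ block_rank i) + (\<Sum>i\<in>I \<inter> {..<0}. (1 / 2 :: real) ^ block_rank i)"
    using assms by (subst sum.union_disjoint[symmetric]) (auto intro!: sum.cong)
  also have "\<dots> \<le> 2 + 2"
    using assms by (intro add_mono half) (auto simp: inj_on_def block_rank_def)
  finally show ?thesis by simp
qed

locale level_sequence =
  fixes T :: "int \<Rightarrow> real" and \<delta> :: real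
  assumes T_pos: "\<And>k. 0 < T k" and T_mono: "strict_mono T"
    and T_small: "\<And>e. 0 < e \<Longrightarrow> \<exists>k. T k \<le> e" and T_large: "\<And>e. \<exists>k. e \<le> T k"
    and \<delta>: "0 < \<delta>" and levels: "\<And>(I :: int set) j k. finite I \<Longrightarrow> inj_on k I \<Longrightarrow>
      (\<Sum>i\<in>I. T (j i) / T (k i)) < \<delta> \<Longrightarrow> (\<Sum>i\<in>I. 2 powr of_int (j i - k i)) \<le> (2::real)"
begin

lemma T_le_iff: "T i \<le> T j \<longleftrightarrow> i \<le> j"
  using T_mono by (rule strict_mono_less_eq)

definition V :: "int \<Rightarrow> real" where "V k = T k / 2 powr of_int k"

lemma V_pos: "0 < V k"
  by (simp add: V_def T_pos)

lemma T_eq: "T k = V k * 2 powr of_int k"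
  by (simp add: V_def)

lemma step_bounded:
  obtains E where "2 \<le> E" "\<And>k. T (k + 1) \<le> 2 * E * T k"
proof -
  let ?jumps = "{k. T (k - 1) / T k < \<delta> / 6}"
  have fin: "finite ?jumps"
  proof (rule ccontr)
    assume "infinite ?jumps"
    then obtain S where S: "S \<subseteq> ?jumps" "finite S" "card S = 5"
      using infinite_arbitrarily_large by blast
    have "(\<Sum>k\<in>S. T (k - 1) / T k) \<le> (\<Sum>k\<in>S. \<delta> / 6)" using S by (intro sum_mono) auto
    also have "\<dots> < \<delta>" using S \<delta> by simp
    finally have "(\<Sum>k\<in>S. 2 powr of_int (k - 1 - k)) \<le> (2::real)"
      using levels[OF S(2), of "\<lambda>k. k" "\<lambda>k. k - 1"] by simp
    then show False using S by (simp add: powr_minus)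
  qed
  define E where "E = Max (insert 2 (insert (6 / \<delta>) ((\<lambda>k. T k / T (k - 1)) ` ?jumps)))"
  have E: "2 \<le> E" "6 / \<delta> \<le> E" "\<And>k. k \<in> ?jumps \<Longrightarrow> T k / T (k - 1) \<le> E"
    unfolding E_def using fin by (intro Max_ge; force)+
  have step: "T k \<le> E * T (k - 1)" for k
  proof (cases "k \<in> ?jumps")
    case True
    then show ?thesis using E(3)[OF True] T_pos[of "k - 1"] by (simp add: field_simps)
  next
    case False
    then have "T k \<le> 6 / \<delta> * T (k - 1)" using T_pos[of k] \<delta> by (simp add: field_simps)
    also have "\<dots> \<le> E * T (k - 1)" using E(2) T_pos[of "k - 1"] by (intro mult_right_mono) auto
    finally show ?thesis .
  qed
  have "T (k + 1) \<le> 2 * E * T k" for k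
  proof -
    have "T (k + 1) \<le> E * T k" using step[of "k + 1"] by simp
    also have "\<dots> \<le> 2 * E * T k" using E(1) T_pos[of k] by simp
    finally show ?thesis .
  qed
  with E(1) show thesis by (rule that)
qed

end

locale block_construction = level_sequence +
  fixes E :: real and N :: nat
  assumes E_ge_2: "2 \<le> E" and step: "\<And>k. T (k + 1) \<le> 2 * E * T k"
    and N_large: "2 * E \<le> 2 ^ N" "6 \<le> E ^ N" "4 / \<delta> \<le> E ^ N"
begin

definition A :: real where "A = E ^ N"

definition B :: real where "B = A * E"

lemma A_ge: "6 \<le> A" "4 / \<delta> \<le> A"
  using N_large by (simp_all add: A_def)

lemma A_le_B: "A \<le> B" and B_ge_2: "2 \<le> B"
  using A_ge mult_mono[of A A 1 E] mult_mono[of 6 A 1 E] E_ge_2 by (auto simp: B_def)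

lemma V_step: "V (k + 1) \<le> E * V k"
  using step[of k] by (simp add: V_def powr_add field_simps)

lemma V_steps: "V (k + int m) \<le> E ^ m * V k"
proof (induction m)
  case (Suc m)
  have "V (k + int (Suc m)) \<le> E * V (k + int m)" using V_step[of "k + int m"] by (simp add: add_ac)
  also have "\<dots> \<le> E * (E ^ m * V k)" using Suc E_ge_2 by simp
  finally show ?case by simp
qed simp

definition rises :: "int \<Rightarrow> int \<Rightarrow> bool" where
  "rises u v \<longleftrightarrow> (\<exists>j k. u \<le> j \<and> j < k \<and> k \<le> v \<and> A * V j \<le> V k)"

lemma T_le_of_rises:
  assumes "rises u v"
  shows "2 * B * T u \<le> T v"
proof -
  obtain j k where jk: "u \<le> j" "j < k" "k \<le> v" "A * V j \<le> V k" using assms by (auto simp: rises_def)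
  define m where "m = nat (k - j)"
  have k: "k = j + int m" using jk by (simp add: m_def)
  have "E ^ N * V j \<le> E ^ m * V j" using jk(4) V_steps[of j m] k by (simp add: A_def)
  then have "N \<le> m" using V_pos[of j] E_ge_2 by (simp add: power_increasing_iff)
  then have "2 * E \<le> 2 ^ m" using N_large(1) power_increasing[of N m "2::real"] by linarith
  have "2 * B * T u \<le> 2 * B * T j" using jk B_ge_2 by (intro mult_left_mono) (auto simp: T_le_iff)
  also have "\<dots> = (2 * E) * (A * V j) * 2 powr of_int j" by (simp add: B_def T_eq)
  also have "\<dots> \<le> 2 ^ m * V k * 2 powr of_int j"
    using \<open>2 * E \<le> 2 ^ m\<close> jk(4) A_ge V_pos[of j] by (intro mult_right_mono mult_mono) auto
  also have "\<dots> = T k" by (simp add: T_eq k powr_add powr_realpow)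
  also have "\<dots> \<le> T v" using jk by (simp add: T_le_iff)
  finally show ?thesis .
qed

lemma V_le_of_not_rises:
  assumes "\<not> rises u v" "u \<le> k" "k \<le> l" "l \<le> v"
  shows "V l \<le> A * V k"
proof (cases "k = l")
  case True
  then show ?thesis using mult_right_mono[of 1 A "V l"] A_ge V_pos[of l] by simp
next
  case False
  then have "\<not> A * V k \<le> V l" using assms by (auto simp: rises_def)
  then show ?thesis by simp
qed

lemma V_le_on_block:
  assumes "\<not> rises u (v - 1) \<or> \<not> rises (u + 1) v" and kl: "u \<le> k" "k \<le> l" "l \<le> v"
  shows "V l \<le> B * V k"
proof (cases "k = l")
  case True
  then show ?thesis using mult_right_mono[of 1 B "V l"] B_ge_2 V_pos[of l] by simp
next
  case False
  have nonneg: "0 \<le> E" "0 \<le> A" using E_ge_2 A_ge by auto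
  from assms(1) have "V l \<le> E * (A * V k)"
  proof
    assume no_rise: "\<not> rises u (v - 1)"
    have "V l \<le> E * V (l - 1)" using V_step[of "l - 1"] by simp
    also have "\<dots> \<le> E * (A * V k)"
      using V_le_of_not_rises[OF no_rise, of k "l - 1"] kl False nonneg by (intro mult_left_mono) auto
    finally show ?thesis .
  next
    assume no_rise: "\<not> rises (u + 1) v"
    have "V l \<le> A * V (k + 1)" using V_le_of_not_rises[OF no_rise, of "k + 1" l] kl False by simp
    also have "\<dots> \<le> A * (E * V k)" using V_step nonneg by (intro mult_left_mono) auto
    finally show ?thesis by (simp add: mult_ac)
  qed
  then show ?thesis by (simp add: B_def mult_ac)
qed

text \<open>The inductive bound \<open>2\<close> leaves room for one more term, which is at most \<open>1 / 2\<close>, before the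
  smallness hypothesis of \<open>levels\<close> fails; \<open>levels\<close> then restores the bound \<open>2\<close>.\<close>

lemma sum_powr_rises_le:
  fixes I :: "int set"
  assumes "finite I" "inj_on k I" "\<And>i. i \<in> I \<Longrightarrow> j i < k i" "\<And>i. i \<in> I \<Longrightarrow> A * V (j i) \<le> V (k i)"
  shows "(\<Sum>i\<in>I. 2 powr of_int (j i - k i)) \<le> (2::real)"
  using assms
proof (induction I)
  case (insert x I)
  have ratio: "T (j i) / T (k i) \<le> 2 powr of_int (j i - k i) / A" if "i \<in> insert x I" for i
  proof -
    have "A * V (j i) * 2 powr of_int (j i) \<le> V (k i) * 2 powr of_int (j i)"
      using insert.prems(3)[OF that] by (intro mult_right_mono) auto
    then show ?thesis using A_ge T_pos[of "k i"] V_pos[of "k i"]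
      by (simp add: T_eq powr_diff field_simps)
  qed
  have "2 powr of_int (j x - k x) \<le> (2::real) powr - 1"
    using insert.prems(2)[of x] by (intro powr_mono) auto
  then have half: "2 powr of_int (j x - k x) \<le> (1 / 2 :: real)" by (simp add: powr_minus)
  have IH: "(\<Sum>i\<in>I. 2 powr of_int (j i - k i)) \<le> (2::real)"
    using insert.prems by (intro insert.IH) (auto intro: inj_on_subset)
  have "(\<Sum>i\<in>insert x I. T (j i) / T (k i)) \<le> (\<Sum>i\<in>insert x I. 2 powr of_int (j i - k i) / A)"
    by (intro sum_mono ratio)
  also have "\<dots> = (\<Sum>i\<in>insert x I. 2 powr of_int (j i - k i)) / A" by (simp add: sum_divide_distrib)
  also have "\<dots> \<le> (2 + 1 / 2) / A"
    using insert.hyps half IH A_ge by (intro divide_right_mono) auto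
  also have "\<dots> < \<delta>" using A_ge \<delta> by (simp add: field_simps)
  finally show ?case using insert by (intro levels) auto
qed simp

definition admissible :: "nat \<Rightarrow> int \<Rightarrow> int \<Rightarrow> bool" where
  "admissible n u v \<longleftrightarrow> rises u v \<or> 2 * B * T u \<le> (1 / 2) ^ n * T v"

lemma ex_admissible_right: "\<exists>v>u. admissible n u v"
proof -
  obtain k where "2 * B * T u * 2 ^ n \<le> T k" using T_large by blast
  also have "T k \<le> T (max k (u + 1))" by (simp add: T_le_iff)
  finally show ?thesis
    by (intro exI[of _ "max k (u + 1)"]) (auto simp: admissible_def power_one_over field_simps)
qed

lemma ex_admissible_left: "\<exists>u<v. admissible n u v"
proof -
  obtain k where k: "T k \<le> (1 / 2) ^ n * T v / (2 * B)"
    using T_small[of "(1 / 2) ^ n * T v / (2 * B)"] T_pos[of v] B_ge_2 by auto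
  have "T (min k (v - 1)) \<le> T k" by (simp add: T_le_iff)
  also note k
  finally have "2 * B * T (min k (v - 1)) \<le> (1 / 2) ^ n * T v" using B_ge_2 by (simp add: field_simps)
  then show ?thesis by (intro exI[of _ "min k (v - 1)"]) (auto simp: admissible_def)
qed

lemma T_le_of_admissible:
  assumes "admissible n u v"
  shows "2 * B * T u \<le> T v"
proof -
  have "(1 / 2) ^ n * T v \<le> 1 * T v"
    using T_pos[of v] by (intro mult_right_mono) (auto simp: power_le_one)
  then show ?thesis using assms T_le_of_rises by (auto simp: admissible_def)
qed

lemma sum_rising_blocks_le:
  fixes a :: "int \<Rightarrow> int"
  assumes a: "strict_mono a" and I: "finite I" "\<And>i. i \<in> I \<Longrightarrow> rises (a i) (a (i + 1))"
  shows "(\<Sum>i\<in>I. T (a i) / T (a (i + 1))) \<le> 2 / A"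
proof -
  have "\<exists>j k. \<forall>i\<in>I. a i \<le> j i \<and> j i < k i \<and> k i \<le> a (i + 1) \<and> A * V (j i) \<le> V (k i)"
    using I(2) unfolding rises_def by metis
  then obtain j k where jk: "\<And>i. i \<in> I \<Longrightarrow> a i \<le> j i \<and> j i < k i \<and> k i \<le> a (i + 1) \<and> A * V (j i) \<le> V (k i)"
    by blast
  have k_less: "k x < k y" if "x \<in> I" "y \<in> I" "x < y" for x y
  proof -
    have "a (x + 1) \<le> a y" using a that by (simp add: strict_mono_less_eq)
    then show ?thesis using jk[OF that(1)] jk[OF that(2)] by linarith
  qed
  have inj: "inj_on k I"
    using k_less by (intro inj_onI) (metis less_irrefl linorder_neqE)
  have "(\<Sum>i\<in>I. T (a i) / T (a (i + 1))) \<le> (\<Sum>i\<in>I. 2 powr of_int (j i - k i) / A)"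
  proof (rule sum_mono)
    fix i assume i: "i \<in> I"
    have "T (a i) / T (a (i + 1)) \<le> T (j i) / T (k i)"
      using jk[OF i] T_pos by (intro frac_le) (auto simp: T_le_iff less_imp_le)
    also have "\<dots> = V (j i) * 2 powr of_int (j i - k i) / V (k i)"
      by (simp add: T_eq powr_diff)
    also have "\<dots> \<le> 2 powr of_int (j i - k i) / A"
      using jk[OF i] A_ge V_pos[of "k i"] mult_right_mono[of "A * V (j i)" "V (k i)" "2 powr of_int (j i - k i)"]
      by (simp add: field_simps)
    finally show "T (a i) / T (a (i + 1)) \<le> 2 powr of_int (j i - k i) / A" .
  qed
  also have "\<dots> = (\<Sum>i\<in>I. 2 powr of_int (j i - k i)) / A" by (simp add: sum_divide_distrib)
  also have "\<dots> \<le> 2 / A"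
    using sum_powr_rises_le[OF I(1) inj] jk A_ge by (intro divide_right_mono) auto
  finally show ?thesis .
qed

lemma sum_small_blocks_le:
  assumes "finite I" "\<And>i. i \<in> I \<Longrightarrow> 2 * B * T (a i) \<le> (1 / 2) ^ block_rank i * T (a (i + 1))"
  shows "(\<Sum>i\<in>I. T (a i) / T (a (i + 1))) \<le> 2 / A"
proof -
  have "(\<Sum>i\<in>I. T (a i) / T (a (i + 1))) \<le> (\<Sum>i\<in>I. (1 / 2) ^ block_rank i / (2 * B))"
    using assms(2) B_ge_2 T_pos by (intro sum_mono) (simp add: field_simps)
  also have "\<dots> = (\<Sum>i\<in>I. (1 / 2) ^ block_rank i) / (2 * B)" by (simp add: sum_divide_distrib)
  also have "\<dots> \<le> 4 / (2 * B)"
    using sum_half_powers_block_rank_le[OF assms(1)] B_ge_2 by (intro divide_right_mono) auto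
  also have "\<dots> \<le> 2 / A" using A_ge A_le_B by (simp add: frac_le)
  finally show ?thesis .
qed

end

locale block_sequence = level_sequence +
  fixes a :: "int \<Rightarrow> int" and B E :: real
  assumes B_ge_2: "2 \<le> B" and E_ge_2: "2 \<le> E" and step: "\<And>k. T (k + 1) \<le> 2 * E * T k"
    and a_mono: "strict_mono a" and lacunary: "\<And>i. 2 * B * T (a i) \<le> T (a (i + 1))"
    and ratios: "\<And>I. finite I \<Longrightarrow> (\<Sum>i\<in>I. T (a i) / T (a (i + 1))) \<le> 1"
    and V_le: "\<And>i k l. a i \<le> k \<Longrightarrow> k \<le> l \<Longrightarrow> l \<le> a (i + 1) \<Longrightarrow> V l \<le> B * V k"

lemma (in block_construction) ex_block_sequence: "\<exists>a. block_sequence T \<delta> a B E"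
proof -
  obtain a where a: "strict_mono a" and adm: "\<And>i. admissible (block_rank i) (a i) (a (i + 1))"
    and minimal: "\<And>i. (\<forall>v. a i < v \<and> v < a (i + 1) \<longrightarrow> \<not> admissible (block_rank i) (a i) v)
      \<or> (\<forall>u. a i < u \<and> u < a (i + 1) \<longrightarrow> \<not> admissible (block_rank i) u (a (i + 1)))"
    using two_sided_greedy_sequence[of admissible, OF ex_admissible_right ex_admissible_left] by blast
  have "block_sequence T \<delta> a B E"
  proof unfold_locales
    show "(\<Sum>i\<in>I. T (a i) / T (a (i + 1))) \<le> 1" if I: "finite I" for I
    proof -
      let ?R = "{i \<in> I. rises (a i) (a (i + 1))}"
      have "(\<Sum>i\<in>I. T (a i) / T (a (i + 1)))
          = (\<Sum>i\<in>I - ?R. T (a i) / T (a (i + 1))) + (\<Sum>i\<in>?R. T (a i) / T (a (i + 1)))"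
        using I by (intro sum.subset_diff) auto
      also have "\<dots> \<le> 2 / A + 2 / A"
        using I adm by (intro add_mono sum_rising_blocks_le a sum_small_blocks_le) (auto simp: admissible_def)
      also have "\<dots> \<le> 1" using A_ge by (simp add: field_simps)
      finally show ?thesis .
    qed
    show "V l \<le> B * V k" if kl: "a i \<le> k" "k \<le> l" "l \<le> a (i + 1)" for i k l
    proof (rule V_le_on_block[OF _ kl])
      have "a i < a (i + 1)" using a by (simp add: strict_mono_less)
      moreover have "\<not> rises u u" for u by (auto simp: rises_def)
      ultimately show "\<not> rises (a i) (a (i + 1) - 1) \<or> \<not> rises (a i + 1) (a (i + 1))"
        using minimal[of i] by (cases "a (i + 1) = a i + 1") (auto simp: admissible_def)
    qed
    show "2 * B * T (a i) \<le> T (a (i + 1))" for i by (rule T_le_of_admissible[OF adm])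
  qed (use B_ge_2 E_ge_2 step a in auto)
  then show ?thesis by blast
qed

lemma (in level_sequence) ex_block_sequence: "\<exists>a B E. block_sequence T \<delta> a B E"
proof -
  obtain E where E: "2 \<le> E" "\<And>k. T (k + 1) \<le> 2 * E * T k" using step_bounded by blast
  have "\<exists>n. x \<le> b ^ n" if "2 \<le> b" for x b :: real
    using real_arch_pow[of b x] that by (auto intro: less_imp_le)
  then obtain n1 n2 n3 where n: "2 * E \<le> 2 ^ n1" "6 \<le> E ^ n2" "4 / \<delta> \<le> E ^ n3"
    using E(1) by (meson order_refl)
  define N where "N = max n1 (max n2 n3)"
  have "2 * E \<le> 2 ^ N" by (rule order_trans[OF n(1) power_increasing]) (auto simp: N_def)
  moreover have "6 \<le> E ^ N"
    by (rule order_trans[OF n(2) power_increasing]) (use E in \<open>auto simp: N_def\<close>)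
  moreover have "4 / \<delta> \<le> E ^ N"
    by (rule order_trans[OF n(3) power_increasing]) (use E in \<open>auto simp: N_def\<close>)
  ultimately have "block_construction T \<delta> E N"
    using E by unfold_locales auto
  then show ?thesis using block_construction.ex_block_sequence by blast
qed

section \<open>Construction of the N-function\<close>

lemma lacunary_growth:
  fixes X :: "int \<Rightarrow> real"
  assumes "0 < b" "\<And>i. b * X i \<le> X (i + 1)"
  shows "b ^ n * X i \<le> X (i + int n)"
proof (induction n)
  case (Suc n)
  have "b ^ Suc n * X i \<le> b * X (i + int n)" using Suc assms(1) by (simp add: mult.assoc)
  also have "\<dots> \<le> X (i + int n + 1)" by (rule assms(2))
  finally show ?case by (simp add: add_ac)
qed simp

lemma lacunary_large:
  fixes X :: "int \<Rightarrow> real"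
  assumes b_gt_1: "1 < b" and X: "\<And>i. 0 < X i" "\<And>i. b * X i \<le> X (i + 1)"
  obtains n where "y < X (i + int n)"
proof -
  obtain n where "y / X i < b ^ n" using real_arch_pow[OF b_gt_1] by blast
  then have "y < b ^ n * X i" using X(1)[of i] by (simp add: field_simps)
  also have "\<dots> \<le> X (i + int n)" using b_gt_1 X(2) by (intro lacunary_growth) auto
  finally show thesis by (rule that)
qed

lemma lacunary_small:
  fixes X :: "int \<Rightarrow> real"
  assumes b_gt_1: "1 < b" and X: "\<And>i. 0 < X i" "\<And>i. b * X i \<le> X (i + 1)" and y_pos: "0 < y"
  obtains i where "X i \<le> y"
proof -
  obtain n where n: "X 0 / y < b ^ n" using real_arch_pow[OF b_gt_1] by blast
  have "b ^ n * X (- int n) \<le> X (- int n + int n)"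
    using b_gt_1 X(2) by (intro lacunary_growth) auto
  also have "\<dots> \<le> b ^ n * y" using n y_pos by (simp add: field_simps)
  finally have "X (- int n) \<le> y" using b_gt_1 by simp
  then show thesis by (rule that)
qed

lemma lacunary_bracket:
  fixes X :: "int \<Rightarrow> real"
  assumes b_gt_1: "1 < b" and X: "\<And>i. 0 < X i" "\<And>i. b * X i \<le> X (i + 1)" and y_pos: "0 < y"
  obtains i where "X i \<le> y" "y < X (i + 1)"
proof -
  obtain i where i: "X i \<le> y" using lacunary_small[of b X y, OF b_gt_1 X y_pos] by blast
  define n where "n = (LEAST n. y < X (i + int n))"
  have "\<exists>n. y < X (i + int n)" using lacunary_large[of b X y i, OF b_gt_1 X] by blast
  then have n: "y < X (i + int n)" unfolding n_def by (rule LeastI_ex)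
  then obtain m where m: "n = Suc m" using i by (cases n) auto
  then have "\<not> y < X (i + int m)"
    using not_less_Least[of m "\<lambda>n. y < X (i + int n)"] by (simp add: n_def)
  then show thesis using that[of "i + int m"] n m by (simp add: add_ac)
qed

locale lacunary =
  fixes X :: "int \<Rightarrow> real" and B :: real
  assumes B_ge: "2 \<le> B" and X_pos: "\<And>i. 0 < X i" and X_step: "\<And>i. 2 * B * X i \<le> X (i + 1)"
begin

lemma X_B_step: "B * X i \<le> X (i + 1)"
  using X_step[of i] mult_pos_pos[of B "X i"] X_pos[of i] B_ge by linarith

lemma X_le_Suc: "X i \<le> X (i + 1)"
proof -
  have "1 * X i \<le> B * X i" using B_ge X_pos[of i] by (intro mult_right_mono) auto
  then show ?thesis using X_B_step[of i] by simp
qed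

lemma X_bracket:
  assumes "0 < y"
  obtains i where "X i \<le> y" "y < X (i + 1)"
  using lacunary_bracket[of B X y] B_ge X_pos X_B_step assms by auto

lemma
  shows ratio_small: "0 < y \<Longrightarrow> \<exists>i. X i / B powr of_int i \<le> y"
    and ratio_large: "\<exists>i. y \<le> X i / B powr of_int i"
proof -
  let ?Y = "\<lambda>i. X i / B powr of_int i"
  have Y: "0 < ?Y i" "2 * ?Y i \<le> ?Y (i + 1)" for i
    using X_pos[of i] X_step[of i] B_ge by (simp_all add: powr_add field_simps)
  show "\<exists>i. ?Y i \<le> y" if "0 < y"
    by (rule lacunary_small[of 2 ?Y y, OF _ Y that]) auto
  obtain n where "y < ?Y (0 + int n)" using lacunary_large[of 2 ?Y y 0, OF _ Y] by auto
  then show "\<exists>i. y \<le> ?Y i" by (blast intro: less_imp_le)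
qed

definition hat :: "int \<Rightarrow> real \<Rightarrow> real" where
  "hat i t = B powr of_int i * min 1 (t / X i)"

definition staircase :: "real \<Rightarrow> real" where
  "staircase t = (SUP i. hat i t)"

text \<open>The summand \<open>t / (X 0 + t)\<close> makes \<open>slow\<close> and \<open>t / slow t\<close> strictly increasing.\<close>

definition slow :: "real \<Rightarrow> real" where
  "slow t = staircase t + t / (X 0 + t)"

lemma hat_le:
  assumes t: "t \<le> X i"
  shows "hat j t \<le> B powr of_int i"
proof (cases "j \<le> i")
  case True
  have "hat j t \<le> B powr of_int j * 1" unfolding hat_def by (intro mult_left_mono) auto
  also have "\<dots> \<le> B powr of_int i" using True B_ge by simp
  finally show ?thesis .
next
  case False
  define n where "n = nat (j - i)"
  have j: "j = i + int n" using False by (simp add: n_def)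
  have "min 1 (t / X j) \<le> X i / X j"
    using t X_pos[of j] by (intro min.coboundedI2 divide_right_mono) auto
  then have "hat j t \<le> B powr of_int j * (X i / X j)" unfolding hat_def by (intro mult_left_mono) auto
  also have "\<dots> = B powr of_int i * (B ^ n * X i / X j)"
    using B_ge by (simp add: j powr_add powr_realpow)
  also have "\<dots> \<le> B powr of_int i * 1"
    using lacunary_growth[of B X n i] X_B_step B_ge X_pos[of j]
    by (intro mult_left_mono) (auto simp: j)
  finally show ?thesis by simp
qed

lemma hat_bdd: "bdd_above (range (\<lambda>i. hat i t))"
proof -
  obtain n where "t < X (0 + int n)" using lacunary_large[of B X t 0] B_ge X_pos X_B_step by auto
  then show ?thesis
    using hat_le[of t "0 + int n"] by (intro bdd_aboveI[of _ "B powr of_int (0 + int n)"]) auto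
qed

lemma hat_le_staircase: "hat i t \<le> staircase t"
  unfolding staircase_def by (rule cSUP_upper[OF _ hat_bdd]) simp

lemma staircase_le: "(\<And>i. hat i t \<le> c) \<Longrightarrow> staircase t \<le> c"
  unfolding staircase_def by (intro cSUP_least) auto

lemma staircase_mono:
  assumes "s \<le> t"
  shows "staircase s \<le> staircase t"
proof (rule staircase_le)
  fix i
  have "hat i s \<le> hat i t" unfolding hat_def
    using assms X_pos[of i] by (intro mult_left_mono min.mono divide_right_mono) auto
  then show "hat i s \<le> staircase t" using hat_le_staircase[of i t] by linarith
qed

lemma staircase_ratio:
  assumes "0 < s" "s \<le> t"
  shows "staircase t / t \<le> staircase s / s"
proof -
  have "staircase t \<le> t / s * staircase s"
  proof (rule staircase_le)
    fix i
    have "min 1 (t / X i) \<le> t / s * min 1 (s / X i)"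
      using assms X_pos[of i] by (auto simp: min_def field_simps)
    then have "hat i t \<le> B powr of_int i * (t / s * min 1 (s / X i))"
      unfolding hat_def by (rule mult_left_mono) simp
    also have "\<dots> = t / s * hat i s" by (simp add: hat_def)
    also have "\<dots> \<le> t / s * staircase s"
      using hat_le_staircase[of i s] assms by (intro mult_left_mono) auto
    finally show "hat i t \<le> t / s * staircase s" .
  qed
  then show ?thesis using assms by (simp add: field_simps)
qed

lemma staircase_nonneg:
  assumes "0 \<le> t"
  shows "0 \<le> staircase t"
proof -
  have "0 \<le> hat 0 t" using assms X_pos[of 0] by (simp add: hat_def)
  then show ?thesis using hat_le_staircase[of 0 t] by linarith
qed

lemma slow_zero: "slow 0 = 0"
  using staircase_le[of 0 0] staircase_nonneg[of 0] by (simp add: slow_def hat_def)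

lemma slow_less:
  assumes "0 \<le> s" "s < t"
  shows "slow s < slow t"
proof -
  have "s / (X 0 + s) < t / (X 0 + t)" using assms X_pos[of 0] by (simp add: field_simps)
  then show ?thesis using staircase_mono[of s t] assms by (simp add: slow_def)
qed

lemma slow_pos: "0 < t \<Longrightarrow> 0 < slow t"
  using slow_less[of 0 t] slow_zero by simp

lemma slow_ratio_less:
  assumes "0 < s" "s < t"
  shows "slow t / t < slow s / s"
proof -
  have "1 / (X 0 + t) < 1 / (X 0 + s)" using assms X_pos[of 0] by (intro divide_strict_left_mono) auto
  then show ?thesis
    using staircase_ratio[of s t] assms X_pos[of 0] by (simp add: slow_def add_divide_distrib)
qed

lemma slow_ge:
  assumes "X i \<le> t"
  shows "B powr of_int i \<le> slow t"
proof -
  have t_pos: "0 < t" using assms X_pos[of i] by linarith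
  then have "B powr of_int i = hat i t" using assms X_pos[of i] by (simp add: hat_def)
  also have "\<dots> \<le> staircase t" by (rule hat_le_staircase)
  finally show ?thesis using t_pos X_pos[of 0] by (simp add: slow_def add_increasing2)
qed

lemma slow_le:
  assumes "0 \<le> t" "t \<le> X i"
  shows "slow t \<le> 2 * B powr of_int i"
proof -
  have "t / (X 0 + t) \<le> min 1 (t / X 0)" using assms(1) X_pos[of 0] by (auto intro: divide_left_mono)
  also have "\<dots> = hat 0 t" using B_ge by (simp add: hat_def)
  also have "\<dots> \<le> B powr of_int i" by (rule hat_le[OF assms(2)])
  finally show ?thesis using staircase_le[of t, OF hat_le[OF assms(2)]] by (simp add: slow_def)
qed

lemma phi_function_slow: "phi_function slow"
proof (rule phi_function_of_quasi_concave)
  show "slow t / t \<le> slow s / s" if "0 < s" "s \<le> t" for s t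
    using slow_ratio_less[of s t] that by (cases "s = t") auto
  have powr: "B * B powr of_int i \<le> B powr of_int (i + 1)" for i
    using B_ge by (simp add: powr_add)
  show "\<exists>t>0. slow t \<le> e" if "0 < e" for e
  proof -
    obtain i where "B powr of_int i \<le> e / 2"
      using lacunary_small[of B "\<lambda>i. B powr of_int i" "e / 2"] B_ge powr \<open>0 < e\<close> by auto
    then show ?thesis using slow_le[of "X i" i] X_pos[of i] by (intro exI[of _ "X i"]) auto
  qed
  show "\<exists>t>0. y \<le> slow t" for y
  proof -
    obtain n where "y < B powr of_int (0 + int n)"
      using lacunary_large[of B "\<lambda>i. B powr of_int i" y 0] B_ge powr by auto
    then show ?thesis using slow_ge[of "0 + int n" "X (0 + int n)"] X_pos
      by (intro exI[of _ "X (0 + int n)"]) auto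
  qed
qed (use slow_zero slow_less in auto)

lemma phi_function_div_slow: "phi_function (\<lambda>t. t / slow t)"
proof (rule phi_function_of_quasi_concave)
  show "s / slow s < t / slow t" if "0 \<le> s" "s < t" for s t
    using slow_ratio_less[of s t] slow_pos[of s] slow_pos[of t] that
    by (cases "s = 0") (simp_all add: field_simps)
  show "t / slow t / t \<le> s / slow s / s" if "0 < s" "s \<le> t" for s t
    using slow_less[of s t] that slow_pos[of s] by (cases "s = t") (auto simp: field_simps)
  show "\<exists>t>0. t / slow t \<le> e" if e_pos: "0 < e" for e
  proof -
    obtain i where i: "X i / B powr of_int i \<le> e" using ratio_small[OF e_pos] by blast
    have "X i / slow (X i) \<le> X i / B powr of_int i"
      using slow_ge[of i "X i"] X_pos[of i] B_ge slow_pos[of "X i"] by (intro divide_left_mono) auto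
    then show ?thesis using i X_pos[of i] by (intro exI[of _ "X i"]) auto
  qed
  show "\<exists>t>0. y \<le> t / slow t" for y
  proof -
    obtain i where i: "2 * y \<le> X i / B powr of_int i" using ratio_large by blast
    have "X i / (2 * B powr of_int i) \<le> X i / slow (X i)"
      using slow_le[of "X i" i] X_pos[of i] B_ge slow_pos[of "X i"] by (intro divide_left_mono) auto
    then show ?thesis using i X_pos[of i] by (intro exI[of _ "X i"]) (auto simp: field_simps)
  qed
qed simp

definition shell :: "int \<Rightarrow> real set" where
  "shell i = {1 / X (i + 1)<..1 / X i}"

lemma
  shows sets_shell: "shell i \<in> sets half_line"
    and emeasure_shell_le: "emeasure half_line (shell i) \<le> ennreal (1 / X i)"
proof -
  have "0 \<le> 1 / X (i + 1)" "1 / X (i + 1) \<le> 1 / X i"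
    using X_le_Suc[of i] X_pos[of i] X_pos[of "i + 1"] by (auto intro: frac_le)
  then show "shell i \<in> sets half_line" "emeasure half_line (shell i) \<le> ennreal (1 / X i)"
    unfolding shell_def by (auto simp: sets_half_line_Ioc emeasure_half_line_Ioc intro!: ennreal_leI)
qed

lemma ex_shell:
  assumes x_pos: "0 < x"
  obtains i where "x \<in> shell i"
proof -
  obtain i where "X i \<le> 1 / x" "1 / x < X (i + 1)" using X_bracket[of "1 / x"] x_pos by auto
  then have "x \<in> shell i"
    using x_pos X_pos[of i] X_pos[of "i + 1"] by (auto simp: shell_def field_simps)
  then show thesis by (rule that)
qed

lemma phi_inv_slow_le:
  assumes x: "x \<in> shell i"
  shows "phi_inv slow (slow (1 / x) / (2 * B\<^sup>2)) \<le> X (i - 1)"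
proof -
  have "0 < 1 / X (i + 1)" "1 / X (i + 1) < x" using x X_pos[of "i + 1"] by (auto simp: shell_def)
  then have x_pos: "0 < x" by linarith
  with \<open>1 / X (i + 1) < x\<close> have "1 / x < X (i + 1)" using X_pos[of "i + 1"] by (simp add: field_simps)
  then have "slow (1 / x) \<le> 2 * B powr of_int (i + 1)" using x_pos by (intro slow_le) auto
  then have "slow (1 / x) / (2 * B\<^sup>2) \<le> B powr of_int (i - 1)"
    using B_ge by (simp add: powr_add powr_diff power2_eq_square field_simps)
  also have "\<dots> \<le> slow (X (i - 1))" by (rule slow_ge) simp
  finally show ?thesis
    using x_pos X_pos[of "i - 1"] slow_pos[of "1 / x"] B_ge
    by (subst phi_inv_le_iff_le_phi[OF phi_function_slow]) auto
qed

lemma sum_shells_le_1: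
  assumes ratios: "\<And>I. finite I \<Longrightarrow> (\<Sum>i\<in>I. X i / X (i + 1)) \<le> 1" and I: "finite I"
  shows "(\<Sum>i\<in>I. ennreal (X (i - 1)) * emeasure half_line (shell i)) \<le> 1"
proof -
  have "(\<Sum>i\<in>I. ennreal (X (i - 1)) * emeasure half_line (shell i))
      \<le> (\<Sum>i\<in>I. ennreal (X (i - 1)) * ennreal (1 / X i))"
    by (intro sum_mono mult_left_mono emeasure_shell_le) simp
  also have "\<dots> = (\<Sum>i\<in>I. ennreal (X (i - 1) / X i))"
    using X_pos by (simp add: ennreal_mult[symmetric] less_imp_le)
  also have "\<dots> = ennreal (\<Sum>i\<in>I. X (i - 1) / X i)"
    using X_pos by (simp add: less_imp_le)
  also have "(\<Sum>i\<in>I. X (i - 1) / X i) = (\<Sum>i\<in>(\<lambda>i. i - 1) ` I. X i / X (i + 1))"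
    by (simp add: sum.reindex inj_on_def)
  also have "ennreal \<dots> \<le> 1" using ratios[of "(\<lambda>i. i - 1) ` I"] I by simp
  finally show ?thesis .
qed

lemma modular_slow_le_1:
  assumes ratios: "\<And>I. finite I \<Longrightarrow> (\<Sum>i\<in>I. X i / X (i + 1)) \<le> 1"
  shows "modular (phi_inv slow) (\<lambda>x. slow (1 / x) / (2 * B\<^sup>2)) \<le> 1"
proof -
  define c where "c n x = ennreal (X (int_decode n - 1)) * indicator (shell (int_decode n)) x" for n x
  have "modular (phi_inv slow) (\<lambda>x. slow (1 / x) / (2 * B\<^sup>2)) \<le> (\<integral>\<^sup>+ x. (\<Sum>n. c n x) \<partial>half_line)"
    unfolding modular_def
  proof (rule nn_integral_mono)
    fix x assume "x \<in> space half_line"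
    then have "0 < x" by (simp add: space_restrict_space)
    then obtain i where i: "x \<in> shell i" by (rule ex_shell)
    obtain n where n: "i = int_decode n" using bij_int_decode by (metis bij_pointE)
    have "ennreal (phi_inv slow (slow (1 / x) / (2 * B\<^sup>2))) \<le> (\<Sum>n\<in>{n}. c n x)"
      using phi_inv_slow_le[OF i] i by (simp add: c_def n ennreal_leI)
    also have "\<dots> \<le> (\<Sum>n. c n x)" by (rule sum_le_suminf) auto
    finally show "ennreal (phi_inv slow (slow (1 / x) / (2 * B\<^sup>2))) \<le> (\<Sum>n. c n x)" .
  qed
  also have "\<dots> = (\<Sum>n. ennreal (X (int_decode n - 1)) * emeasure half_line (shell (int_decode n)))"
    unfolding c_def using sets_shell by (simp add: nn_integral_suminf nn_integral_cmult_indicator)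
  also have "\<dots> \<le> 1"
  proof (rule suminf_le_const)
    fix N
    have "inj_on int_decode {..<N}" using bij_int_decode by (auto simp: inj_on_def bij_def)
    then have "(\<Sum>n<N. ennreal (X (int_decode n - 1)) * emeasure half_line (shell (int_decode n)))
        = (\<Sum>i\<in>int_decode ` {..<N}. ennreal (X (i - 1)) * emeasure half_line (shell i))"
      by (simp add: sum.reindex)
    also have "\<dots> \<le> 1" by (rule sum_shells_le_1[OF ratios]) auto
    finally show "(\<Sum>n<N. ennreal (X (int_decode n - 1)) * emeasure half_line (shell (int_decode n))) \<le> 1" .
  qed simp
  finally show ?thesis .
qed

end

lemma phi_equiv_refl: "phi_equiv F F"
  unfolding phi_equiv_def by (intro exI[of _ 1]) simp

lemma N_function_phi_inv_div:
  assumes \<rho>: "phi_function \<rho>" and ratio: "phi_function (\<lambda>t. t / \<rho> t)"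
  shows "N_function (phi_inv (\<lambda>t. t / \<rho> t))"
proof -
  define H where "H = phi_inv (\<lambda>t. t / \<rho> t)"
  have H: "phi_function H" unfolding H_def by (rule phi_function_phi_inv[OF ratio])
  define w where "w t = \<rho> (H t)" for t
  have w: "phi_function w" unfolding w_def by (rule phi_function_compose[OF \<rho> H])
  have Hw: "H t / t = w t" if t_pos: "0 < t" for t
  proof -
    have "0 < \<rho> (H t)" using t_pos by (simp add: phi_pos H \<rho>)
    moreover have "H t / \<rho> (H t) = t" unfolding H_def using phi_phi_inv[OF ratio, of t] t_pos by simp
    ultimately show ?thesis using t_pos by (simp add: w_def field_simps)
  qed
  have "strict_mono_on {0<..} (\<lambda>t. H t / t)"
    by (auto simp: strict_mono_on_def Hw phi_less_iff w)
  moreover have "filterlim (\<lambda>t. H t / t) at_top at_top"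
  proof (rule filterlim_cong[OF refl refl, THEN iffD1])
    show "eventually (\<lambda>t. w t = H t / t) at_top"
      using eventually_gt_at_top[of 0] by eventually_elim (simp add: Hw)
    show "filterlim w at_top at_top" using w by (simp add: phi_function_def)
  qed
  moreover have "((\<lambda>t. H t / t) \<longlongrightarrow> 0) (at_right 0)"
  proof (rule tendsto_cong[THEN iffD1])
    show "eventually (\<lambda>t. w t = H t / t) (at_right 0)"
      using eventually_at_right_less[of 0] by eventually_elim (simp add: Hw)
    have "(w \<longlongrightarrow> w 0) (at 0 within {0..})"
      using phi_continuous_on[OF w] by (simp add: continuous_on_def)
    then have "(w \<longlongrightarrow> w 0) (at_right 0)" by (rule tendsto_within_subset) auto
    then show "(w \<longlongrightarrow> 0) (at_right 0)" by (simp add: phi_zero w)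
  qed
  ultimately show ?thesis
    unfolding N_function_def H_def[symmetric] using H phi_equiv_refl by blast
qed

lemma condJ_phi_inv_div:
  assumes \<rho>: "phi_function \<rho>" and ratio: "phi_function (\<lambda>t. t / \<rho> t)"
    and c_pos: "0 < c" and J: "modular (phi_inv \<rho>) (\<lambda>x. \<rho> (1 / x) / c) \<le> 1"
  shows "condJ (phi_inv (\<lambda>t. t / \<rho> t))"
  unfolding condJ_def
proof (intro exI conjI)
  define Hs where "Hs = phi_inv \<rho>"
  have Hs: "phi_function Hs" unfolding Hs_def by (rule phi_function_phi_inv[OF \<rho>])
  have inv_Hs: "phi_inv Hs t = \<rho> t" if "0 \<le> t" for t
    unfolding Hs_def by (rule phi_inv_phi_inv[OF \<rho> that])
  have "phi_inv (phi_inv (\<lambda>t. t / \<rho> t)) t * phi_inv Hs t = t" if "0 \<le> t" for t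
    using that phi_pos[OF \<rho>, of t] by (cases "t = 0") (auto simp: phi_inv_phi_inv[OF ratio] inv_Hs)
  then show "complementary (phi_inv (\<lambda>t. t / \<rho> t)) Hs"
    unfolding complementary_def using Hs by (intro conjI exI[of _ 1]) auto
  have "modular Hs (\<lambda>x. \<bar>1 / phi_inv (tilde Hs) x\<bar> / c) = modular Hs (\<lambda>x. \<rho> (1 / x) / c)"
    by (rule modular_cong) (simp add: phi_inv_tilde Hs envelope_def inv_Hs phi_nonneg \<rho>)
  then have "lux Hs (\<lambda>x. 1 / phi_inv (tilde Hs) x) \<le> ennreal c"
    using J c_pos by (intro lux_le_of_modular_le_1) (auto simp: Hs_def)
  then show "lux Hs (\<lambda>x. 1 / phi_inv (tilde Hs) x) < \<infinity>" by (auto intro: le_less_trans)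
qed

lemma convex_on_SUP:
  fixes f :: "'i \<Rightarrow> 'a::real_vector \<Rightarrow> real"
  assumes "convex S" "I \<noteq> {}" and conv: "\<And>i. i \<in> I \<Longrightarrow> convex_on S (f i)"
    and bdd: "\<And>x. x \<in> S \<Longrightarrow> bdd_above ((\<lambda>i. f i x) ` I)"
  shows "convex_on S (\<lambda>x. SUP i\<in>I. f i x)"
proof (rule convex_onI)
  fix t :: real and x y assume t: "0 < t" "t < 1" and xy: "x \<in> S" "y \<in> S"
  show "(SUP i\<in>I. f i ((1 - t) *\<^sub>R x + t *\<^sub>R y)) \<le> (1 - t) * (SUP i\<in>I. f i x) + t * (SUP i\<in>I. f i y)"
  proof (rule cSUP_least[OF \<open>I \<noteq> {}\<close>])
    fix i assume i: "i \<in> I"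
    have "f i ((1 - t) *\<^sub>R x + t *\<^sub>R y) \<le> (1 - t) * f i x + t * f i y"
      using conv[OF i] t xy by (intro convex_onD) auto
    also have "\<dots> \<le> (1 - t) * (SUP i\<in>I. f i x) + t * (SUP i\<in>I. f i y)"
      using t by (intro add_mono mult_left_mono cSUP_upper i bdd xy) auto
    finally show "f i ((1 - t) *\<^sub>R x + t *\<^sub>R y) \<le> (1 - t) * (SUP i\<in>I. f i x) + t * (SUP i\<in>I. f i y)" .
  qed
qed (rule \<open>convex S\<close>)

lemma convex_on_max_0_diff: "convex_on {0..} (\<lambda>t. max 0 (t - s :: real))"
proof (rule convex_onI)
  fix a x y :: real assume a: "0 < a" "a < 1"
  have "(1 - a) * (x - s) \<le> (1 - a) * max 0 (x - s)" "a * (y - s) \<le> a * max 0 (y - s)"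
    "0 \<le> (1 - a) * max 0 (x - s)" "0 \<le> a * max 0 (y - s)"
    using a by (auto intro: mult_left_mono)
  moreover have "(1 - a) *\<^sub>R x + a *\<^sub>R y - s = (1 - a) * (x - s) + a * (y - s)"
    by (simp add: algebra_simps)
  ultimately show "max 0 ((1 - a) *\<^sub>R x + a *\<^sub>R y - s) \<le> (1 - a) * max 0 (x - s) + a * max 0 (y - s)"
    by simp
qed simp

definition ramp :: "(real \<Rightarrow> real) \<Rightarrow> real \<Rightarrow> real \<Rightarrow> real" where
  "ramp Q s t = Q s / s * max 0 (t - s)"

definition ramp_sup :: "(real \<Rightarrow> real) \<Rightarrow> real \<Rightarrow> real" where
  "ramp_sup Q t = (SUP s\<in>{0<..}. ramp Q s t)"

lemma ramp_le:
  assumes Q: "phi_function Q" and C_ge_1: "1 \<le> C"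
    and quasi: "\<And>s t. 0 < s \<Longrightarrow> s \<le> t \<Longrightarrow> Q s / s \<le> C * (Q t / t)"
    and s_pos: "0 < s" and t_nonneg: "0 \<le> t"
  shows "ramp Q s t \<le> C * Q t"
proof (cases "s < t")
  case True
  have "ramp Q s t \<le> Q s / s * t" unfolding ramp_def
    using s_pos True phi_pos[OF Q s_pos] by (intro mult_left_mono) auto
  also have "\<dots> \<le> C * (Q t / t) * t" using quasi[of s t] s_pos True by (intro mult_right_mono) auto
  finally show ?thesis using True s_pos by simp
next
  case False
  then show ?thesis using C_ge_1 phi_nonneg[OF Q t_nonneg] by (simp add: ramp_def)
qed

lemma
  assumes Q: "phi_function Q" and C_ge_1: "1 \<le> C"
    and quasi: "\<And>s t. 0 < s \<Longrightarrow> s \<le> t \<Longrightarrow> Q s / s \<le> C * (Q t / t)"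
  shows ramp_le_ramp_sup: "0 < s \<Longrightarrow> 0 \<le> t \<Longrightarrow> ramp Q s t \<le> ramp_sup Q t"
    and ramp_sup_le: "0 \<le> t \<Longrightarrow> ramp_sup Q t \<le> C * Q t"
    and convex_on_ramp_sup: "convex_on {0..} (ramp_sup Q)"
proof -
  have bdd: "bdd_above ((\<lambda>s. ramp Q s t) ` {0<..})" if "0 \<le> t" for t
    using ramp_le[OF Q C_ge_1 quasi] that by (intro bdd_aboveI[of _ "C * Q t"]) auto
  show "0 < s \<Longrightarrow> 0 \<le> t \<Longrightarrow> ramp Q s t \<le> ramp_sup Q t"
    unfolding ramp_sup_def by (intro cSUP_upper bdd) auto
  show "0 \<le> t \<Longrightarrow> ramp_sup Q t \<le> C * Q t"
    unfolding ramp_sup_def using ramp_le[OF Q C_ge_1 quasi] by (intro cSUP_least) auto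
  have "convex_on {0..} (ramp Q s)" if s_pos: "0 < s" for s
    unfolding ramp_def[abs_def] using phi_pos[OF Q s_pos] s_pos
    by (intro convex_on_cmul convex_on_max_0_diff) auto
  then show "convex_on {0..} (ramp_sup Q)"
    unfolding ramp_sup_def[abs_def] using bdd by (intro convex_on_SUP) auto
qed

lemma quasi_increasing_mult_le:
  assumes Q: "phi_function Q" and C_ge_1: "1 \<le> C"
    and quasi: "\<And>s t. 0 < s \<Longrightarrow> s \<le> t \<Longrightarrow> Q s / s \<le> C * (Q t / t)"
    and t_nonneg: "0 \<le> t"
  shows "C * Q t \<le> Q (C * C * t)"
proof (cases "t = 0")
  case False
  then have t_pos: "0 < t" using t_nonneg by simp
  have CC: "1 \<le> C * C" using mult_mono[OF C_ge_1 C_ge_1] C_ge_1 by simp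
  have "Q t / t \<le> C * (Q (C * C * t) / (C * C * t))"
    using t_pos CC mult_right_mono[OF CC, of t] by (intro quasi) auto
  also have "\<dots> = (Q (C * C * t) / C) / t" using C_ge_1 by simp
  finally show ?thesis using t_pos C_ge_1 by (simp add: field_simps)
qed (simp add: phi_zero Q)

lemma convex_equiv_of_quasi_increasing:
  assumes Q: "phi_function Q" and C_ge_1: "1 \<le> C"
    and quasi: "\<And>s t. 0 < s \<Longrightarrow> s \<le> t \<Longrightarrow> Q s / s \<le> C * (Q t / t)"
  shows "\<exists>K. convex_on {0..} K \<and> phi_equiv Q K"
proof (intro exI conjI)
  show "convex_on {0..} (ramp_sup Q)" by (rule convex_on_ramp_sup[OF Q C_ge_1 quasi])
  define c where "c = max 2 (C * C)"
  have c: "2 \<le> c" "C * C \<le> c" by (auto simp: c_def)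
  have lower: "Q (t / c) \<le> ramp_sup Q t" if t_nonneg: "0 \<le> t" for t
  proof (cases "t = 0")
    case True
    then show ?thesis using ramp_le_ramp_sup[OF Q C_ge_1 quasi, of 1 0]
      by (simp add: ramp_def phi_zero Q)
  next
    case False
    then have "Q (t / c) \<le> Q (t / 2)"
      using t_nonneg c by (subst phi_le_iff[OF Q]) (auto simp: field_simps)
    also have "\<dots> = ramp Q (t / 2) t" using t_nonneg False by (simp add: ramp_def)
    also have "\<dots> \<le> ramp_sup Q t"
      using t_nonneg False by (intro ramp_le_ramp_sup[OF Q C_ge_1 quasi]) auto
    finally show ?thesis .
  qed
  have upper: "ramp_sup Q t \<le> Q (c * t)" if t_nonneg: "0 \<le> t" for t
  proof -
    have "ramp_sup Q t \<le> C * Q t" by (rule ramp_sup_le[OF Q C_ge_1 quasi t_nonneg])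
    also have "\<dots> \<le> Q (C * C * t)" by (rule quasi_increasing_mult_le[OF Q C_ge_1 quasi t_nonneg])
    also have "\<dots> \<le> Q (c * t)"
      using t_nonneg c C_ge_1 by (subst phi_le_iff[OF Q]) (auto intro: mult_right_mono)
    finally show ?thesis .
  qed
  show "phi_equiv Q (ramp_sup Q)"
    unfolding phi_equiv_def using c lower upper by (intro exI[of _ c]) auto
qed

locale phi_block_sequence = block_sequence +
  fixes G :: "real \<Rightarrow> real"
  assumes G: "phi_function G" and T_def: "\<And>k. T k = phi_inv G (2 powr of_int k)"
begin

sublocale lacunary "\<lambda>i. T (a i)" B
  by unfold_locales (use B_ge_2 T_pos lacunary in auto)

lemma V_le_across_blocks:
  assumes "a i \<le> k" "k \<le> a (i + 1)" "a (i + int n) \<le> l" "l \<le> a (i + int n + 1)" "k \<le> l"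
  shows "V l \<le> B ^ (n + 1) * V k"
  using assms
proof (induction n arbitrary: l)
  case 0
  then show ?case using V_le[of i k l] by simp
next
  case (Suc n)
  let ?m = "a (i + int n + 1)"
  have index_eq: "i + int (Suc n) = i + int n + 1" by simp
  have "V l \<le> B * V ?m" using Suc.prems unfolding index_eq by (intro V_le[of "i + int n + 1"]) auto
  also have "\<dots> \<le> B * (B ^ (n + 1) * V k)"
  proof (intro mult_left_mono Suc.IH)
    show "a (i + int n) \<le> ?m" using a_mono by (simp add: strict_mono_less_eq)
    have "a (i + 1) \<le> ?m" using a_mono by (simp add: strict_mono_less_eq)
    then show "k \<le> ?m" using Suc.prems by linarith
  qed (use Suc.prems B_ge_2 in auto)
  finally show ?case by simp
qed

lemma slow_T_div_V_le:
  assumes "k \<le> l"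
  shows "slow (T k) / V k \<le> 2 * B\<^sup>2 * (slow (T l) / V l)"
proof -
  obtain i where i: "T (a i) \<le> T k" "T k < T (a (i + 1))" using X_bracket[OF T_pos] by blast
  obtain i' where i': "T (a i') \<le> T l" "T l < T (a (i' + 1))" using X_bracket[OF T_pos] by blast
  have ik: "a i \<le> k" "k < a (i + 1)" "a i' \<le> l" "l < a (i' + 1)"
    using i i' T_mono by (auto simp: strict_mono_less_eq strict_mono_less)
  then have "a i < a (i' + 1)" using assms by linarith
  then have "i < i' + 1" using a_mono by (simp add: strict_mono_less)
  define n where "n = nat (i' - i)"
  have n: "i' = i + int n" using \<open>i < i' + 1\<close> by (simp add: n_def)
  have "V l \<le> B ^ (n + 1) * V k" using ik assms n by (intro V_le_across_blocks) auto
  then have Vk: "1 / V k \<le> B ^ (n + 1) / V l" using V_pos[of k] V_pos[of l] by (simp add: field_simps)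
  have "slow (T k) * (1 / V k) \<le> (2 * B powr of_int (i + 1)) * (B ^ (n + 1) / V l)"
    using i T_pos[of k] slow_pos[OF T_pos, of k] V_pos[of k] B_ge_2
    by (intro mult_mono Vk slow_le) (auto simp: less_imp_le)
  also have "\<dots> = 2 * B\<^sup>2 * (B powr of_int i' / V l)"
    using B_ge_2 by (simp add: n powr_add powr_realpow power2_eq_square)
  also have "\<dots> \<le> 2 * B\<^sup>2 * (slow (T l) / V l)"
    using slow_ge[OF i'(1)] V_pos[of l] B_ge_2 by (intro mult_left_mono divide_right_mono) auto
  finally show ?thesis by simp
qed

lemma slow_T_Suc_le: "slow (T (k + 1)) \<le> 2 * E * slow (T k)"
proof -
  have pos: "0 < slow (T k)" "0 < slow (T (k + 1))" by (simp_all add: slow_pos T_pos)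
  have "T k / slow (T k) \<le> T (k + 1) / slow (T (k + 1))"
    using phi_le_iff[OF phi_function_div_slow, of "T k" "T (k + 1)"] T_pos
      by (simp add: T_le_iff less_imp_le)
  then have "slow (T (k + 1)) * T k \<le> T (k + 1) * slow (T k)" using pos by (simp add: field_simps)
  also have "\<dots> \<le> (2 * E * T k) * slow (T k)" using step[of k] pos by (intro mult_right_mono) auto
  finally show ?thesis using T_pos[of k] by simp
qed

definition level :: "real \<Rightarrow> int" where
  "level x = \<lfloor>log 2 (G x)\<rfloor>"

lemma
  assumes x_pos: "0 < x"
  shows powr_level: "2 powr of_int (level x) \<le> G x" "G x \<le> 2 powr of_int (level x + 1)"
    and T_level: "T (level x) \<le> x" "x \<le> T (level x + 1)"
proof -
  have Gx: "0 < G x" using x_pos by (simp add: phi_pos G)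
  have "of_int (level x) \<le> log 2 (G x)" "log 2 (G x) \<le> of_int (level x + 1)"
    unfolding level_def by linarith+
  then show powr: "2 powr of_int (level x) \<le> G x" "G x \<le> 2 powr of_int (level x + 1)"
    using Gx by (auto simp: le_log_iff log_le_iff)
  then show "T (level x) \<le> x" "x \<le> T (level x + 1)"
    using x_pos by (simp_all add: T_def phi_inv_le_iff_le_phi le_phi_inv_iff G)
qed

lemma level_mono: "0 < y \<Longrightarrow> y \<le> z \<Longrightarrow> level y \<le> level z"
  unfolding level_def using phi_pos[OF G, of y] phi_pos[OF G, of z]
  by (intro floor_mono) (simp add: phi_le_iff G)

lemma
  assumes x_pos: "0 < x"
  shows G_ratio_le: "G x / (x / slow x) \<le> 4 * E * (slow (T (level x)) / V (level x))"
    and le_G_ratio: "slow (T (level x)) / V (level x) \<le> 2 * E * (G x / (x / slow x))"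
proof -
  define k where "k = level x"
  note levels = powr_level[OF x_pos, folded k_def] T_level[OF x_pos, folded k_def]
  have pos: "0 < T k" "0 < slow (T k)" "0 < slow x" "0 < G x"
    using x_pos by (simp_all add: slow_pos T_pos phi_pos G)
  have "slow x \<le> slow (T (k + 1))" using levels(4) x_pos by (simp add: phi_le_iff phi_function_slow)
  then have slow_x: "slow x \<le> 2 * E * slow (T k)" using slow_T_Suc_le[of k] by linarith
  have "G x * slow x * (1 / x) \<le> 2 powr of_int (k + 1) * (2 * E * slow (T k)) * (1 / T k)"
    using levels slow_x x_pos pos E_ge_2 by (intro mult_mono divide_left_mono) (auto simp: less_imp_le)
  also have "\<dots> = 4 * E * (slow (T k) / V k)" by (simp add: V_def powr_add)
  finally show "G x / (x / slow x) \<le> 4 * E * (slow (T (level x)) / V (level x))" by (simp add: k_def)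
  have "x \<le> 2 * E * T k" using levels(4) step[of k] by linarith
  then have inverse_T: "1 / T k \<le> 2 * E / x" using x_pos pos by (simp add: field_simps)
  have "slow (T k) \<le> slow x" using levels(3) x_pos pos by (simp add: phi_le_iff phi_function_slow)
  then have "2 powr of_int k * slow (T k) * (1 / T k) \<le> G x * slow x * (2 * E / x)"
    using levels(1) inverse_T pos by (intro mult_mono) (auto simp: less_imp_le)
  then show "slow (T (level x)) / V (level x) \<le> 2 * E * (G x / (x / slow x))"
    by (simp add: V_def k_def mult_ac)
qed

lemma G_ratio_quasi_mono:
  assumes "0 < y" "y \<le> z"
  shows "G y / (y / slow y) \<le> 16 * E\<^sup>2 * B\<^sup>2 * (G z / (z / slow z))"
proof -
  have z_pos: "0 < z" using assms by simp
  have E_nonneg: "0 \<le> E" using E_ge_2 by simp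
  have "G y / (y / slow y) \<le> 4 * E * (slow (T (level y)) / V (level y))"
    by (rule G_ratio_le[OF assms(1)])
  also have "\<dots> \<le> 4 * E * (2 * B\<^sup>2 * (slow (T (level z)) / V (level z)))"
    using E_nonneg by (intro mult_left_mono slow_T_div_V_le level_mono assms) auto
  also have "\<dots> \<le> 4 * E * (2 * B\<^sup>2 * (2 * E * (G z / (z / slow z))))"
    using E_nonneg by (intro mult_left_mono le_G_ratio z_pos) auto
  also have "\<dots> = 16 * E\<^sup>2 * B\<^sup>2 * (G z / (z / slow z))" by (simp add: power2_eq_square)
  finally show ?thesis .
qed

theorem ex_N_function:
  "\<exists>H. N_function H \<and> condJ H \<and> (\<exists>K. convex_on {0..} K \<and> phi_equiv (\<lambda>u. G (H u)) K)"
proof (rule exI[of _ "phi_inv (\<lambda>t. t / slow t)"], intro conjI)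
  let ?H = "phi_inv (\<lambda>t. t / slow t)"
  show "N_function ?H" by (rule N_function_phi_inv_div[OF phi_function_slow phi_function_div_slow])
  show "condJ ?H"
    by (rule condJ_phi_inv_div[OF phi_function_slow phi_function_div_slow _ modular_slow_le_1])
      (use B_ge_2 ratios in auto)
  have H: "phi_function ?H" by (rule phi_function_phi_inv[OF phi_function_div_slow])
  show "\<exists>K. convex_on {0..} K \<and> phi_equiv (\<lambda>u. G (?H u)) K"
  proof (rule convex_equiv_of_quasi_increasing)
    show "phi_function (\<lambda>u. G (?H u))" by (rule phi_function_compose[OF G H])
    show "1 \<le> 16 * E\<^sup>2 * B\<^sup>2"
      using mult_mono[of 1 "E\<^sup>2" 1 "B\<^sup>2"] one_le_power[of E 2] one_le_power[of B 2] E_ge_2 B_ge_2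
        by simp
    fix s t :: real assume st: "0 < s" "s \<le> t"
    have "?H u / slow (?H u) = u" if "0 < u" for u
      using phi_phi_inv[OF phi_function_div_slow, of u] that by simp
    moreover have "0 < ?H s" "?H s \<le> ?H t" using st by (simp_all add: phi_pos phi_le_iff H)
    ultimately show "G (?H s) / s \<le> 16 * E\<^sup>2 * B\<^sup>2 * (G (?H t) / t)"
      using G_ratio_quasi_mono[of "?H s" "?H t"] st by simp
  qed
qed

end

theorem ex_N_function_of_normable:
  assumes F: "phi_function F" and G: "phi_function G" and norm: "normable F G"
  shows "\<exists>H. N_function H \<and> condJ H \<and> (\<exists>K. convex_on {0..} K \<and> phi_equiv (\<lambda>u. G (H u)) K)"
proof -
  define T where "T k = phi_inv G (2 powr of_int k)" for k :: int
  obtain \<delta> where \<delta>: "0 < \<delta>" and levels: "\<And>(I :: int set) j k. finite I \<Longrightarrow> inj_on k I \<Longrightarrow>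
      (\<Sum>i\<in>I. T (j i) / T (k i)) < \<delta> \<Longrightarrow> (\<Sum>i\<in>I. 2 powr of_int (j i - k i)) \<le> (2::real)"
    using normable_levels[OF F G norm] unfolding T_def by blast
  have powr: "(0::real) < 2 powr of_int k" "2 * 2 powr of_int k \<le> (2::real) powr of_int (k + 1)" for k
    by (simp_all add: powr_add)
  have "level_sequence T \<delta>"
  proof
    show "0 < T k" for k by (simp add: T_def phi_inv_pos G)
    show "strict_mono T" by (rule strict_monoI) (simp add: T_def phi_inv_less_iff G)
    show "\<exists>k. T k \<le> e" if e_pos: "0 < e" for e
      by (rule lacunary_small[of 2 "\<lambda>k. 2 powr of_int k" "G e", OF _ powr phi_pos[OF G e_pos]])
        (use e_pos in \<open>auto simp: T_def phi_inv_le_iff_le_phi G\<close>)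
    show "\<exists>k. e \<le> T k" for e
    proof -
      obtain n where "G (max e 0) < 2 powr of_int (0 + int n)"
        using lacunary_large[of 2 "\<lambda>k. 2 powr of_int k" "G (max e 0)" 0, OF _ powr] by auto
      then have "max e 0 \<le> T (0 + int n)" by (simp only: T_def) (subst le_phi_inv_iff[OF G]; simp)
      then show ?thesis by (intro exI[of _ "0 + int n"]) simp
    qed
  qed (use \<delta> levels in auto)
  then obtain a B E where "block_sequence T \<delta> a B E" using level_sequence.ex_block_sequence by blast
  then have "phi_block_sequence T \<delta> a B E G"
    by (intro phi_block_sequence.intro phi_block_sequence_axioms.intro G T_def)
  then show ?thesis by (rule phi_block_sequence.ex_N_function)
qed

theorem theorem5p3:
  fixes F G :: "real \<Rightarrow> real" and p :: real
  assumes "phi_function F" and "phi_function G" and "0 < p"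
  shows "(ereal p < lower_boyd F G \<and>
           (\<exists>H. N_function H \<and> condJ H \<and> phi_succ G (\<lambda>t. phi_inv H (t powr p)))
          \<longrightarrow> p_convex F G p)
       \<and> (p_convex F G p \<longrightarrow>
           ereal p \<le> lower_boyd F G \<and>
           (\<exists>H. N_function H \<and> condJ H \<and> phi_succ G (\<lambda>t. phi_inv H (t powr p))))"
proof -
  define F' G' where "F' = root_scale p F" and "G' = root_scale p G"
  have F': "phi_function F'" and G': "phi_function G'"
    using assms by (simp_all add: F'_def G'_def phi_function_root_scale)
  have succ_iff: "phi_succ G (\<lambda>t. phi_inv H (t powr p)) \<longleftrightarrow> (\<exists>K. convex_on {0..} K \<and> phi_equiv (\<lambda>u. G' (H u)) K)"
    if "N_function H" for H
    using that assms(3) by (simp add: G'_def phi_succ_phi_inv_powr_iff N_function_def)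
  have "p_convex F G p" if boyd: "ereal p < lower_boyd F G"
    and H: "N_function H" "condJ H" "phi_succ G (\<lambda>t. phi_inv H (t powr p))" for H
  proof -
    obtain q where "p < q" "boyd_exponent F G q"
      using boyd by (auto simp: lower_boyd_eq_Sup assms less_Sup_iff)
    then have q: "boyd_exponent F' G' (q / p)" "1 < q / p"
      using assms by (simp_all add: F'_def G'_def boyd_exponent_root_scale)
    obtain C where "decreasing_sum_bound G' C"
      using H succ_iff[OF H(1)] ex_decreasing_sum_bound_of_condJ[OF G'] by (auto simp: N_function_def)
    from normable_of_boyd_exponent[OF F' G' q this] show ?thesis
      unfolding F'_def G'_def by (rule p_convex_of_normable[OF assms])
  qed
  moreover have "ereal p \<le> lower_boyd F G"
    and "\<exists>H. N_function H \<and> condJ H \<and> phi_succ G (\<lambda>t. phi_inv H (t powr p))" if "p_convex F G p"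
  proof -
    have norm: "normable F' G'" unfolding F'_def G'_def by (rule normable_of_p_convex[OF assms that])
    have "boyd_exponent F' G' (p / p)" using boyd_exponent_1_of_normable[OF F' G' norm] assms(3) by simp
    then have "boyd_exponent F G p" unfolding F'_def G'_def
      by (rule boyd_exponent_of_root_scale[OF assms])
    then show "ereal p \<le> lower_boyd F G" by (auto simp: lower_boyd_eq_Sup assms intro: Sup_upper)
    show "\<exists>H. N_function H \<and> condJ H \<and> phi_succ G (\<lambda>t. phi_inv H (t powr p))"
      using ex_N_function_of_normable[OF F' G' norm] succ_iff by blast
  qed
  ultimately show ?thesis by blast
qed

end
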